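(* Let $\mathcal{L}$ be a backward parabolic operator on $[0,T]\times\mathbb{R}^n$, $$\mathcal{L}u=\partial_t u+\sum_{i,j=1}^n\partial_{x_i}\left(a_{i,j}(t)\partial_{x_j}u\right)+\sum_{j=1}^n b_j(t)\partial_{x_j}u+c(t)u,$$ satisfying the structural assumptions (S) listed in the context, where the coefficients $a_{i,j}$ have the regularity given by $$\omega(s)=s(1-\log s)\log(1-\log s),\qquad s\in\,]0,e^{1-e}].$$ Then for all $T'\in\,]0,T[$ and all $D>0$ there exist $\widetilde\rho>0$, $\widetilde\sigma>0$, $\widetilde\tau>0$ and $\widetilde\delta\in\,]0,1[$ such that, if $u\in\mathcal{H}_0$ is a solution of $\mathcal{L}u=0$ on $[0,T]\times\mathbb{R}^n$ with $\|u(t,\cdot)\|_{L^2}\le D$ for all $t\in[0,T]$ and $\|u(0,\cdot)\|_{L^2}\le\widetilde\rho$, then $$\sup_{z\in[0,T']}\|u(z,\cdot)\|^2_{L^2}\le\exp\left\{-\widetilde\sigma\exp\left[\left(\log\left(\frac{1}{2\widetilde\tau}\left|\log\|u(0,\cdot)\|^2_{L^2}\right|\right)\right)^{\widetilde\delta}\right]\right\}$$ (the right-hand side being read as $0$ if $u(0,\cdot)=0$).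
   Context: $T>0$, $n\ge1$. Assumptions (S) on $\mathcal{L}$ (all coefficients depend on $t$ only; $a_{i,j}$ are real-valued, $b_i,c$ are bounded and may be complex-valued): $a_{i,j}(t)=a_{j,i}(t)$ for all $i,j$ and $t\in[0,T]$; there is $k_A\in\,]0,1[$ with $k_A|\xi|^2\le\sum_{i,j}a_{i,j}(t)\xi_i\xi_j\le k_A^{-1}|\xi|^2$ for all $(t,\xi)\in[0,T]\times\mathbb{R}^n$; there are $k_B,k_C>0$ with $|b_i(t)|\le k_B$ and $|c(t)|\le k_C$ for all $t\in[0,T]$ and all $i$; and $\sup_{0<|t-s|\le e^{1-e}}\frac{|a_{i,j}(t)-a_{i,j}(s)|}{\omega(|t-s|)}<+\infty$ for all $i,j$, with the function $\omega$ given in the claim. $\mathcal{H}_0=C([0,T],L^2)\cap C([0,T[,H^1)\cap C^1([0,T[,L^2)$, where $L^2=L^2(\mathbb{R}^n)$, $H^1=H^1(\mathbb{R}^n)$. A solution $u\in\mathcal{H}_0$ of $\mathcal{L}u=0$ satisfies the equation in $H^{-1}(\mathbb{R}^n)$ for a.e. $t\in\,]0,T[$. *)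

theory Defs
  imports "HOL-Analysis.Analysis"
begin

section \<open>Sobolev spaces on \<open>\<real>\<^sup>n\<close>\<close>

text \<open>Elements of \<open>L\<^sup>2\<close> are handled through representatives, complex-valued functions
  on \<open>\<real>\<^sup>n\<close> (\<open>n = CARD('n)\<close>); no notion below depends on the choice of representatives.\<close>

definition L2 :: "(real^'n \<Rightarrow> complex) set" where
  "L2 = {f \<in> borel_measurable lebesgue. integrable lebesgue (\<lambda>x. (norm (f x))\<^sup>2)}"

definition L2_norm :: "(real^'n \<Rightarrow> complex) \<Rightarrow> real" where
  "L2_norm f = sqrt (integral\<^sup>L lebesgue (\<lambda>x. (norm (f x))\<^sup>2))"

definition partial :: "'n \<Rightarrow> (real^'n \<Rightarrow> complex) \<Rightarrow> real^'n \<Rightarrow> complex" where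
  "partial i f x = frechet_derivative f (at x) (axis i 1)"

fun Ck :: "nat \<Rightarrow> (real^'n \<Rightarrow> complex) \<Rightarrow> bool" where
  "Ck 0 f \<longleftrightarrow> continuous_on UNIV f"
| "Ck (Suc k) f \<longleftrightarrow> f differentiable_on UNIV \<and> (\<forall>i. Ck k (partial i f))"

definition test_fun :: "(real^'n \<Rightarrow> complex) set" where
  "test_fun = {\<phi>. (\<forall>k. Ck k \<phi>) \<and> compact (closure {x. \<phi> x \<noteq> 0})}"

definition has_weak_partial ::
    "'n \<Rightarrow> (real^'n \<Rightarrow> complex) \<Rightarrow> (real^'n \<Rightarrow> complex) \<Rightarrow> bool" where
  "has_weak_partial i f g \<longleftrightarrow>
     (\<forall>\<phi>\<in>test_fun. integral\<^sup>L lebesgue (\<lambda>x. f x * partial i \<phi> x)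
                  = - integral\<^sup>L lebesgue (\<lambda>x. g x * \<phi> x))"

definition H1 :: "(real^'n \<Rightarrow> complex) set" where
  "H1 = {f \<in> L2. \<forall>i. \<exists>g\<in>L2. has_weak_partial i f g}"

definition weak_partial :: "'n \<Rightarrow> (real^'n \<Rightarrow> complex) \<Rightarrow> real^'n \<Rightarrow> complex" where
  "weak_partial i f = (SOME g. g \<in> L2 \<and> has_weak_partial i f g)"

definition H1_norm :: "(real^'n \<Rightarrow> complex) \<Rightarrow> real" where
  "H1_norm f = sqrt ((L2_norm f)\<^sup>2 + (\<Sum>i\<in>UNIV. (L2_norm (weak_partial i f))\<^sup>2))"

text \<open>\<open>H\<^sup>-\<^sup>1\<close> is the dual of \<open>H\<^sup>1\<close> under the bilinear pairing \<open>\<integral> f \<phi>\<close>, as for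
  distributions. The next two definitions give the functionals on \<open>H\<^sup>1\<close> corresponding to
  \<open>f\<close> and to \<open>\<partial>f/\<partial>x\<^sub>i\<close> for \<open>f\<close> in \<open>L\<^sup>2\<close>.\<close>

definition dual_L2 :: "(real^'n \<Rightarrow> complex) \<Rightarrow> (real^'n \<Rightarrow> complex) \<Rightarrow> complex" where
  "dual_L2 f \<phi> = integral\<^sup>L lebesgue (\<lambda>x. f x * \<phi> x)"

definition dual_partial :: "'n \<Rightarrow> (real^'n \<Rightarrow> complex) \<Rightarrow> (real^'n \<Rightarrow> complex) \<Rightarrow> complex" where
  "dual_partial i f \<phi> = - dual_L2 f (weak_partial i \<phi>)"


section \<open>Functions of time with values in \<open>L\<^sup>2\<close> and \<open>H\<^sup>1\<close>\<close>

definition C_L2 :: "real set \<Rightarrow> (real \<Rightarrow> real^'n \<Rightarrow> complex) set" where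
  "C_L2 S = {u. \<forall>t\<in>S. u t \<in> L2 \<and> ((\<lambda>s. L2_norm (\<lambda>x. u s x - u t x)) \<longlongrightarrow> 0) (at t within S)}"

definition C_H1 :: "real set \<Rightarrow> (real \<Rightarrow> real^'n \<Rightarrow> complex) set" where
  "C_H1 S = {u. \<forall>t\<in>S. u t \<in> H1 \<and> ((\<lambda>s. H1_norm (\<lambda>x. u s x - u t x)) \<longlongrightarrow> 0) (at t within S)}"

definition has_L2_deriv ::
    "(real \<Rightarrow> real^'n \<Rightarrow> complex) \<Rightarrow> (real^'n \<Rightarrow> complex) \<Rightarrow> real \<Rightarrow> real set \<Rightarrow> bool" where
  "has_L2_deriv u v t S \<longleftrightarrow> v \<in> L2 \<and>
     ((\<lambda>s. L2_norm (\<lambda>x. (u s x - u t x) / of_real (s - t) - v x)) \<longlongrightarrow> 0) (at t within S)"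

definition L2_deriv ::
    "real set \<Rightarrow> (real \<Rightarrow> real^'n \<Rightarrow> complex) \<Rightarrow> real \<Rightarrow> real^'n \<Rightarrow> complex" where
  "L2_deriv S u t = (SOME v. has_L2_deriv u v t S)"

definition C1_L2 :: "real set \<Rightarrow> (real \<Rightarrow> real^'n \<Rightarrow> complex) set" where
  "C1_L2 S = {u \<in> C_L2 S. (\<forall>t\<in>S. \<exists>v. has_L2_deriv u v t S) \<and> L2_deriv S u \<in> C_L2 S}"

definition H0_space :: "real \<Rightarrow> (real \<Rightarrow> real^'n \<Rightarrow> complex) set" where
  "H0_space T = C_L2 {0..T} \<inter> C_H1 {0..<T} \<inter> C1_L2 {0..<T}"


section \<open>The backward parabolic operator\<close>

definition omega :: "real \<Rightarrow> real" where
  "omega s = s * (1 - ln s) * ln (1 - ln s)"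

definition structural_assms ::
    "real \<Rightarrow> ('n::finite \<Rightarrow> 'n \<Rightarrow> real \<Rightarrow> real) \<Rightarrow> ('n \<Rightarrow> real \<Rightarrow> complex) \<Rightarrow> (real \<Rightarrow> complex) \<Rightarrow> bool" where
  "structural_assms T a b c \<longleftrightarrow>
     (\<forall>i j. \<forall>t\<in>{0..T}. a i j t = a j i t) \<and>
     (\<exists>kA. 0 < kA \<and> kA < 1 \<and>
        (\<forall>t\<in>{0..T}. \<forall>\<xi>::real^'n.
           kA * (norm \<xi>)\<^sup>2 \<le> (\<Sum>i\<in>UNIV. \<Sum>j\<in>UNIV. a i j t * (\<xi> $ i) * (\<xi> $ j)) \<and>
           (\<Sum>i\<in>UNIV. \<Sum>j\<in>UNIV. a i j t * (\<xi> $ i) * (\<xi> $ j)) \<le> inverse kA * (norm \<xi>)\<^sup>2)) \<and>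
     (\<exists>kB>0. \<forall>i. \<forall>t\<in>{0..T}. norm (b i t) \<le> kB) \<and>
     (\<exists>kC>0. \<forall>t\<in>{0..T}. norm (c t) \<le> kC) \<and>
     (\<forall>i j. bdd_above {\<bar>a i j t - a i j s\<bar> / omega \<bar>t - s\<bar> | t s.
        t \<in> {0..T} \<and> s \<in> {0..T} \<and> 0 < \<bar>t - s\<bar> \<and> \<bar>t - s\<bar> \<le> exp (1 - exp 1)})"

text \<open>The functional \<open>\<L>u(t)\<close> in \<open>H\<^sup>-\<^sup>1\<close>, for \<open>w = u(t)\<close> in \<open>H\<^sup>1\<close> and \<open>v = \<partial>\<^sub>tu(t)\<close> in \<open>L\<^sup>2\<close>.\<close>

definition L_op ::
    "('n::finite \<Rightarrow> 'n \<Rightarrow> real \<Rightarrow> real) \<Rightarrow> ('n \<Rightarrow> real \<Rightarrow> complex) \<Rightarrow> (real \<Rightarrow> complex) \<Rightarrow> real \<Rightarrow>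
     (real^'n \<Rightarrow> complex) \<Rightarrow> (real^'n \<Rightarrow> complex) \<Rightarrow> (real^'n \<Rightarrow> complex) \<Rightarrow> complex" where
  "L_op a b c t v w \<phi> =
     dual_L2 v \<phi>
     + (\<Sum>i\<in>UNIV. \<Sum>j\<in>UNIV. dual_partial i (\<lambda>x. of_real (a i j t) * weak_partial j w x) \<phi>)
     + (\<Sum>j\<in>UNIV. dual_L2 (\<lambda>x. b j t * weak_partial j w x) \<phi>)
     + dual_L2 (\<lambda>x. c t * w x) \<phi>"

definition is_solution ::
    "real \<Rightarrow> ('n::finite \<Rightarrow> 'n \<Rightarrow> real \<Rightarrow> real) \<Rightarrow> ('n \<Rightarrow> real \<Rightarrow> complex) \<Rightarrow> (real \<Rightarrow> complex) \<Rightarrow>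
     (real \<Rightarrow> real^'n \<Rightarrow> complex) \<Rightarrow> bool" where
  "is_solution T a b c u \<longleftrightarrow>
     (AE t in lebesgue. t \<in> {0<..<T} \<longrightarrow>
        (\<forall>\<phi>\<in>H1. L_op a b c t (L2_deriv {0..<T} u t) (u t) \<phi> = 0))"

end

theory Submission
  imports Defs "HOL-Probability.Distributions"
begin

text \<open>
  The idea is to measure \<open>u(t)\<close> through the form \<open>B\<^sub>l(v, v) = \<langle>exp(l \<Delta>) v, v\<rangle>\<close>. The coefficients
  depend on \<open>t\<close> only, so \<open>exp(l \<Delta>)\<close> commutes with \<open>\<L>\<close>, while \<open>\<partial>\<^sub>l B\<^sub>l(v, v) = - \<Sum>\<^sub>i B\<^sub>l(\<partial>\<^sub>i v, \<partial>\<^sub>i v)\<close>.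
  By ellipticity, \<open>t \<mapsto> B\<^bsub>l(t)\<^esub>(u(t), u(t))\<close> is, up to an exponential factor, increasing if
  \<open>l' \<le> k\<^sub>A\<close> and decreasing if \<open>l' \<ge> 4/k\<^sub>A\<close>. A small slope on \<open>[z, T]\<close>, starting near \<open>l = 0\<close>, and a
  large slope on \<open>[0, T]\<close>, starting at \<open>l = 1\<close>, give
  \<open>|u(z)|\<^sup>2 \<le> C B\<^sub>\<Lambda>(u(T), u(T))\<close> and \<open>B\<^sub>M(u(T), u(T)) \<le> C |u(0)|\<^sup>2\<close>, where \<open>\<Lambda> = M/2\<^sup>n\<close>.
  The Cauchy--Schwarz inequality \<open>B\<^sub>l(v, v)\<^sup>2 \<le> B\<^sub>2\<^sub>l(v, v) |v|\<^sup>2\<close>, applied \<open>n\<close> times, links the two scales and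
  yields the Hoelder bound \<open>|u(z)|\<^sup>2 \<le> K |u(0)|\<^bsup>2\<theta>\<^esup>\<close> with \<open>\<theta> = 1/2\<^sup>n\<close>, which is stronger than the
  double exponential of the theorem. No Fourier transform is needed:
  \<open>exp(l \<Delta>)\<close> is an average of translations, so it is enough to test the equation with the
  translates of the conjugate of \<open>u(t)\<close>.
\<close>


section \<open>Smooth functions and bump functions\<close>

text \<open>The operator is backward parabolic, so the norm of u(t) essentially grows with t:
  bounding u(z) by later values is natural, while bounding u(T) by u(0) is the ill-posed direction.
  A scale l that grows faster than energy is produced makes the second bound possible, but then u(T)
  is only seen at the large scale M. The first bound survives a slow growth of l, and on [z, T] this
  affords a rise of k_A (T - z) only; here T' < T enters, and n is chosen so that M / 2^n fits below
  k_A (T - T'). The gap between the two scales is paid for with the a priori bound D at time T.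

  A second obstacle is that u(t) lies only in H^1 and is known up to null sets. The calculus is
  therefore done on correlations h -> <v(. + h), w>, which are bounded functions of h, integrated
  against a smooth kernel: derivatives in l fall on the Gaussian, weak derivatives are handled by
  parts in h, and the equation is used for each h separately.\<close>

lemma Ck_Suc_imp_Ck: "Ck (Suc k) f \<Longrightarrow> Ck k f"
  by (induction k arbitrary: f) (auto intro: differentiable_imp_continuous_on)

lemma Ck_differentiable: "Ck (Suc k) f \<Longrightarrow> f differentiable (at x)"
  by (simp add: differentiable_on_eq_differentiable_at)

lemma Ck_continuous: "Ck k f \<Longrightarrow> continuous_on UNIV f"
  by (induction k) (auto intro: Ck_Suc_imp_Ck differentiable_imp_continuous_on)

lemma partial_eqI: "(f has_derivative f') (at x) \<Longrightarrow> partial i f x = f' (axis i 1)"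
  unfolding partial_def using frechet_derivative_at by metis

lemma Ck_Suc_iff: "Ck (Suc k) f \<longleftrightarrow> (\<forall>x. f differentiable (at x)) \<and> (\<forall>i. Ck k (partial i f))"
  by (simp add: differentiable_on_eq_differentiable_at)

lemma partial_add:
  assumes "f differentiable (at x)" "g differentiable (at x)"
  shows "partial i (\<lambda>x. f x + g x) x = partial i f x + partial i g x"
proof -
  have "((\<lambda>x. f x + g x) has_derivative (\<lambda>h. frechet_derivative f (at x) h + frechet_derivative g (at x) h)) (at x)"
    using assms by (intro has_derivative_add) (auto simp: frechet_derivative_works)
  from partial_eqI[OF this] show ?thesis by (simp add: partial_def)
qed

lemma partial_mult:
  assumes "f differentiable (at x)" "g differentiable (at x)"
  shows "partial i (\<lambda>x. f x * g x) x = f x * partial i g x + partial i f x * g x"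
proof -
  have "((\<lambda>x. f x * g x) has_derivative
      (\<lambda>h. f x * frechet_derivative g (at x) h + frechet_derivative f (at x) h * g x)) (at x)"
    using assms by (intro has_derivative_mult) (auto simp: frechet_derivative_works)
  from partial_eqI[OF this] show ?thesis by (simp add: partial_def)
qed

text \<open>One rule serves both translations (\<open>r = 1\<close>) and dilated cutoffs
  (\<open>a = 0\<close>).\<close>

lemma partial_affine:
  assumes "f differentiable (at (r *\<^sub>R x + a))"
  shows "(\<lambda>x. f (r *\<^sub>R x + a)) differentiable (at x)"
    and "partial i (\<lambda>x. f (r *\<^sub>R x + a)) x = of_real r * partial i f (r *\<^sub>R x + a)"
proof -
  have f: "(f has_derivative frechet_derivative f (at (r *\<^sub>R x + a))) (at (r *\<^sub>R x + a))"
    using assms by (simp add: frechet_derivative_works)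
  have d: "((\<lambda>x. f (r *\<^sub>R x + a)) has_derivative (\<lambda>h. frechet_derivative f (at (r *\<^sub>R x + a)) (r *\<^sub>R h))) (at x)"
    by (rule has_derivative_compose[where g=f and f="\<lambda>x. r *\<^sub>R x + a", OF _ f]) (auto intro!: derivative_eq_intros)
  show "(\<lambda>x. f (r *\<^sub>R x + a)) differentiable (at x)"
    using d by (auto simp: differentiable_def)
  have "linear (frechet_derivative f (at (r *\<^sub>R x + a)))"
    using f has_derivative_linear by blast
  then show "partial i (\<lambda>x. f (r *\<^sub>R x + a)) x = of_real r * partial i f (r *\<^sub>R x + a)"
    using partial_eqI[OF d, of i] linear_cmul[of _ r "axis i 1"]
    by (metis partial_def scaleR_conv_of_real)
qed

lemma Ck_const: "Ck k (\<lambda>x. c)"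
proof (induction k arbitrary: c)
  case (Suc k)
  have "partial i (\<lambda>x. c) = (\<lambda>x. 0)" for i :: 'a
    by (rule ext, rule partial_eqI) (rule has_derivative_const)
  with Suc show ?case by simp
qed simp

lemma Ck_add: "Ck k f \<Longrightarrow> Ck k g \<Longrightarrow> Ck k (\<lambda>x. f x + g x)"
proof (induction k arbitrary: f g)
  case (Suc k)
  have "partial i (\<lambda>x. f x + g x) = (\<lambda>x. partial i f x + partial i g x)" for i
    using Suc.prems by (intro ext partial_add) (auto simp: Ck_Suc_iff simp del: Ck.simps)
  with Suc show ?case
    by (auto simp: Ck_Suc_iff simp del: Ck.simps intro: differentiable_add)
qed (auto intro: continuous_intros)

lemma Ck_mult: "Ck k f \<Longrightarrow> Ck k g \<Longrightarrow> Ck k (\<lambda>x. f x * g x)"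
proof (induction k arbitrary: f g)
  case (Suc k)
  have "partial i (\<lambda>x. f x * g x) = (\<lambda>x. f x * partial i g x + partial i f x * g x)" for i
    using Suc.prems by (intro ext partial_mult) (auto simp: Ck_Suc_iff simp del: Ck.simps)
  moreover have "Ck k f" "Ck k g" using Suc.prems Ck_Suc_imp_Ck by auto
  ultimately show ?case using Suc
    by (auto simp: Ck_Suc_iff simp del: Ck.simps intro: differentiable_mult Ck_add)
qed (auto intro: continuous_intros)

lemma Ck_prod: "finite I \<Longrightarrow> (\<And>i. i \<in> I \<Longrightarrow> Ck k (f i)) \<Longrightarrow> Ck k (\<lambda>x. \<Prod>i\<in>I. f i x)"
  by (induction I rule: finite_induct) (auto intro: Ck_mult Ck_const)

lemma Ck_affine: "Ck k f \<Longrightarrow> Ck k (\<lambda>x. f (r *\<^sub>R x + a))"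
proof (induction k arbitrary: f)
  case (Suc k)
  have d: "f differentiable (at x)" for x
    using Suc.prems by (rule Ck_differentiable)
  have "partial i (\<lambda>x. f (r *\<^sub>R x + a)) = (\<lambda>x. of_real r * partial i f (r *\<^sub>R x + a))" for i
    by (intro ext partial_affine d)
  with Suc show ?case
    by (auto simp: Ck_Suc_iff d simp del: Ck.simps intro!: partial_affine Ck_mult Ck_const)
qed (auto intro!: continuous_intros elim: continuous_on_compose2)

lemma Ck_partial: "\<forall>k. Ck k f \<Longrightarrow> Ck k (partial i f)"
  by (metis Ck.simps(2))

text \<open>One-variable counterpart of \<open>Ck\<close>: the Gaussian and the cutoffs are products
  of functions of single coordinates. The derivative is asked for by an existential, so a smoothness
  proof just has to exhibit it.\<close>

fun Dk :: "nat \<Rightarrow> (real \<Rightarrow> real) \<Rightarrow> bool" where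
  "Dk 0 f \<longleftrightarrow> continuous_on UNIV f"
| "Dk (Suc k) f \<longleftrightarrow> (\<exists>f'. (\<forall>x. (f has_real_derivative f' x) (at x)) \<and> Dk k f')"

lemma Dk_cmult: "Dk k f \<Longrightarrow> Dk k (\<lambda>x. c * f x)"
proof (induction k arbitrary: f)
  case (Suc k)
  then obtain f' where f': "\<And>x. (f has_real_derivative f' x) (at x)" "Dk k f'" by auto
  then show ?case
    by (auto intro!: exI[of _ "\<lambda>x. c * f' x"] Suc.IH DERIV_cmult)
qed (auto intro: continuous_intros)

lemma Dk_affine: "Dk k f \<Longrightarrow> Dk k (\<lambda>x. f (r * x + a))"
proof (induction k arbitrary: f)
  case (Suc k)
  then obtain f' where f': "\<And>x. (f has_real_derivative f' x) (at x)" "Dk k f'" by auto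
  have "((\<lambda>x. f (r * x + a)) has_real_derivative r * f' (r * x + a)) (at x)" for x
    by (rule DERIV_cong[OF DERIV_chain2[where f=f and g="\<lambda>x. r * x + a", OF f'(1)[of "r * x + a"]]])
       (auto intro!: derivative_eq_intros)
  then show ?case
    using f' by (auto intro!: exI[of _ "\<lambda>x. r * f' (r * x + a)"] Dk_cmult Suc.IH)
qed (auto intro!: continuous_intros elim: continuous_on_compose2)

lemma has_derivative_of_coordinate:
  assumes "(f has_real_derivative f') (at (x $ i))"
  shows "((\<lambda>x::real^'n. complex_of_real (f (x $ i))) has_derivative
          (\<lambda>h. complex_of_real (f' * h $ i))) (at x)"
proof -
  have "((\<lambda>x. f (x $ i)) has_derivative (\<lambda>h. f' * h $ i)) (at x)"
    by (rule has_derivative_compose[where g=f and f="\<lambda>x. x $ i", OF _ assms[unfolded has_field_derivative_def]])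
       (rule bounded_linear_imp_has_derivative[OF bounded_linear_vec_nth])
  from bounded_linear.has_derivative[OF bounded_linear_of_real this] show ?thesis .
qed

lemma Ck_of_coordinate: "Dk k f \<Longrightarrow> Ck k (\<lambda>x. complex_of_real (f (x $ i)))"
proof (induction k arbitrary: f)
  case 0
  then show ?case
    by (auto intro!: continuous_intros elim: continuous_on_compose2)
next
  case (Suc k)
  then obtain f' where f': "\<And>x. (f has_real_derivative f' x) (at x)" "Dk k f'" by auto
  note d = has_derivative_of_coordinate[OF f'(1)]
  have "partial j (\<lambda>x. complex_of_real (f (x $ i))) =
      (\<lambda>x. (if i = j then 1 else 0) * complex_of_real (f' (x $ i)))" for j
    by (rule ext, subst partial_eqI[OF d]) (auto simp: axis_def)
  moreover have "Ck k (\<lambda>x. (if i = j then 1 else 0) * complex_of_real (f' (x $ i)))" for j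
    by (intro Ck_mult Ck_const Suc.IH f')
  ultimately show ?case
    using d unfolding Ck_Suc_iff differentiable_def by metis
qed

text \<open>Base case for polynomial functions in the density argument. The first partials are
  constant, so a case distinction on \<open>k\<close> replaces induction.\<close>

lemma Ck_of_bounded_linear:
  assumes "bounded_linear f"
  shows "Ck k (\<lambda>x. complex_of_real (f x))"
proof (cases k)
  case 0
  then show ?thesis
    using linear_continuous_on[OF assms] by (auto intro!: continuous_intros)
next
  case (Suc m)
  have d: "((\<lambda>x. complex_of_real (f x)) has_derivative (\<lambda>h. complex_of_real (f h))) (at x)" for x
    by (intro bounded_linear.has_derivative[OF bounded_linear_of_real]
        bounded_linear_imp_has_derivative assms)
  have "partial i (\<lambda>x. complex_of_real (f x)) = (\<lambda>x. complex_of_real (f (axis i 1)))" for i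
    by (rule ext) (rule partial_eqI[OF d])
  with Suc show ?thesis
    using d unfolding Suc Ck_Suc_iff differentiable_def by (metis Ck_const)
qed

text \<open>Polynomials times a fixed Gaussian form a class closed under differentiation, hence the
  induction over arbitrary \<open>p\<close>; the Gaussian itself is the case
  \<open>p = 1\<close>.\<close>

lemma Dk_poly_exp: "Dk k (\<lambda>t. poly p t * exp (- c * t\<^sup>2))"
proof (induction k arbitrary: p)
  case (Suc k)
  let ?q = "pderiv p - [:0, 2 * c:] * p"
  have "((\<lambda>t. poly p t * exp (- c * t\<^sup>2)) has_real_derivative poly ?q t * exp (- c * t\<^sup>2)) (at t)" for t
    by (auto intro!: derivative_eq_intros poly_DERIV simp: algebra_simps)
  with Suc.IH[of ?q] show ?case
    unfolding Dk.simps by (intro exI[of _ "\<lambda>t. poly ?q t * exp (- c * t\<^sup>2)"] conjI allI)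
qed (auto intro!: continuous_intros)

text \<open>For \<open>p = 1\<close> this is the classical smooth function that is flat at 0.
  Polynomials in 1/s are carried along because the class is then closed under
  differentiation.\<close>

definition flat_exp :: "real poly \<Rightarrow> real \<Rightarrow> real" where
  "flat_exp p s = (if s > 0 then poly p (1 / s) * exp (- (1 / s)) else 0)"

lemma poly_exp_tendsto_0: "((\<lambda>y::real. poly p y * exp (- y)) \<longlongrightarrow> 0) at_top"
proof -
  have "((\<lambda>y::real. \<Sum>i\<le>degree p. coeff p i * (y ^ i / exp y)) \<longlongrightarrow> (\<Sum>i\<le>degree p. coeff p i * 0)) at_top"
    by (intro tendsto_sum tendsto_mult tendsto_const tendsto_power_div_exp_0)
  then show ?thesis
    by (simp add: poly_altdef exp_minus field_simps sum_distrib_left sum_distrib_right sum_divide_distrib)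
qed

lemma flat_exp_tendsto_0: "(flat_exp p \<longlongrightarrow> 0) (at 0)"
proof -
  have "((\<lambda>s. poly p (inverse s) * exp (- inverse s)) \<longlongrightarrow> 0) (at_right 0)"
    by (rule filterlim_compose[OF poly_exp_tendsto_0 filterlim_inverse_at_top_right])
  then have "(flat_exp p \<longlongrightarrow> 0) (at_right 0)"
    by (rule Lim_transform_eventually)
       (auto simp: eventually_at_filter flat_exp_def inverse_eq_divide)
  moreover have "(flat_exp p \<longlongrightarrow> 0) (at_left 0)"
    by (rule Lim_transform_eventually[OF tendsto_const])
       (auto simp: eventually_at_filter flat_exp_def)
  ultimately show ?thesis by (simp add: filterlim_at_split)
qed

text \<open>With y = 1/s one has dy/ds = - y^2, and differentiating p(y) exp(-y) in y gives (p' -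
  p)(y) exp(-y). This is the origin of the polynomial (p - p') X^2.\<close>

lemma flat_exp_deriv:
  "(flat_exp p has_real_derivative flat_exp ((p - pderiv p) * [:0, 0, 1:]) s) (at s)"
proof -
  consider "s > 0" | "s = 0" | "s < 0" by linarith
  then show ?thesis
  proof cases
    case 1
    have "((\<lambda>s. poly p (1 / s) * exp (- (1 / s))) has_real_derivative
       flat_exp ((p - pderiv p) * [:0, 0, 1:]) s) (at s)"
      using 1 by (auto intro!: derivative_eq_intros DERIV_chain2[OF poly_DERIV]
          simp: flat_exp_def power2_eq_square field_simps)
    then show ?thesis
      by (rule has_field_derivative_transform_within_open[where S="{0<..}"])
         (use 1 in \<open>auto simp: flat_exp_def\<close>)
  next
    case 2
    \<comment> \<open>The difference quotient at 0 belongs to the same class: division by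
      \<open>h\<close> multiplies the polynomial by X.\<close>
    have "((\<lambda>h. flat_exp (p * [:0, 1:]) h) \<longlongrightarrow> 0) (at 0)"
      by (rule flat_exp_tendsto_0)
    then have "((\<lambda>h. (flat_exp p (0 + h) - flat_exp p 0) / h) \<longlongrightarrow> 0) (at 0)"
      by (rule Lim_transform_eventually) (auto simp: flat_exp_def intro!: always_eventually)
    with 2 show ?thesis by (simp add: DERIV_def flat_exp_def)
  next
    case 3
    have "((\<lambda>s. 0) has_real_derivative flat_exp ((p - pderiv p) * [:0, 0, 1:]) s) (at s)"
      using 3 by (simp add: flat_exp_def)
    then show ?thesis
      by (rule has_field_derivative_transform_within_open[where S="{..<0}"])
         (use 3 in \<open>auto simp: flat_exp_def\<close>)
  qed
qed

lemma Dk_flat_exp: "Dk k (flat_exp p)"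
proof (induction k arbitrary: p)
  case 0
  show ?case by (auto intro!: DERIV_isCont flat_exp_deriv simp: continuous_on_eq_continuous_at)
next
  case (Suc k)
  then show ?case using flat_exp_deriv by auto
qed

abbreviation step :: "real \<Rightarrow> real" where "step \<equiv> flat_exp 1"

text \<open>\<open>N\<close> is the half-width of the supporting cube and \<open>m\<close> the
  steepness of the flanks. As \<open>m\<close> grows, the function tends to 1 inside the cube,
  because \<open>step\<close> tends to 1 at infinity; so no normalisation is built in.\<close>

definition bump :: "real \<Rightarrow> real \<Rightarrow> real^'n \<Rightarrow> complex" where
  "bump m N x = (\<Prod>i\<in>UNIV. complex_of_real (step (m * x $ i + m * N)) *
                            complex_of_real (step (- m * x $ i + m * N)))"

lemma Ck_bump: "Ck k (bump m N)"
  unfolding bump_def by (intro Ck_prod Ck_mult Ck_of_coordinate Dk_affine Dk_flat_exp) auto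

lemma step_bounds: "0 \<le> step s" "step s \<le> 1"
  by (auto simp: flat_exp_def)

lemma norm_bump: "norm (bump m N x) \<le> 1"
  unfolding bump_def prod_norm[symmetric]
  by (intro prod_le_1) (auto simp: norm_mult step_bounds intro!: mult_le_one)

lemma bump_eq_0:
  assumes "m > 0" "x \<notin> cbox (\<chi> i. -N) (\<chi> i. N)"
  shows "bump m N x = 0"
proof -
  obtain i where i: "x $ i < -N \<or> N < x $ i"
    using assms by (auto simp: mem_box_cart not_le)
  then have "m * x $ i + m * N < 0 \<or> - m * x $ i + m * N < 0"
    using assms(1) mult_pos_neg[of m "x $ i + N"] mult_pos_neg[of m "N - x $ i"]
    by (auto simp: algebra_simps)
  then show ?thesis
    unfolding bump_def by (auto simp: prod_zero_iff flat_exp_def intro!: exI[of _ i])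
qed

lemma bump_0: "bump 1 1 0 \<noteq> 0"
  by (auto simp: bump_def prod_zero_iff flat_exp_def)

lemma bump_tendsto_1:
  assumes "x \<in> box (\<chi> i. -N) (\<chi> i. N)"
  shows "(\<lambda>k. bump (real k) N x) \<longlonglongrightarrow> 1"
proof -
  have lim: "(\<lambda>k. step (real k * r)) \<longlonglongrightarrow> 1" if "r > 0" for r
  proof -
    have "(\<lambda>k. exp (- (1 / (real k * r)))) \<longlonglongrightarrow> exp (- 0)"
      by (intro tendsto_exp tendsto_minus real_tendsto_divide_at_top[OF tendsto_const]
            filterlim_at_top_mult_tendsto_pos[OF tendsto_const that filterlim_real_sequentially])
    then have "(\<lambda>k. exp (- (1 / (real k * r)))) \<longlonglongrightarrow> 1" by simp
    then show ?thesis
      by (rule Lim_transform_eventually)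
         (use that in \<open>auto simp: flat_exp_def eventually_sequentially intro!: exI[of _ 1]\<close>)
  qed
  have "(\<lambda>k. bump (real k) N x) \<longlonglongrightarrow> (\<Prod>i\<in>(UNIV::'a set). complex_of_real 1 * complex_of_real 1)"
    unfolding bump_def
  proof (intro tendsto_prod tendsto_mult tendsto_of_real)
    fix i
    have "x $ i + N > 0" "N - x $ i > 0" using assms by (auto simp: mem_box_cart) (smt (verit))+
    from lim[OF this(1)] lim[OF this(2)]
    show "(\<lambda>k. step (real k * x $ i + real k * N)) \<longlonglongrightarrow> 1"
      "(\<lambda>k. step (- real k * x $ i + real k * N)) \<longlonglongrightarrow> 1"
      by (simp_all add: algebra_simps)
  qed
  then show ?thesis by simp
qed


section \<open>Square integrable functions\<close>

lemma borel_measurable_cnj [measurable (raw)]: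
  "f \<in> borel_measurable M \<Longrightarrow> (\<lambda>x. cnj (f x)) \<in> borel_measurable M"
  by (rule borel_measurable_continuous_on[of cnj, OF continuous_on_cnj[OF continuous_on_id]])

definition shift :: "real^'n \<Rightarrow> (real^'n \<Rightarrow> complex) \<Rightarrow> real^'n \<Rightarrow> complex" where
  "shift h f x = f (x + h)"

text \<open>Borel representatives, for which \<open>(x, h) \<mapsto> f (x + h)\<close> is measurable on the product.\<close>

definition L2b :: "(real^'n \<Rightarrow> complex) set" where
  "L2b = {f \<in> borel_measurable borel. integrable lborel (\<lambda>x. (norm (f x))\<^sup>2)}"

definition ip :: "(real^'n \<Rightarrow> complex) \<Rightarrow> (real^'n \<Rightarrow> complex) \<Rightarrow> complex" where
  "ip f g = (\<integral>x. f x * cnj (g x) \<partial>lborel)"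

section \<open>Lebesgue measure under translation and reflection\<close>

lemma integral_lborel_shift:
  fixes f :: "real^'n \<Rightarrow> 'b::{banach, second_countable_topology}"
  assumes "f \<in> borel_measurable borel"
  shows "(\<integral>x. f (x + h) \<partial>lborel) = (\<integral>x. f x \<partial>lborel)"
proof -
  have "(\<integral>x. f x \<partial>lborel) = (\<integral>x. f x \<partial>distr lborel borel ((+) h))"
    by (simp add: lborel_distr_plus)
  also have "\<dots> = (\<integral>x. f (x + h) \<partial>lborel)"
    using assms by (subst integral_distr) (auto simp: add.commute)
  finally show ?thesis ..
qed

lemma integrable_lborel_shift:
  fixes f :: "real^'n \<Rightarrow> 'b::{banach, second_countable_topology}"
  assumes "integrable lborel f"
  shows "integrable lborel (\<lambda>x. f (x + h))"
proof -
  have "integrable (distr lborel borel ((+) h)) f"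
    using assms by (simp add: lborel_distr_plus)
  then show ?thesis
    using assms by (subst (asm) integrable_distr_eq) (auto simp: add.commute)
qed

lemma lborel_distr_uminus_vec: "distr lborel borel uminus = (lborel :: (real^'n) measure)"
  using lborel_affine[of "-1" "0::real^'n"] by (simp add: density_1)

lemma integral_lborel_reflect:
  fixes f :: "real^'n \<Rightarrow> 'b::{banach, second_countable_topology}"
  assumes "f \<in> borel_measurable borel"
  shows "(\<integral>x. f (- x) \<partial>lborel) = (\<integral>x. f x \<partial>lborel)"
  using integral_distr[of uminus lborel borel f] assms
  by (simp add: lborel_distr_uminus_vec)

lemma L2bD:
  assumes "f \<in> L2b"
  shows "f \<in> borel_measurable borel" "integrable lborel (\<lambda>x. (norm (f x))\<^sup>2)"
  using assms by (auto simp: L2b_def)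

lemma L2b_L2: "f \<in> L2b \<Longrightarrow> f \<in> L2"
  by (auto simp: L2b_def L2_def integrable_completion intro!: measurable_completion)

lemma L2_norm_lborel:
  assumes "f \<in> borel_measurable borel"
  shows "L2_norm f = sqrt (\<integral>x. (norm (f x))\<^sup>2 \<partial>lborel)"
  unfolding L2_norm_def using assms by (subst integral_completion) auto

lemma L2_norm_nonneg [simp]: "0 \<le> L2_norm f"
  by (simp add: L2_norm_def)

lemma L2_norm_power2:
  assumes "f \<in> borel_measurable borel"
  shows "(L2_norm f)\<^sup>2 = (\<integral>x. (norm (f x))\<^sup>2 \<partial>lborel)"
  by (simp add: L2_norm_lborel[OF assms])

lemma ip_self: "f \<in> borel_measurable borel \<Longrightarrow> ip f f = of_real ((L2_norm f)\<^sup>2)"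
  by (simp add: ip_def L2_norm_power2 complex_norm_square[symmetric] flip: integral_complex_of_real)

section \<open>The Cauchy-Schwarz inequality and the vector space structure\<close>

lemma L2b_integrable_mult_norm:
  assumes "f \<in> L2b" "g \<in> L2b"
  shows "integrable lborel (\<lambda>x. norm (f x) * norm (g x))"
proof (rule Bochner_Integration.integrable_bound)
  show "integrable lborel (\<lambda>x. (norm (f x))\<^sup>2 + (norm (g x))\<^sup>2)"
    using assms by (auto dest: L2bD)
  show "AE x in lborel. norm (norm (f x) * norm (g x)) \<le> norm ((norm (f x))\<^sup>2 + (norm (g x))\<^sup>2)"
  proof (rule AE_I2)
    fix x
    show "norm (norm (f x) * norm (g x)) \<le> norm ((norm (f x))\<^sup>2 + (norm (g x))\<^sup>2)"
      using sum_squares_bound[of "norm (f x)" "norm (g x)"]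
        mult_nonneg_nonneg[OF norm_ge_zero[of "f x"] norm_ge_zero[of "g x"]]
      unfolding real_norm_def by linarith
  qed
qed (use L2bD(1)[OF assms(1)] L2bD(1)[OF assms(2)] in simp)

lemma L2b_integrable_mult:
  assumes "f \<in> L2b" "g \<in> L2b"
  shows "integrable lborel (\<lambda>x. f x * cnj (g x))"
  by (rule Bochner_Integration.integrable_bound[OF L2b_integrable_mult_norm[OF assms]])
     (use L2bD(1)[OF assms(1)] L2bD(1)[OF assms(2)] in \<open>auto simp: norm_mult\<close>)

lemma L2b_Cauchy_Schwarz:
  assumes f: "f \<in> L2b" and g: "g \<in> L2b"
  shows "(\<integral>x. norm (f x) * norm (g x) \<partial>lborel) \<le> L2_norm f * L2_norm g" (is "?I \<le> _")
proof -
  note [measurable] = L2bD(1)[OF f] L2bD(1)[OF g]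
  define A B where "A = L2_norm f" and "B = L2_norm g"
  \<comment> \<open>Young's inequality with a free weight. The optimal choice
    \<open>s^2 = B / A\<close> may be 0 or undefined, so both norms are enlarged by \<open>e\<close>
    before optimising, and \<open>e\<close> tends to 0 at the end.\<close>
  have *: "2 * ?I \<le> s\<^sup>2 * A\<^sup>2 + B\<^sup>2 / s\<^sup>2" if "s > 0" for s :: real
  proof -
    have "2 * ?I = (\<integral>x. 2 * (norm (f x) * norm (g x)) \<partial>lborel)" by simp
    also have "\<dots> \<le> (\<integral>x. s\<^sup>2 * (norm (f x))\<^sup>2 + (norm (g x))\<^sup>2 / s\<^sup>2 \<partial>lborel)"
    proof (rule integral_mono)
      show "integrable lborel (\<lambda>x. 2 * (norm (f x) * norm (g x)))"
        using L2b_integrable_mult_norm[OF f g] by simp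
      show "integrable lborel (\<lambda>x. s\<^sup>2 * (norm (f x))\<^sup>2 + (norm (g x))\<^sup>2 / s\<^sup>2)"
        using L2bD(2)[OF f] L2bD(2)[OF g] by simp
      show "2 * (norm (f x) * norm (g x)) \<le> s\<^sup>2 * (norm (f x))\<^sup>2 + (norm (g x))\<^sup>2 / s\<^sup>2" for x
        using sum_squares_bound[of "s * norm (f x)" "norm (g x) / s"] that
        by (simp add: power_mult_distrib power_divide)
    qed
    also have "\<dots> = s\<^sup>2 * A\<^sup>2 + B\<^sup>2 / s\<^sup>2"
      using L2bD(2)[OF f] L2bD(2)[OF g] by (simp add: A_def B_def L2_norm_power2)
    finally show ?thesis .
  qed
  have AB: "A \<ge> 0" "B \<ge> 0" by (auto simp: A_def B_def)
  have "?I \<le> (A + e) * (B + e)" if e: "e > 0" for e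
  proof -
    define s where "s = sqrt ((B + e) / (A + e))"
    have s: "s > 0" "s\<^sup>2 = (B + e) / (A + e)" using AB e by (auto simp: s_def)
    have "s\<^sup>2 * A\<^sup>2 \<le> s\<^sup>2 * (A + e)\<^sup>2" "B\<^sup>2 / s\<^sup>2 \<le> (B + e)\<^sup>2 / s\<^sup>2"
      using AB e by (auto intro!: mult_left_mono divide_right_mono power_mono)
    moreover have "s\<^sup>2 * (A + e)\<^sup>2 = (A + e) * (B + e)" "(B + e)\<^sup>2 / s\<^sup>2 = (A + e) * (B + e)"
      unfolding s(2) using AB e by (auto simp: power2_eq_square)
    ultimately show ?thesis using *[OF s(1)] by linarith
  qed
  then have "eventually (\<lambda>e. ?I \<le> (A + e) * (B + e)) (at_right 0)"
    by (auto simp: eventually_at_filter)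
  moreover have "((\<lambda>e. (A + e) * (B + e)) \<longlongrightarrow> (A + 0) * (B + 0)) (at_right 0)"
    by (intro tendsto_intros)
  ultimately have "?I \<le> (A + 0) * (B + 0)"
    by (intro tendsto_lowerbound[where F="at_right 0"]) auto
  then show ?thesis by (simp add: A_def B_def)
qed

lemma ip_bound:
  assumes "f \<in> L2b" "g \<in> L2b"
  shows "norm (ip f g) \<le> L2_norm f * L2_norm g"
proof -
  have "norm (ip f g) \<le> (\<integral>x. norm (f x * cnj (g x)) \<partial>lborel)"
    unfolding ip_def by (rule integral_norm_bound)
  also have "\<dots> \<le> L2_norm f * L2_norm g"
    using L2b_Cauchy_Schwarz[OF assms] by (simp add: norm_mult)
  finally show ?thesis .
qed

lemma L2b_zero: "(\<lambda>x. 0) \<in> L2b"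
  by (auto simp: L2b_def)

lemma L2b_add:
  assumes f: "f \<in> L2b" and g: "g \<in> L2b"
  shows "(\<lambda>x. f x + g x) \<in> L2b"
proof -
  note [measurable] = L2bD(1)[OF f] L2bD(1)[OF g]
  have "integrable lborel (\<lambda>x. (norm (f x + g x))\<^sup>2)"
  proof (rule Bochner_Integration.integrable_bound)
    show "integrable lborel (\<lambda>x. 2 * ((norm (f x))\<^sup>2 + (norm (g x))\<^sup>2))"
      using L2bD(2)[OF f] L2bD(2)[OF g] by simp
    have "(norm (f x + g x))\<^sup>2 \<le> 2 * ((norm (f x))\<^sup>2 + (norm (g x))\<^sup>2)" for x
    proof -
      have "(norm (f x + g x))\<^sup>2 \<le> (norm (f x) + norm (g x))\<^sup>2"
        by (intro power_mono norm_triangle_ineq) auto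
      also have "\<dots> \<le> 2 * ((norm (f x))\<^sup>2 + (norm (g x))\<^sup>2)"
        using sum_squares_bound[of "norm (f x)" "norm (g x)"] by (simp add: power2_sum)
      finally show ?thesis .
    qed
    then show "AE x in lborel. norm ((norm (f x + g x))\<^sup>2) \<le> norm (2 * ((norm (f x))\<^sup>2 + (norm (g x))\<^sup>2))"
      by (auto intro!: AE_I2)
  qed simp
  then show ?thesis by (auto simp: L2b_def)
qed

lemma L2b_cmult: "f \<in> L2b \<Longrightarrow> (\<lambda>x. c * f x) \<in> L2b"
  by (auto simp: L2b_def norm_mult power_mult_distrib)

lemma L2b_diff:
  assumes "f \<in> L2b" "g \<in> L2b"
  shows "(\<lambda>x. f x - g x) \<in> L2b"
  using L2b_add[OF assms(1) L2b_cmult[OF assms(2), of "-1"]] by simp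

lemma L2b_cnj: "f \<in> L2b \<Longrightarrow> (\<lambda>x. cnj (f x)) \<in> L2b"
  by (auto simp: L2b_def)

lemma L2b_shift: "f \<in> L2b \<Longrightarrow> shift h f \<in> L2b"
  using integrable_lborel_shift[of "\<lambda>x. (norm (f x))\<^sup>2" h]
  by (auto simp: L2b_def shift_def[abs_def])

lemma L2_norm_shift:
  assumes "f \<in> borel_measurable borel"
  shows "L2_norm (shift h f) = L2_norm f"
  using integral_lborel_shift[of "\<lambda>x. (norm (f x))\<^sup>2" h] assms
  by (auto simp: L2_norm_lborel shift_def[abs_def])

lemma ip_shift:
  assumes "f \<in> borel_measurable borel" "g \<in> borel_measurable borel"
  shows "ip (shift h f) (shift h g) = ip f g"
  using integral_lborel_shift[of "\<lambda>x. f x * cnj (g x)" h] assms by (simp add: ip_def shift_def)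

lemma ip_commute: "ip f g = cnj (ip g f)"
  unfolding ip_def by (simp add: mult.commute flip: Bochner_Integration.integral_cnj)

lemma ip_diff_left: "f \<in> L2b \<Longrightarrow> f' \<in> L2b \<Longrightarrow> g \<in> L2b \<Longrightarrow> ip (\<lambda>x. f x - f' x) g = ip f g - ip f' g"
  unfolding ip_def by (simp add: left_diff_distrib L2b_integrable_mult)

lemma ip_diff_right: "f \<in> L2b \<Longrightarrow> f' \<in> L2b \<Longrightarrow> g \<in> L2b \<Longrightarrow> ip g (\<lambda>x. f x - f' x) = ip g f - ip g f'"
  unfolding ip_def by (simp add: right_diff_distrib L2b_integrable_mult)

lemma L2_norm_triangle:
  assumes f: "f \<in> L2b" and g: "g \<in> L2b"
  shows "L2_norm (\<lambda>x. f x + g x) \<le> L2_norm f + L2_norm g"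
proof (rule power2_le_imp_le)
  note [measurable] = L2bD(1)[OF f] L2bD(1)[OF g]
  have "(L2_norm (\<lambda>x. f x + g x))\<^sup>2 = (\<integral>x. (norm (f x + g x))\<^sup>2 \<partial>lborel)"
    by (simp add: L2_norm_power2)
  also have "\<dots> \<le> (\<integral>x. (norm (f x))\<^sup>2 + (norm (g x))\<^sup>2 + 2 * (norm (f x) * norm (g x)) \<partial>lborel)"
  proof (rule integral_mono)
    show "(norm (f x + g x))\<^sup>2 \<le> (norm (f x))\<^sup>2 + (norm (g x))\<^sup>2 + 2 * (norm (f x) * norm (g x))" for x
      using power_mono[OF norm_triangle_ineq[of "f x" "g x"], of 2] by (simp add: power2_sum)
  qed (use L2bD(2)[OF L2b_add[OF f g]] L2bD(2)[OF f] L2bD(2)[OF g] L2b_integrable_mult_norm[OF f g] in auto)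
  also have "\<dots> = (L2_norm f)\<^sup>2 + (L2_norm g)\<^sup>2 + 2 * (\<integral>x. norm (f x) * norm (g x) \<partial>lborel)"
    using L2bD(2)[OF f] L2bD(2)[OF g] L2b_integrable_mult_norm[OF f g]
    by (simp add: L2_norm_power2)
  also have "\<dots> \<le> (L2_norm f + L2_norm g)\<^sup>2"
    using L2b_Cauchy_Schwarz[OF f g] by (simp add: power2_sum)
  finally show "(L2_norm (\<lambda>x. f x + g x))\<^sup>2 \<le> (L2_norm f + L2_norm g)\<^sup>2" .
qed simp

lemma L2_norm_AE_cong:
  assumes "AE x in lebesgue. f x = g x"
    and "f \<in> borel_measurable lebesgue" "g \<in> borel_measurable lebesgue"
  shows "L2_norm f = L2_norm g"
  unfolding L2_norm_def using assms by (intro arg_cong[where f=sqrt] integral_cong_AE) auto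

text \<open>The bridge from the \<open>lebesgue\<close>-measurable representatives of the statement
  to Borel ones: real and imaginary part each agree almost everywhere with a Borel function.\<close>

lemma L2_obtain_L2b:
  assumes "f \<in> L2"
  obtains g where "g \<in> L2b" "AE x in lebesgue. f x = g x" "L2_norm f = L2_norm g"
proof -
  have f: "f \<in> borel_measurable lebesgue" "integrable lebesgue (\<lambda>x. (norm (f x))\<^sup>2)"
    using assms by (auto simp: L2_def)
  have "(\<lambda>x. Re (f x)) \<in> borel_measurable lebesgue" "(\<lambda>x. Im (f x)) \<in> borel_measurable lebesgue"
    using f by measurable
  from this[THEN completion_ex_borel_measurable_real]
  obtain p q where p: "p \<in> borel_measurable lborel" "AE x in lborel. Re (f x) = p x"
    and q: "q \<in> borel_measurable lborel" "AE x in lborel. Im (f x) = q x" by auto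
  define g where "g x = Complex (p x) (q x)" for x
  have "(\<lambda>x. of_real (p x) + \<i> * of_real (q x)) \<in> borel_measurable borel"
    using p q by measurable
  then have g: "g \<in> borel_measurable borel" by (simp add: g_def[abs_def] Complex_eq)
  then have gl: "g \<in> borel_measurable lebesgue" by (auto intro!: measurable_completion)
  have "AE x in lborel. f x = g x"
    using p(2) q(2) by eventually_elim (auto simp: g_def complex_eq_iff)
  then have ae: "AE x in lebesgue. f x = g x" by (rule AE_completion)
  have "integrable lebesgue (\<lambda>x. (norm (g x))\<^sup>2)"
    using f gl ae by (subst integrable_cong_AE[where g="\<lambda>x. (norm (f x))\<^sup>2"]) auto
  with g have "g \<in> L2b" by (simp add: L2b_def integrable_completion)
  with ae L2_norm_AE_cong[OF ae f(1) gl] show ?thesis by (intro that)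
qed


section \<open>Density of the test functions\<close>

lemma test_funI:
  assumes "\<And>k. Ck k f" "compact K" "\<And>x. x \<notin> K \<Longrightarrow> f x = 0"
  shows "f \<in> test_fun"
proof -
  have "closure {x. f x \<noteq> 0} \<subseteq> K"
    using assms by (intro closure_minimal compact_imp_closed) auto
  then have "compact (closure {x. f x \<noteq> 0})"
    using assms(2) compact_Int_closed[of K "closure {x. f x \<noteq> 0}"] by (simp add: inf.absorb2)
  with assms(1) show ?thesis by (simp add: test_fun_def)
qed

lemma test_funD:
  assumes "f \<in> test_fun"
  shows "Ck k f" "continuous_on UNIV f" "f differentiable (at x)"
proof -
  have c: "Ck k f" for k using assms by (simp add: test_fun_def)
  show "Ck k f" "continuous_on UNIV f" "f differentiable (at x)"
    by (rule c, rule Ck_continuous[OF c], rule Ck_differentiable[OF c])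
qed

lemma test_fun_obtain_compact:
  assumes "f \<in> test_fun"
  obtains K where "compact K" "\<And>x. x \<notin> K \<Longrightarrow> f x = 0"
  using assms closure_subset[of "{x. f x \<noteq> 0}"] unfolding test_fun_def by blast

lemma continuous_compact_support_bounded:
  fixes f :: "real^'n \<Rightarrow> complex"
  assumes "continuous_on UNIV f" "compact K" "\<And>x. x \<notin> K \<Longrightarrow> f x = 0"
  obtains M where "M > 0" "\<And>x. norm (f x) \<le> M"
proof -
  have "compact (f ` K)"
    using assms by (intro compact_continuous_image continuous_on_subset[OF assms(1)]) auto
  then obtain M where M: "M > 0" "\<And>y. y \<in> f ` K \<Longrightarrow> norm y \<le> M"
    using compact_imp_bounded bounded_pos by metis
  have "norm (f x) \<le> M" for x
    using M assms(3)[of x] by (cases "x \<in> K") auto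
  with M(1) show ?thesis by (rule that)
qed

lemma test_fun_mult:
  assumes "f \<in> test_fun" "\<And>k. Ck k g"
  shows "(\<lambda>x. g x * f x) \<in> test_fun"
proof -
  obtain K where K: "compact K" "\<And>x. x \<notin> K \<Longrightarrow> f x = 0"
    using test_fun_obtain_compact[OF assms(1)] by blast
  show ?thesis
    by (rule test_funI[OF _ K(1)]) (use K(2) in \<open>auto intro: Ck_mult assms(2) test_funD(1)[OF assms(1)]\<close>)
qed

lemma test_fun_affine:
  assumes "f \<in> test_fun" "r \<noteq> 0"
  shows "(\<lambda>x. f (r *\<^sub>R x + a)) \<in> test_fun"
proof -
  obtain K where K: "compact K" "\<And>x. x \<notin> K \<Longrightarrow> f x = 0"
    using test_fun_obtain_compact[OF assms(1)] by blast
  show ?thesis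
  proof (rule test_funI[where K="(\<lambda>y. (1 / r) *\<^sub>R y + (- (1 / r)) *\<^sub>R a) ` K"])
    show "compact ((\<lambda>y. (1 / r) *\<^sub>R y + (- (1 / r)) *\<^sub>R a) ` K)"
      by (intro compact_continuous_image K continuous_intros)
    show "f (r *\<^sub>R x + a) = 0" if "x \<notin> (\<lambda>y. (1 / r) *\<^sub>R y + (- (1 / r)) *\<^sub>R a) ` K" for x
    proof (rule K(2))
      have "x = (1 / r) *\<^sub>R (r *\<^sub>R x + a) + (- (1 / r)) *\<^sub>R a"
        using assms(2) by (simp add: scaleR_add_right)
      with that show "r *\<^sub>R x + a \<notin> K" by blast
    qed
  qed (intro Ck_affine test_funD(1) assms)
qed

lemma test_fun_partial:
  assumes "f \<in> test_fun"
  shows "partial i f \<in> test_fun"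
proof -
  obtain K where K: "compact K" "\<And>x. x \<notin> K \<Longrightarrow> f x = 0"
    using test_fun_obtain_compact[OF assms(1)] by blast
  show ?thesis
  proof (rule test_funI[OF _ K(1)])
    show "Ck k (partial i f)" for k
      using test_funD(1)[OF assms] by (intro Ck_partial) auto
    fix x assume x: "x \<notin> K"
    have "(f has_derivative (\<lambda>h. 0)) (at x)"
      by (rule has_derivative_transform_within_open[of "\<lambda>x. 0" _ _ _ "- K"])
         (use K x compact_imp_closed in auto)
    from partial_eqI[OF this] show "partial i f x = 0" .
  qed
qed

lemma test_fun_bump:
  assumes "m > 0"
  shows "bump m N \<in> test_fun"
  using assms by (intro test_funI[where K="cbox (\<chi> i. -N) (\<chi> i. N)"] Ck_bump bump_eq_0) auto

lemma test_fun_bounded: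
  assumes "f \<in> test_fun"
  obtains M where "M > 0" "\<And>x. norm (f x) \<le> M"
  using assms by (metis continuous_compact_support_bounded test_funD(2) test_fun_obtain_compact)

lemma L2b_bounded_support:
  assumes f: "f \<in> borel_measurable borel" and A: "A \<in> sets borel" "emeasure lborel A < \<infinity>"
    and b: "\<And>x. norm (f x) \<le> M * indicator A x"
  shows "f \<in> L2b"
proof -
  have "integrable lborel (\<lambda>x. (norm (f x))\<^sup>2)"
  proof (rule Bochner_Integration.integrable_bound)
    show "integrable lborel (\<lambda>x. M\<^sup>2 * indicator A x :: real)"
      using A by (intro integrable_mult_right integrable_real_indicator) auto
    have "(norm (f x))\<^sup>2 \<le> M\<^sup>2 * indicator A x" for x
      using power_mono[OF b[of x], of 2] by (auto simp: indicator_def split: if_splits)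
    then show "AE x in lborel. norm ((norm (f x))\<^sup>2) \<le> norm (M\<^sup>2 * indicator A x :: real)"
      by auto
  qed (use f in simp)
  with f show ?thesis by (simp add: L2b_def)
qed

lemma test_fun_dominated:
  assumes "f \<in> test_fun"
  obtains M R where "M > 0" "R > 0" "\<And>x. norm (f x) \<le> M * indicator (cball 0 R) x"
proof -
  obtain M where M: "M > 0" "\<And>x. norm (f x) \<le> M"
    using test_fun_bounded[OF assms] by blast
  obtain K where K: "compact K" "\<And>x. x \<notin> K \<Longrightarrow> f x = 0"
    using test_fun_obtain_compact[OF assms(1)] by blast
  obtain R where R: "R > 0" "\<And>x. x \<in> K \<Longrightarrow> norm x \<le> R"
    using compact_imp_bounded[OF K(1)] bounded_pos by metis
  have "norm (f x) \<le> M * indicator (cball 0 R) x" for x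
    using M K R by (cases "x \<in> K") (auto simp: indicator_def)
  with M(1) R(1) show ?thesis by (rule that)
qed

lemma test_fun_L2b:
  assumes "f \<in> test_fun"
  shows "f \<in> L2b"
proof -
  obtain M R where "M > 0" "R > 0" "\<And>x. norm (f x) \<le> M * indicator (cball 0 R) x"
    using test_fun_dominated[OF assms] by blast
  then show ?thesis
    using test_funD(2)[OF assms] emeasure_lborel_cball_finite[of 0 R]
    by (intro L2b_bounded_support[where A="cball 0 R"] borel_measurable_continuous_onI) auto
qed

section \<open>Approximation by test functions\<close>

lemma L2_norm_dominated_convergence:
  assumes f: "\<And>n. f n \<in> borel_measurable borel" and g: "g \<in> borel_measurable borel"
    and w: "w \<in> borel_measurable borel" "integrable lborel (\<lambda>x. (w x)\<^sup>2)"
    and lim: "AE x in lborel. (\<lambda>n. f n x) \<longlonglongrightarrow> g x"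
    and bound: "\<And>n. AE x in lborel. norm (f n x) \<le> w x"
  shows "g \<in> L2b" "(\<lambda>n. L2_norm (\<lambda>x. g x - f n x)) \<longlonglongrightarrow> 0"
proof -
  note [measurable] = f g w(1)
  have "AE x in lborel. \<forall>n. norm (f n x) \<le> w x" using bound by (simp add: AE_all_countable)
  with lim have ae: "AE x in lborel. norm (g x) \<le> w x"
  proof eventually_elim
    case (elim x)
    then show ?case
      by (intro Lim_bounded[OF tendsto_norm[OF elim(1)], of 0]) auto
  qed
  have w2: "(norm z)\<^sup>2 \<le> r\<^sup>2" if "norm z \<le> r" for z :: complex and r
    using that by (intro power_mono) auto
  have "integrable lborel (\<lambda>x. (norm (g x))\<^sup>2)"
    by (rule Bochner_Integration.integrable_bound[OF w(2)]) (use ae w2 in auto)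
  then show "g \<in> L2b" using g by (simp add: L2b_def)
  have "(\<lambda>n. \<integral>x. (norm (g x - f n x))\<^sup>2 \<partial>lborel) \<longlonglongrightarrow> (\<integral>x. 0 \<partial>(lborel :: (real^'a) measure))"
  proof (rule integral_dominated_convergence)
    show "integrable lborel (\<lambda>x. 4 * (w x)\<^sup>2)" using w(2) by simp
    show "AE x in lborel. (\<lambda>n. (norm (g x - f n x))\<^sup>2) \<longlonglongrightarrow> 0"
      using lim
    proof eventually_elim
      case (elim x)
      have "(\<lambda>n. (norm (g x - f n x))\<^sup>2) \<longlonglongrightarrow> (norm (g x - g x))\<^sup>2"
        by (intro tendsto_intros elim)
      then show ?case by simp
    qed
    show "AE x in lborel. norm ((norm (g x - f n x))\<^sup>2) \<le> 4 * (w x)\<^sup>2" for n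
      using ae bound[of n]
    proof eventually_elim
      case (elim x)
      then have "norm (g x - f n x) \<le> 2 * w x"
        using norm_triangle_ineq4[of "g x" "f n x"] by linarith
      then show ?case
        using w2[of "g x - f n x" "2 * w x"] by (simp add: power_mult_distrib)
    qed
  qed auto
  then have "(\<lambda>n. sqrt (\<integral>x. (norm (g x - f n x))\<^sup>2 \<partial>lborel)) \<longlonglongrightarrow> sqrt 0"
    by (intro tendsto_real_sqrt) simp
  then show "(\<lambda>n. L2_norm (\<lambda>x. g x - f n x)) \<longlonglongrightarrow> 0"
    by (simp add: L2_norm_lborel)
qed

definition test_closure :: "(real^'n \<Rightarrow> complex) set" where
  "test_closure = {f \<in> L2b. \<forall>e>0. \<exists>\<phi>\<in>test_fun. L2_norm (\<lambda>x. f x - \<phi> x) < e}"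

text \<open>Density is reached by using this closure under dominated limits repeatedly: bumps give
  indicators of cubes times smooth functions, polynomials then allow continuous factors, limits
  almost everywhere give truncated measurable functions, and letting the truncation grow gives all
  of \<open>L2b\<close>.\<close>

lemma test_closure_limit:
  assumes f: "\<And>n. f n \<in> test_closure" and g: "g \<in> borel_measurable borel"
    and w: "w \<in> borel_measurable borel" "integrable lborel (\<lambda>x. (w x)\<^sup>2)"
    and lim: "AE x in lborel. (\<lambda>n. f n x) \<longlonglongrightarrow> g x"
    and bound: "\<And>n x. norm (f n x) \<le> w x"
  shows "g \<in> test_closure"
proof -
  have f': "f n \<in> L2b" for n using f by (auto simp: test_closure_def)
  have d: "g \<in> L2b" "(\<lambda>n. L2_norm (\<lambda>x. g x - f n x)) \<longlonglongrightarrow> 0"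
    by (rule L2_norm_dominated_convergence[OF L2bD(1)[OF f'] g w lim]; simp add: bound)+
  have "\<exists>\<phi>\<in>test_fun. L2_norm (\<lambda>x. g x - \<phi> x) < e" if e: "e > 0" for e
  proof -
    have "eventually (\<lambda>n. L2_norm (\<lambda>x. g x - f n x) < e / 2) sequentially"
      using order_tendstoD(2)[OF d(2), of "e / 2"] e by simp
    then obtain n where n: "L2_norm (\<lambda>x. g x - f n x) < e / 2"
      unfolding eventually_sequentially by blast
    obtain \<phi> where \<phi>: "\<phi> \<in> test_fun" "L2_norm (\<lambda>x. f n x - \<phi> x) < e / 2"
      using f[of n] half_gt_zero[OF e] unfolding test_closure_def by blast
    have "L2_norm (\<lambda>x. (g x - f n x) + (f n x - \<phi> x)) \<le>
        L2_norm (\<lambda>x. g x - f n x) + L2_norm (\<lambda>x. f n x - \<phi> x)"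
      by (intro L2_norm_triangle L2b_diff d f' test_fun_L2b \<phi>)
    with n \<phi> show ?thesis by (intro bexI[of _ \<phi>]) auto
  qed
  with d show ?thesis by (simp add: test_closure_def)
qed

lemma test_fun_test_closure: "\<phi> \<in> test_fun \<Longrightarrow> \<phi> \<in> test_closure"
  by (auto simp: test_closure_def test_fun_L2b L2_norm_def intro!: bexI[of _ \<phi>])

lemma Ck_real_polynomial_function:
  assumes "real_polynomial_function p"
  shows "Ck k (\<lambda>x. complex_of_real (p x))"
  using assms by (induction rule: real_polynomial_function.induct)
    (auto intro: Ck_of_bounded_linear Ck_const Ck_add Ck_mult)

lemma Ck_polynomial_function:
  fixes p :: "real^'n \<Rightarrow> complex"
  assumes "polynomial_function p"
  shows "Ck k p"
proof -
  have "real_polynomial_function (\<lambda>x. Re (p x))" "real_polynomial_function (\<lambda>x. Im (p x))"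
    using assms bounded_linear_Re bounded_linear_Im unfolding polynomial_function_def o_def by blast+
  then have "Ck k (\<lambda>x. of_real (Re (p x)) + \<i> * of_real (Im (p x)))"
    by (intro Ck_add Ck_mult Ck_const Ck_real_polynomial_function)
  then show ?thesis by (simp flip: complex_eq)
qed

abbreviation cube :: "real \<Rightarrow> (real^'n) set" where
  "cube N \<equiv> box (\<chi> i. - N) (\<chi> i. N)"

lemma integrable_cbox_const_power2: "integrable lborel (\<lambda>x. (indicator (cbox a b) x * M :: real)\<^sup>2)"
proof -
  have "(\<lambda>x. (indicator (cbox a b) x * M :: real)\<^sup>2) = (\<lambda>x. indicator (cbox a b) x * M\<^sup>2)"
    by (auto simp: indicator_def)
  then show ?thesis using emeasure_lborel_cbox_finite[of a b] by simp
qed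

lemma AE_not_cube_boundary: "AE x in lborel. x \<in> box a b \<or> x \<notin> cbox a (b :: real^'n)"
  by (rule AE_I'[OF null_sets_cbox_Diff_box[of a b]]) auto

text \<open>Bumps of growing steepness converge to the indicator except on the boundary of the cube,
  which is a null set.\<close>

lemma indicator_cube_Ck_test_closure:
  assumes p: "\<And>k. Ck k p"
  shows "(\<lambda>x. indicator (cube N) x * p x) \<in> test_closure"
proof -
  let ?C = "cbox (\<chi> i. - N) (\<chi> i. N) :: (real^'a) set"
  have c: "continuous_on UNIV p" using p[of 0] by simp
  have "compact (p ` ?C)"
    by (intro compact_continuous_image continuous_on_subset[OF c]) auto
  then obtain M where M: "M > 0" "\<And>x. x \<in> ?C \<Longrightarrow> norm (p x) \<le> M"
    using compact_imp_bounded bounded_pos by (metis imageI)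
  show ?thesis
  proof (rule test_closure_limit[where f="\<lambda>n x. p x * bump (real (Suc n)) N x"
        and w="\<lambda>x. indicator ?C x * M"])
    show "(\<lambda>x. p x * bump (real (Suc n)) N x) \<in> test_closure" for n
      by (intro test_fun_test_closure test_fun_mult test_fun_bump p) auto
    show "(\<lambda>x. indicator (cube N) x * p x) \<in> borel_measurable borel"
      using borel_measurable_continuous_onI[OF c] by measurable
    show "integrable lborel (\<lambda>x. (indicator ?C x * M)\<^sup>2)" by (rule integrable_cbox_const_power2)
    show "AE x in lborel. (\<lambda>n. p x * bump (real (Suc n)) N x) \<longlonglongrightarrow> indicator (cube N) x * p x"
      using AE_not_cube_boundary[of "\<chi> i. - N" "\<chi> i. N"]
    proof eventually_elim
      case (elim x)
      show ?case
      proof (cases "x \<in> cube N")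
        case True
        have "(\<lambda>n. p x * bump (real (Suc n)) N x) \<longlonglongrightarrow> p x * 1"
          by (intro tendsto_intros LIMSEQ_Suc[OF bump_tendsto_1[OF True]])
        with True show ?thesis by simp
      next
        case False
        with elim have "bump (real (Suc n)) N x = 0" for n by (intro bump_eq_0) auto
        with False show ?thesis by simp
      qed
    qed
    show "norm (p x * bump (real (Suc n)) N x) \<le> indicator ?C x * M" for n x
    proof (cases "x \<in> ?C")
      case True
      have "norm (p x) * norm (bump (real (Suc n)) N x) \<le> M * 1"
        using M True norm_bump by (intro mult_mono) auto
      with True show ?thesis by (simp add: norm_mult)
    next
      case False
      then have "bump (real (Suc n)) N x = 0" by (intro bump_eq_0) auto
      with False show ?thesis by simp
    qed
  qed auto
qed

text \<open>Stone-Weierstrass on the closed cube with error 1/(n+1); the summand 1 in the dominating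
  function absorbs this error.\<close>

lemma indicator_cube_continuous_test_closure:
  assumes c: "continuous_on UNIV g"
  shows "(\<lambda>x. indicator (cube N) x * g x) \<in> test_closure"
proof -
  let ?C = "cbox (\<chi> i. - N) (\<chi> i. N) :: (real^'a) set"
  have "compact (g ` ?C)"
    by (intro compact_continuous_image continuous_on_subset[OF c]) auto
  then obtain M where M: "M > 0" "\<And>x. x \<in> ?C \<Longrightarrow> norm (g x) \<le> M"
    using compact_imp_bounded bounded_pos by (metis imageI)
  have "\<exists>p. polynomial_function p \<and> (\<forall>x\<in>?C. norm (g x - p x) < 1 / real (Suc n))" for n
    by (intro Stone_Weierstrass_polynomial_function continuous_on_subset[OF c]) auto
  then obtain p where p: "\<And>n. polynomial_function (p n)"
    "\<And>n x. x \<in> ?C \<Longrightarrow> norm (g x - p n x) < 1 / real (Suc n)" by metis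
  show ?thesis
  proof (rule test_closure_limit[where f="\<lambda>n x. indicator (cube N) x * p n x"
        and w="\<lambda>x. indicator ?C x * (M + 1)"])
    show "(\<lambda>x. indicator (cube N) x * p n x) \<in> test_closure" for n
      by (intro indicator_cube_Ck_test_closure Ck_polynomial_function p)
    show "(\<lambda>x. indicator (cube N) x * g x) \<in> borel_measurable borel"
      using borel_measurable_continuous_onI[OF c] by measurable
    show "integrable lborel (\<lambda>x. (indicator ?C x * (M + 1))\<^sup>2)" by (rule integrable_cbox_const_power2)
    have "(\<lambda>n. indicator (cube N) x * p n x) \<longlonglongrightarrow> indicator (cube N) x * g x" for x
    proof (cases "x \<in> cube N")
      case True
      then have x: "x \<in> ?C" using box_subset_cbox by blast
      have "(\<lambda>n. norm (p n x - g x)) \<longlonglongrightarrow> 0"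
        by (rule tendsto_sandwich[OF _ _ tendsto_const lim_inverse_n'[THEN LIMSEQ_Suc]])
           (use p(2)[OF x] in \<open>auto simp: norm_minus_commute less_imp_le intro!: always_eventually\<close>)
      then have "(\<lambda>n. p n x) \<longlonglongrightarrow> g x" using tendsto_norm_zero_iff LIM_zero_iff by blast
      with True show ?thesis by simp
    qed simp
    then show "AE x in lborel. (\<lambda>n. indicator (cube N) x * p n x) \<longlonglongrightarrow> indicator (cube N) x * g x"
      by simp
    show "norm (indicator (cube N) x * p n x) \<le> indicator ?C x * (M + 1)" for n x
    proof (cases "x \<in> cube N")
      case True
      then have x: "x \<in> ?C" using box_subset_cbox by blast
      have "norm (p n x) \<le> norm (g x) + norm (g x - p n x)"
        using norm_triangle_ineq4[of "g x" "g x - p n x"] by simp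
      also have "\<dots> \<le> M + 1"
        using M(2)[OF x] p(2)[OF x, of n] by (smt (verit) divide_le_eq_1 of_nat_0_less_iff of_nat_Suc of_nat_0_le_iff)
      finally show ?thesis using True x by (simp add: norm_mult)
    qed (use M in auto)
  qed auto
qed

lemma L2b_subset_test_closure:
  assumes f: "f \<in> L2b"
  shows "f \<in> test_closure"
proof -
  note [measurable] = L2bD(1)[OF f]
  \<comment> \<open>Radial retraction onto the ball of radius \<open>N\<close>. The
    \<open>max\<close> in the denominator makes it visibly continuous for \<open>N > 0\<close>, so
    truncated approximants converge to the truncation of \<open>f\<close>.\<close>
  define clip where "clip N z = (N / max N (norm z)) *\<^sub>R z" for N :: real and z :: complex
  have clip: "norm (clip N z) \<le> N" "norm (clip N z) \<le> norm z" if "N > 0" for N z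
    using that by (auto simp: clip_def divide_le_eq max_def field_simps mult_left_mono)
  have clip_eq: "clip N z = z" if "N > 0" "norm z \<le> N" for N z
    using that by (auto simp: clip_def max_def)
  have clip_cont: "continuous_on UNIV (clip N)" if "N > 0" for N
    using that unfolding clip_def by (intro continuous_intros) (auto simp: max_def)
  have [measurable]: "clip N \<in> borel_measurable borel" if "N > 0" for N
    using clip_cont[OF that] by (rule borel_measurable_continuous_onI)
  have "f \<in> borel_measurable lebesgue" by (auto intro!: measurable_completion)
  \<comment> \<open>This notion supplies continuous functions converging to \<open>f\<close> off a
    negligible set. They come without any bound, which is why they are truncated before passing to
    the limit.\<close>
  then have "f measurable_on UNIV"
    by (subst measurable_on_iff_borel_measurable) (auto simp: lebesgue_on_UNIV_eq)
  then obtain Z g where Z: "negligible Z" and g: "\<And>n. continuous_on UNIV (g n)"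
    and lim: "\<And>x. x \<notin> Z \<Longrightarrow> (\<lambda>n. g n x) \<longlonglongrightarrow> f x"
    unfolding measurable_on_def by auto
  have ae: "AE x in lborel. x \<notin> Z"
    using Z unfolding negligible_iff_null_sets by (metis AE_completion_iff AE_not_in)
  have trunc: "(\<lambda>x. indicator (cube N) x * clip N (f x)) \<in> test_closure" if N: "N > 0" for N
  proof (rule test_closure_limit[where f="\<lambda>n x. indicator (cube N) x * clip N (g n x)"
        and w="\<lambda>x. indicator (cbox (\<chi> i. - N) (\<chi> i. N)) x * N"])
    show "(\<lambda>x. indicator (cube N) x * clip N (g n x)) \<in> test_closure" for n
      by (intro indicator_cube_continuous_test_closure continuous_on_compose2[OF clip_cont[OF N] g]) auto
    show "(\<lambda>x. indicator (cube N) x * clip N (f x)) \<in> borel_measurable borel"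
      using N by measurable
    show "integrable lborel (\<lambda>x. (indicator (cbox (\<chi> i. - N) (\<chi> i. N)) x * N)\<^sup>2)"
      by (rule integrable_cbox_const_power2)
    show "AE x in lborel. (\<lambda>n. indicator (cube N) x * clip N (g n x)) \<longlonglongrightarrow>
        indicator (cube N) x * clip N (f x)"
      using ae
    proof eventually_elim
      case (elim x)
      have "isCont (clip N) (f x)"
        using clip_cont[OF N] by (simp add: continuous_on_eq_continuous_at)
      then show ?case
        by (intro tendsto_intros isCont_tendsto_compose[where g="clip N"] lim elim)
    qed
    show "norm (indicator (cube N) x * clip N (g n x)) \<le> indicator (cbox (\<chi> i. - N) (\<chi> i. N)) x * N" for n x
      using clip[OF N, of "g n x"] N box_subset_cbox by (auto simp: norm_mult indicator_def)
  qed auto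
  show ?thesis
  proof (rule test_closure_limit[where f="\<lambda>n x. indicator (cube (real (Suc n))) x * clip (real (Suc n)) (f x)"
        and w="\<lambda>x. norm (f x)"])
    show "(\<lambda>x. indicator (cube (real (Suc n))) x * clip (real (Suc n)) (f x)) \<in> test_closure" for n
      by (rule trunc) simp
    show "integrable lborel (\<lambda>x. (norm (f x))\<^sup>2)" using f by (rule L2bD)
    have "(\<lambda>n. indicator (cube (real (Suc n))) x * clip (real (Suc n)) (f x)) \<longlonglongrightarrow> f x" for x
    proof (rule tendsto_eventually)
      obtain m where m: "norm x + norm (f x) < real m" using reals_Archimedean2 by blast
      have "indicator (cube (real (Suc n))) x * clip (real (Suc n)) (f x) = f x" if "n \<ge> m" for n
      proof -
        have "norm x < real (Suc n)" "norm (f x) \<le> real (Suc n)"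
          using m that norm_ge_zero[of x] norm_ge_zero[of "f x"] by linarith+
        moreover from this have "\<bar>x $ i\<bar> < real (Suc n)" for i
          using component_le_norm_cart[of x i] by linarith
        then have "x \<in> cube (real (Suc n))"
          unfolding mem_box_cart by (auto simp: abs_less_iff) (smt (verit))+
        ultimately show ?thesis by (simp add: clip_eq)
      qed
      then show "\<forall>\<^sub>F n in sequentially. indicator (cube (real (Suc n))) x * clip (real (Suc n)) (f x) = f x"
        unfolding eventually_sequentially by blast
    qed
    then show "AE x in lborel. (\<lambda>n. indicator (cube (real (Suc n))) x * clip (real (Suc n)) (f x)) \<longlonglongrightarrow> f x"
      by simp
    show "norm (indicator (cube (real (Suc n))) x * clip (real (Suc n)) (f x)) \<le> norm (f x)" for n x
      using clip(2)[of "real (Suc n)" "f x"] by (auto simp: norm_mult indicator_def)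
  qed auto
qed

lemma test_fun_dense:
  assumes "f \<in> L2b" "e > 0"
  obtains \<phi> where "\<phi> \<in> test_fun" "L2_norm (\<lambda>x. f x - \<phi> x) < e"
  using L2b_subset_test_closure[OF assms(1)] assms(2) unfolding test_closure_def by blast

text \<open>The pairing is bilinear, so a test function \<open>\<phi>\<close> is chosen close to the
  conjugate of \<open>g\<close>. Orthogonality gives |g|^2 = <g, g - cnj \<phi>>, which is at most
  |g| e for every e > 0.\<close>

lemma L2b_eq_0_of_test:
  assumes g: "g \<in> L2b" and 0: "\<And>\<phi>. \<phi> \<in> test_fun \<Longrightarrow> (\<integral>x. g x * \<phi> x \<partial>lborel) = 0"
  shows "AE x in lborel. g x = 0"
proof -
  note [measurable] = L2bD(1)[OF g]
  have *: "(L2_norm g)\<^sup>2 \<le> L2_norm g * e" if e: "e > 0" for e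
  proof -
    obtain \<phi> where \<phi>: "\<phi> \<in> test_fun" "L2_norm (\<lambda>x. cnj (g x) - \<phi> x) < e"
      using test_fun_dense[OF L2b_cnj[OF g] e] by blast
    have \<phi>': "(\<lambda>x. cnj (\<phi> x)) \<in> L2b" using \<phi>(1) by (intro L2b_cnj test_fun_L2b)
    note [measurable] = L2bD(1)[OF test_fun_L2b[OF \<phi>(1)]]
    have "ip g (\<lambda>x. g x - cnj (\<phi> x)) = ip g g"
      using 0[OF \<phi>(1)] by (simp add: ip_diff_right[OF g \<phi>' g]) (simp add: ip_def)
    then have "(L2_norm g)\<^sup>2 = norm (ip g (\<lambda>x. g x - cnj (\<phi> x)))"
      by (simp add: ip_self norm_power)
    also have "\<dots> \<le> L2_norm g * L2_norm (\<lambda>x. g x - cnj (\<phi> x))"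
      by (intro ip_bound g L2b_diff \<phi>')
    also have "L2_norm (\<lambda>x. g x - cnj (\<phi> x)) = L2_norm (\<lambda>x. cnj (cnj (g x) - \<phi> x))"
      by simp
    also have "\<dots> = L2_norm (\<lambda>x. cnj (g x) - \<phi> x)"
      unfolding L2_norm_def complex_mod_cnj ..
    also have "L2_norm g * \<dots> \<le> L2_norm g * e"
      using \<phi>(2) by (intro mult_left_mono) auto
    finally show ?thesis .
  qed
  have "L2_norm g = 0"
  proof (rule ccontr)
    assume "L2_norm g \<noteq> 0"
    then have "L2_norm g > 0" using L2_norm_nonneg[of g] by linarith
    with *[of "L2_norm g / 2"] show False by (simp add: power2_eq_square)
  qed
  then have "(\<integral>x. (norm (g x))\<^sup>2 \<partial>lborel) = 0" by (simp add: L2_norm_lborel)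
  then show ?thesis
    using L2bD(2)[OF g] by (subst (asm) integral_nonneg_eq_0_iff_AE) auto
qed

section \<open>Continuity of translations\<close>

lemma L2_norm_shift_diff_tendsto_0:
  assumes \<phi>: "\<phi> \<in> test_fun" and h: "h \<longlonglongrightarrow> 0"
  shows "(\<lambda>n. L2_norm (\<lambda>x. \<phi> x - shift (h n) \<phi> x)) \<longlonglongrightarrow> 0"
proof -
  obtain M R where M: "M > 0" "R > 0" "\<And>x. norm (\<phi> x) \<le> M * indicator (cball 0 R) x"
    using test_fun_dominated[OF \<phi>] by blast
  obtain H where H: "\<And>n. norm (h n) \<le> H"
    using convergent_imp_Bseq[OF convergentI[OF h]] unfolding Bseq_def by auto
  note [measurable] = L2bD(1)[OF test_fun_L2b[OF \<phi>]]
  let ?w = "\<lambda>x::real^'a. M * indicator (cball 0 (R + H)) x :: real"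
  show ?thesis
  proof (rule L2_norm_dominated_convergence(2)[where w="?w"])
    show "?w \<in> borel_measurable borel"
      by (intro borel_measurable_times borel_measurable_const borel_measurable_indicator borel_closed closed_cball)
    have "(\<lambda>x. (?w x)\<^sup>2) = (\<lambda>x. M\<^sup>2 * indicator (cball 0 (R + H)) x)"
      by (auto simp: indicator_def)
    then show "integrable lborel (\<lambda>x. (?w x)\<^sup>2)"
      using emeasure_lborel_cball_finite[of "0::real^'a" "R + H"] by (simp only:) simp
    have "(\<lambda>n. shift (h n) \<phi> x) \<longlonglongrightarrow> \<phi> x" for x
    proof -
      have "isCont \<phi> (x + 0)" using test_funD(2)[OF \<phi>] by (simp add: continuous_on_eq_continuous_at)
      from isCont_tendsto_compose[OF this tendsto_add[OF tendsto_const h]]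
      show ?thesis by (simp add: shift_def)
    qed
    then show "AE x in lborel. (\<lambda>n. shift (h n) \<phi> x) \<longlonglongrightarrow> \<phi> x" by simp
    have "norm (shift (h n) \<phi> x) \<le> ?w x" for n x
    proof (cases "x \<in> cball 0 (R + H)")
      case True
      have "norm (shift (h n) \<phi> x) \<le> M * indicator (cball 0 R) (x + h n)"
        unfolding shift_def by (rule M)
      also have "\<dots> \<le> M" using M(1) by (simp add: indicator_def)
      finally show ?thesis using True by simp
    next
      case False
      then have "x + h n \<notin> cball 0 R"
        using H[of n] norm_triangle_ineq4[of "x + h n" "h n"] by (auto simp: dist_norm simp flip: norm_minus_cancel[of "x + h n"])
      with M(3)[of "x + h n"] False show ?thesis by (simp add: shift_def)
    qed
    then show "AE x in lborel. norm (shift (h n) \<phi> x) \<le> ?w x" for n by simp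
  qed (auto simp: shift_def[abs_def])
qed

text \<open>Translations are isometries, so the error of replacing \<open>v\<close> by a test
  function is the same before and after the shift, and only the test function has to be compared
  with its translates.\<close>

lemma ip_shift_tendsto:
  assumes v: "v \<in> L2b" and w: "w \<in> L2b" and h: "h \<longlonglongrightarrow> 0"
  shows "(\<lambda>n. ip (shift (h n) v) w) \<longlonglongrightarrow> ip v w"
proof (rule LIMSEQ_I)
  fix e :: real assume e: "e > 0"
  \<comment> \<open>A third of \<open>e\<close> for each of the three errors; the summand 1 covers
    \<open>w\<close> of norm zero.\<close>
  define d where "d = e / (3 * (L2_norm w + 1))"
  have W: "L2_norm w + 1 > 0" using L2_norm_nonneg[of w] by linarith
  then have d: "d > 0" using e by (simp add: d_def)
  obtain \<phi> where \<phi>: "\<phi> \<in> test_fun" "L2_norm (\<lambda>x. v x - \<phi> x) < d"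
    using test_fun_dense[OF v d] by blast
  note \<phi>L = test_fun_L2b[OF \<phi>(1)]
  from order_tendstoD(2)[OF L2_norm_shift_diff_tendsto_0[OF \<phi>(1) h] d]
  obtain n0 where n0: "\<And>n. n \<ge> n0 \<Longrightarrow> L2_norm (\<lambda>x. \<phi> x - shift (h n) \<phi> x) < d"
    by (auto simp: eventually_sequentially)
  have "norm (ip (shift (h n) v) w - ip v w) < e" if n: "n \<ge> n0" for n
  proof -
    let ?a = "\<lambda>x. v x - \<phi> x"
    have a: "?a \<in> L2b" by (intro L2b_diff v \<phi>L)
    have b: "(\<lambda>x. \<phi> x - shift (h n) \<phi> x) \<in> L2b" by (intro L2b_diff \<phi>L L2b_shift)
    have "ip v w - ip (shift (h n) v) w =
        (ip ?a w + ip (\<lambda>x. \<phi> x - shift (h n) \<phi> x) w) - ip (shift (h n) ?a) w"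
    proof -
      have "shift (h n) ?a = (\<lambda>x. shift (h n) v x - shift (h n) \<phi> x)" by (auto simp: shift_def)
      then show ?thesis
        by (simp add: ip_diff_left v w \<phi>L L2b_shift)
    qed
    then have "norm (ip (shift (h n) v) w - ip v w) \<le>
       norm (ip ?a w) + norm (ip (\<lambda>x. \<phi> x - shift (h n) \<phi> x) w) + norm (ip (shift (h n) ?a) w)"
      by (smt (verit) norm_minus_commute norm_triangle_ineq norm_triangle_ineq4)
    also have "\<dots> \<le> L2_norm ?a * L2_norm w + L2_norm (\<lambda>x. \<phi> x - shift (h n) \<phi> x) * L2_norm w
        + L2_norm ?a * L2_norm w"
      using ip_bound[OF a w] ip_bound[OF b w] ip_bound[OF L2b_shift[OF a, of "h n"] w]
      unfolding L2_norm_shift[OF L2bD(1)[OF a]] by linarith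
    also have "\<dots> \<le> d * L2_norm w + d * L2_norm w + d * L2_norm w"
      using \<phi>(2) n0[OF n] by (intro add_mono mult_right_mono) auto
    also have "\<dots> < 3 * (d * (L2_norm w + 1))"
      using d by (simp add: distrib_left)
    also have "\<dots> = e" using W unfolding d_def by (simp add: divide_simps)
    finally show ?thesis .
  qed
  then show "\<exists>no. \<forall>n\<ge>no. norm (ip (shift (h n) v) w - ip v w) < e" by blast
qed


section \<open>The Gaussian kernel\<close>

text \<open>The heat kernel \<open>(4 \<pi> l)\<^bsup>-n/2\<^esup> exp (- |x|\<^sup>2 / (4 l))\<close>, meaningful for \<open>l > 0\<close> only.\<close>

definition gauss :: "real \<Rightarrow> real^'n \<Rightarrow> real" where
  "gauss l x = exp (- (real CARD('n) / 2) * ln (4 * pi * l) - (norm x)\<^sup>2 / (4 * l))"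

lemma gauss_nonneg [simp]: "0 \<le> gauss l x"
  by (simp add: gauss_def)

lemma gauss_minus [simp]: "gauss l (- x) = gauss l x"
  by (simp add: gauss_def)

lemma gauss_continuous: "continuous_on UNIV (gauss l)"
  unfolding gauss_def by (cases "l = 0") (auto intro!: continuous_intros)

lemma gauss_measurable [measurable]: "gauss l \<in> borel_measurable borel"
  by (rule borel_measurable_continuous_onI[OF gauss_continuous])

text \<open>Each coordinate is normal with variance 2 l. Integrability and total mass 1 are thereby
  inherited from one dimension.\<close>

lemma gauss_prod_normal_density:
  fixes x :: "real^'n"
  assumes "l > 0"
  shows "gauss l x = (\<Prod>b\<in>Basis. normal_density 0 (sqrt (2 * l)) (x \<bullet> b))"
proof -
  have "normal_density 0 (sqrt (2 * l)) t = exp (- (1 / 2) * ln (4 * pi * l) - t\<^sup>2 / (4 * l))" for t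
  proof -
    have "exp (- (1 / 2) * ln (4 * pi * l)) = 1 / sqrt (4 * pi * l)"
      using assms by (simp add: exp_minus ln_sqrt[symmetric] inverse_eq_divide)
    moreover have "exp (- (1 / 2) * ln (4 * pi * l) - t\<^sup>2 / (4 * l)) =
        exp (- (1 / 2) * ln (4 * pi * l)) * exp (- (t\<^sup>2 / (4 * l)))"
      by (simp flip: exp_add)
    ultimately show ?thesis
      using assms by (simp add: normal_density_def)
  qed
  then have "(\<Prod>b\<in>Basis. normal_density 0 (sqrt (2 * l)) (x \<bullet> b)) =
      exp (\<Sum>b\<in>(Basis :: (real^'n) set). - (1 / 2) * ln (4 * pi * l) - (x \<bullet> b)\<^sup>2 / (4 * l))"
    by (simp add: exp_sum)
  also have "(\<Sum>b\<in>(Basis :: (real^'n) set). - (1 / 2) * ln (4 * pi * l) - (x \<bullet> b)\<^sup>2 / (4 * l)) =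
      - (real CARD('n) / 2) * ln (4 * pi * l) - (norm x)\<^sup>2 / (4 * l)"
  proof -
    have "(\<Sum>b\<in>Basis. (x \<bullet> b)\<^sup>2) = (norm x)\<^sup>2"
      by (subst power2_norm_eq_inner, subst euclidean_inner) (simp only: power2_eq_square)
    then show ?thesis by (simp add: sum_subtractf sum_divide_distrib[symmetric])
  qed
  finally show ?thesis by (simp add: gauss_def)
qed

lemma gauss_integral:
  assumes "l > 0"
  shows "integrable lborel (gauss l :: real^'n \<Rightarrow> real)" "(\<integral>x. gauss l (x :: real^'n) \<partial>lborel) = 1"
proof -
  interpret product_sigma_finite "\<lambda>_::real^'n. lborel :: real measure"
    by standard
  let ?P = "\<Pi>\<^sub>M b\<in>(Basis :: (real^'n) set). lborel :: real measure"
  let ?T = "\<lambda>f. \<Sum>b\<in>(Basis :: (real^'n) set). f b *\<^sub>R b"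
  let ?f = "\<lambda>f. \<Prod>b\<in>(Basis :: (real^'n) set). normal_density 0 (sqrt (2 * l)) (f b)"
  have T: "?T \<in> ?P \<rightarrow>\<^sub>M borel" by measurable
  have eq: "gauss l (?T f) = ?f f" for f
    unfolding gauss_prod_normal_density[OF assms] by (intro prod.cong) auto
  have l: "sqrt (2 * l) > 0" using assms by simp
  have "integrable ?P ?f"
    using l by (intro product_integrable_prod) auto
  then show "integrable lborel (gauss l :: real^'n \<Rightarrow> real)"
    by (subst lborel_eq, subst integrable_distr_eq[OF T]) (auto simp: eq)
  have "(\<integral>x. gauss l (x :: real^'n) \<partial>lborel) = (\<integral>f. ?f f \<partial>?P)"
    by (subst lborel_eq, subst integral_distr[OF T]) (auto simp: eq)
  also have "\<dots> = (\<Prod>b\<in>(Basis :: (real^'n) set). (\<integral>t. normal_density 0 (sqrt (2 * l)) t \<partial>lborel))"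
    using l by (intro product_integral_prod) auto
  also have "\<dots> = 1" using l by simp
  finally show "(\<integral>x. gauss l (x :: real^'n) \<partial>lborel) = 1" .
qed

text \<open>The bracket is the sum over \<open>i\<close> of the factors in
  \<open>partial_partial_gauss\<close>: the kernel solves the heat equation. The two sides are
  computed separately and meet where the form is differentiated in its scale.\<close>

lemma gauss_has_derivative_time:
  fixes x :: "real^'n"
  assumes "l > 0"
  shows "((\<lambda>l. gauss l x) has_real_derivative
    ((norm x)\<^sup>2 / (4 * l\<^sup>2) - real CARD('n) / (2 * l)) * gauss l x) (at l)"
proof -
  have "((\<lambda>l. - c * ln (4 * pi * l) - s / (4 * l)) has_real_derivative s / (4 * l\<^sup>2) - c / l) (at l)" for c s
    using assms by (auto intro!: derivative_eq_intros) (simp add: field_simps power2_eq_square)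
  from DERIV_fun_exp[OF this[of "real CARD('n) / 2" "(norm x)\<^sup>2"]] show ?thesis
    by (simp add: gauss_def mult.commute)
qed

lemma Ck_gauss:
  assumes "l > 0"
  shows "Ck k (\<lambda>x. complex_of_real (gauss l x))"
proof -
  \<comment> \<open>The Gaussian factorises over the coordinates; \<open>poly 1\<close> only brings
    each factor into the shape of \<open>Dk_poly_exp\<close>.\<close>
  have eq: "(\<lambda>x::real^'a. complex_of_real (gauss l x)) = (\<lambda>x. of_real (exp (- (real CARD('a) / 2) * ln (4 * pi * l))) *
      (\<Prod>i\<in>UNIV. complex_of_real (poly 1 (x $ i) * exp (- (1 / (4 * l)) * (x $ i)\<^sup>2))))"
  proof
    fix x :: "real^'a"
    have "(norm x)\<^sup>2 = (\<Sum>i\<in>UNIV. (x $ i)\<^sup>2)"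
      by (simp add: norm_vec_def L2_set_def sum_nonneg)
    then have "- (norm x)\<^sup>2 / (4 * l) = - (1 / (4 * l)) * (\<Sum>i\<in>UNIV. (x $ i)\<^sup>2)"
      by simp
    also have "\<dots> = (\<Sum>i\<in>UNIV. - (1 / (4 * l)) * (x $ i)\<^sup>2)"
      by (rule sum_distrib_left)
    finally have "exp (- (norm x)\<^sup>2 / (4 * l)) = (\<Prod>i\<in>UNIV. exp (- (1 / (4 * l)) * (x $ i)\<^sup>2))"
      by (simp only: exp_sum[OF finite])
    moreover have "gauss l x = exp (- (real CARD('a) / 2) * ln (4 * pi * l)) * exp (- (norm x)\<^sup>2 / (4 * l))"
      by (simp add: gauss_def flip: exp_add)
    ultimately have "gauss l x = exp (- (real CARD('a) / 2) * ln (4 * pi * l)) *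
        (\<Prod>i\<in>UNIV. exp (- (1 / (4 * l)) * (x $ i)\<^sup>2))"
      by (simp only:)
    then show "complex_of_real (gauss l x) = of_real (exp (- (real CARD('a) / 2) * ln (4 * pi * l))) *
      (\<Prod>i\<in>UNIV. complex_of_real (poly 1 (x $ i) * exp (- (1 / (4 * l)) * (x $ i)\<^sup>2)))"
      by simp
  qed
  show ?thesis
    unfolding eq by (intro Ck_mult Ck_const Ck_prod Ck_of_coordinate Dk_poly_exp) auto
qed

lemma gauss_has_derivative:
  fixes x :: "real^'n"
  assumes "l > 0"
  shows "(gauss l has_derivative (\<lambda>h. - (x \<bullet> h) / (2 * l) * gauss l x)) (at x)"
proof -
  have eq: "gauss l = (\<lambda>x::real^'n. exp (- (real CARD('n) / 2) * ln (4 * pi * l) - (x \<bullet> x) / (4 * l)))"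
    by (auto simp: gauss_def power2_norm_eq_inner)
  have "((\<lambda>x. exp (- (real CARD('n) / 2) * ln (4 * pi * l) - (x \<bullet> x) / (4 * l))) has_derivative
      (\<lambda>h. - (x \<bullet> h) / (2 * l) * exp (- (real CARD('n) / 2) * ln (4 * pi * l) - (x \<bullet> x) / (4 * l)))) (at x)"
    using assms by (auto intro!: derivative_eq_intros simp: inner_commute field_simps)
  then show ?thesis by (simp add: eq)
qed

lemma partial_gauss:
  assumes "l > 0"
  shows "partial i (\<lambda>x::real^'a. complex_of_real (gauss l x)) = (\<lambda>x. of_real (- (x $ i) / (2 * l) * gauss l x))"
proof
  fix x :: "real^'a"
  from bounded_linear.has_derivative[OF bounded_linear_of_real gauss_has_derivative[OF assms]]
  have "((\<lambda>x. complex_of_real (gauss l x)) has_derivative (\<lambda>h. of_real (- (x \<bullet> h) / (2 * l) * gauss l x))) (at x)" .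
  from partial_eqI[OF this]
  show "partial i (\<lambda>x. complex_of_real (gauss l x)) x = of_real (- (x $ i) / (2 * l) * gauss l x)"
    by (simp add: inner_axis)
qed

lemma partial_partial_gauss:
  assumes "l > 0"
  shows "partial i (\<lambda>x. complex_of_real (- (x $ i) / (2 * l) * gauss l x)) =
    (\<lambda>x. of_real (((x $ i)\<^sup>2 / (4 * l\<^sup>2) - 1 / (2 * l)) * gauss l x))"
proof
  fix x :: "real^'a"
  have "((\<lambda>x. x $ i) has_derivative (\<lambda>h. h $ i)) (at x)"
    by (rule bounded_linear_imp_has_derivative[OF bounded_linear_vec_nth])
  note d = has_derivative_mult[OF has_derivative_minus[OF this, THEN has_derivative_mult_left[of _ _ _ "1 / (2 * l)"]]
      gauss_has_derivative[OF assms]]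
  from partial_eqI[OF bounded_linear.has_derivative[OF bounded_linear_of_real d], of i]
  show "partial i (\<lambda>x. complex_of_real (- (x $ i) / (2 * l) * gauss l x)) x =
      of_real (((x $ i)\<^sup>2 / (4 * l\<^sup>2) - 1 / (2 * l)) * gauss l x)"
    using assms by (simp add: inner_axis power2_eq_square field_simps)
qed

lemma Ck_partial_gauss:
  assumes "l > 0"
  shows "Ck k (\<lambda>x. complex_of_real (- (x $ i) / (2 * l) * gauss l x))"
  using Ck_partial[of "\<lambda>x. complex_of_real (gauss l x)" k i] Ck_gauss[OF assms]
  unfolding partial_gauss[OF assms] by blast

text \<open>Half of the decay rate is given up to absorb the factor \<open>s\<close>, by t <= exp t
  at t = s / (8 l).\<close>

lemma mult_exp_minus_le:
  fixes s l :: real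
  assumes "l > 0"
  shows "s * exp (- s / (4 * l)) \<le> 8 * l * exp (- s / (8 * l))"
proof -
  have "s / (8 * l) \<le> exp (s / (8 * l))"
    using exp_ge_add_one_self[of "s / (8 * l)"] by linarith
  then have "s \<le> 8 * l * exp (s / (8 * l))"
    using assms by (simp add: field_simps)
  then have "s * exp (- s / (4 * l)) \<le> 8 * l * exp (s / (8 * l)) * exp (- s / (4 * l))"
    by (rule mult_right_mono) simp
  also have "\<dots> = 8 * l * exp (- s / (8 * l))"
    using assms by (simp add: exp_add[symmetric] mult.assoc)
  finally show ?thesis .
qed

text \<open>Uniformity for \<open>l\<close> in a compact interval of positive scales is the point:
  it yields a single integrable majorant when the form is differentiated in
  \<open>l\<close>.\<close>

lemma gauss_moment_bound:
  fixes x :: "real^'n"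
  assumes "0 < a" "a \<le> l" "l \<le> b"
  shows "(1 + (norm x)\<^sup>2) * gauss l x \<le>
    (1 + 8 * b) * exp (- (real CARD('n) / 2) * ln (4 * pi * a)) * exp (- (norm x)\<^sup>2 / (8 * b))"
proof -
  let ?s = "(norm x)\<^sup>2"
  have l: "l > 0" using assms by simp
  have "exp (- ?s / (4 * l)) \<le> exp (- ?s / (8 * l))"
    using l by (simp add: field_simps)
  then have "(1 + ?s) * exp (- ?s / (4 * l)) \<le> (1 + 8 * l) * exp (- ?s / (8 * l))"
    using mult_exp_minus_le[OF l, of ?s] by (simp only: distrib_right mult_1_left)
  also have "\<dots> \<le> (1 + 8 * b) * exp (- ?s / (8 * b))"
    using assms l by (intro mult_mono) (auto simp: frac_le)
  finally have 1: "(1 + ?s) * exp (- ?s / (4 * l)) \<le> (1 + 8 * b) * exp (- ?s / (8 * b))" .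
  have 2: "exp (- (real CARD('n) / 2) * ln (4 * pi * l)) \<le> exp (- (real CARD('n) / 2) * ln (4 * pi * a))"
    using assms by (simp add: mult_left_mono)
  have "(1 + ?s) * gauss l x = exp (- (real CARD('n) / 2) * ln (4 * pi * l)) * ((1 + ?s) * exp (- ?s / (4 * l)))"
  proof -
    have "gauss l x = exp (- (real CARD('n) / 2) * ln (4 * pi * l)) * exp (- ?s / (4 * l))"
      by (simp add: gauss_def flip: exp_add)
    then show ?thesis by (simp only: mult_ac)
  qed
  also have "\<dots> \<le> exp (- (real CARD('n) / 2) * ln (4 * pi * a)) * ((1 + 8 * b) * exp (- ?s / (8 * b)))"
    by (rule mult_mono[OF 2 1]) auto
  finally show ?thesis by (simp add: mult_ac)
qed

text \<open>The majorant is a multiple of the Gaussian at scale \<open>2 * b\<close>.\<close>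

lemma integrable_exp_norm_power2:
  assumes "b > 0"
  shows "integrable lborel (\<lambda>x::real^'n. exp (- (norm x)\<^sup>2 / (8 * b)))"
proof -
  have "(\<lambda>x::real^'n. exp (- (norm x)\<^sup>2 / (8 * b))) =
      (\<lambda>x. exp (real CARD('n) / 2 * ln (4 * pi * (2 * b))) * gauss (2 * b) x)"
    by (auto simp: gauss_def exp_add[symmetric])
  then show ?thesis using gauss_integral(1)[of "2 * b"] assms by simp
qed

lemma integrable_gauss_moment:
  fixes f :: "real^'n \<Rightarrow> real"
  assumes l: "l > 0" and f: "f \<in> borel_measurable borel" and b: "\<And>x. \<bar>f x\<bar> \<le> C * (1 + (norm x)\<^sup>2)"
  shows "integrable lborel (\<lambda>x. f x * gauss l x)"
proof (rule Bochner_Integration.integrable_bound)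
  let ?K = "(1 + 8 * l) * exp (- (real CARD('n) / 2) * ln (4 * pi * l))"
  show "integrable lborel (\<lambda>x::real^'n. C * (?K * exp (- (norm x)\<^sup>2 / (8 * l))))"
    by (intro integrable_mult_right integrable_exp_norm_power2[OF l])
  have C: "C \<ge> 0" using b[of 0] by simp
  have "norm (f x * gauss l x) \<le> norm (C * (?K * exp (- (norm x)\<^sup>2 / (8 * l))))" for x
  proof -
    have "norm (f x * gauss l x) \<le> C * (1 + (norm x)\<^sup>2) * gauss l x"
      using b[of x] by (simp add: abs_mult mult_right_mono)
    also have "\<dots> \<le> C * (?K * exp (- (norm x)\<^sup>2 / (8 * l)))"
      using mult_left_mono[OF gauss_moment_bound[OF l order_refl order_refl, of x] C] by (simp add: mult.assoc)
    finally show ?thesis by simp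
  qed
  then show "AE x in lborel. norm (f x * gauss l x) \<le> norm (C * (?K * exp (- (norm x)\<^sup>2 / (8 * l))))"
    by simp
qed (use f in simp)

text \<open>Completing the square by |h|^2 + |m - h|^2 = 2 |h - m/2|^2 + |m|^2 / 2. Two equal scales
  suffice, because the semigroup law is only used to double a scale.\<close>

lemma gauss_mult_gauss:
  fixes m h :: "real^'n"
  assumes "l > 0"
  shows "gauss l h * gauss l (m - h) = gauss (2 * l) m * gauss (l / 2) (h - (1 / 2) *\<^sub>R m)"
proof -
  have "(norm h)\<^sup>2 + (norm (m - h))\<^sup>2 = 2 * (norm (h - (1 / 2) *\<^sub>R m))\<^sup>2 + (norm m)\<^sup>2 / 2"
    by (simp add: power2_norm_eq_inner inner_diff_left inner_diff_right inner_commute field_simps)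
  then have "((norm h)\<^sup>2 + (norm (m - h))\<^sup>2) / (4 * l) = (2 * (norm (h - (1 / 2) *\<^sub>R m))\<^sup>2 + (norm m)\<^sup>2 / 2) / (4 * l)"
    by (simp only:)
  then have 1: "(norm h)\<^sup>2 / (4 * l) + (norm (m - h))\<^sup>2 / (4 * l) =
      (norm m)\<^sup>2 / (4 * (2 * l)) + (norm (h - (1 / 2) *\<^sub>R m))\<^sup>2 / (4 * (l / 2))"
    by (simp add: add_divide_distrib mult_ac)
  have "ln (4 * pi * (2 * l)) = ln (4 * pi * l) + ln 2" "ln (4 * pi * (l / 2)) = ln (4 * pi * l) - ln 2"
    using assms ln_mult[of "4 * pi * l" 2] ln_div[of "4 * pi * l" 2] by (simp_all add: mult_ac)
  then have 2: "- (real CARD('n) / 2) * ln (4 * pi * (2 * l)) + - (real CARD('n) / 2) * ln (4 * pi * (l / 2)) =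
      - (real CARD('n) / 2) * ln (4 * pi * l) + - (real CARD('n) / 2) * ln (4 * pi * l)"
    by (simp only:) (simp add: field_simps)
  show ?thesis
    unfolding gauss_def exp_add[symmetric] using 1 2 by (intro arg_cong[where f=exp]) linarith
qed

lemma gauss_convolution:
  fixes m :: "real^'n"
  assumes "l > 0"
  shows "(\<integral>h. gauss l h * gauss l (m - h) \<partial>lborel) = gauss (2 * l) m"
proof -
  have "(\<integral>h. gauss l h * gauss l (m - h) \<partial>lborel) =
      gauss (2 * l) m * (\<integral>h. gauss (l / 2) (h + (- (1 / 2)) *\<^sub>R m) \<partial>lborel)"
    using assms by (simp add: gauss_mult_gauss)
  also have "(\<integral>h. gauss (l / 2) (h + (- (1 / 2)) *\<^sub>R m) \<partial>lborel) = 1"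
    using assms by (subst integral_lborel_shift) (auto simp: gauss_integral)
  finally show ?thesis by simp
qed


section \<open>The heat form\<close>

lemma ip_shift_bound:
  assumes "v \<in> L2b" "w \<in> L2b"
  shows "norm (ip (shift h v) w) \<le> L2_norm v * L2_norm w"
  using ip_bound[OF L2b_shift[OF assms(1)] assms(2)] L2_norm_shift[OF L2bD(1)[OF assms(1)]] by metis

lemma ip_shift_measurable:
  assumes [measurable]: "v \<in> borel_measurable borel" "w \<in> borel_measurable borel"
  shows "(\<lambda>h. ip (shift h v) w) \<in> borel_measurable borel"
  unfolding ip_def shift_def by measurable

lemma integrable_mult_ip_shift:
  assumes v: "v \<in> L2b" and w: "w \<in> L2b" and K: "integrable lborel K"
  shows "integrable lborel (\<lambda>h. K h * ip (shift h v) w)"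
proof (rule Bochner_Integration.integrable_bound)
  show "integrable lborel (\<lambda>h. norm (K h) * (L2_norm v * L2_norm w))"
    using K by (intro integrable_mult_left integrable_norm)
  note [measurable] = ip_shift_measurable[OF L2bD(1)[OF v] L2bD(1)[OF w]] borel_measurable_integrable[OF K]
  show "(\<lambda>h. K h * ip (shift h v) w) \<in> borel_measurable lborel" by measurable
  show "AE h in lborel. norm (K h * ip (shift h v) w) \<le> norm (norm (K h) * (L2_norm v * L2_norm w))"
    using ip_shift_bound[OF v w] by (auto simp: norm_mult intro!: mult_left_mono)
qed

text \<open>Averaging translates commutes with pairing. For the Gaussian this identifies the heat
  form with a pairing of a smoothed function; for a test function the inner integral can be read, at
  each \<open>x\<close>, as a distributional pairing.\<close>

lemma ip_shift_Fubini:
  assumes v: "v \<in> L2b" and w: "w \<in> L2b" and K: "integrable lborel K"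
  shows "(\<integral>h. K h * ip (shift h v) w \<partial>lborel) = (\<integral>x. (\<integral>h. K h * v (x + h) \<partial>lborel) * cnj (w x) \<partial>lborel)"
proof -
  note [measurable] = L2bD(1)[OF v] L2bD(1)[OF w] borel_measurable_integrable[OF K]
  let ?f = "\<lambda>h x. K h * v (x + h) * cnj (w x)"
  have "integrable (lborel \<Otimes>\<^sub>M lborel) (case_prod ?f)"
  proof (rule lborel_pair.Fubini_integrable)
    have "norm (\<integral>x. norm (?f h x) \<partial>lborel) \<le> norm (norm (K h) * (L2_norm v * L2_norm w))" for h
    proof -
      have "(\<integral>x. norm (?f h x) \<partial>lborel) = norm (K h) * (\<integral>x. norm (shift h v x) * norm (w x) \<partial>lborel)"
        by (simp add: norm_mult shift_def mult.assoc)
      also have "\<dots> \<le> norm (K h) * (L2_norm (shift h v) * L2_norm w)"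
        by (intro mult_left_mono L2b_Cauchy_Schwarz L2b_shift v w) auto
      finally show ?thesis
        by (simp add: L2_norm_shift integral_nonneg_AE)
    qed
    then show "integrable lborel (\<lambda>h. \<integral>x. norm (case_prod ?f (h, x)) \<partial>lborel)"
      by (intro Bochner_Integration.integrable_bound[OF integrable_mult_left[OF integrable_norm[OF K]],
            of _ "L2_norm v * L2_norm w"] AE_I2) auto
    have "integrable lborel (\<lambda>x. K h * (shift h v x * cnj (w x)))" for h
      by (intro integrable_mult_right L2b_integrable_mult L2b_shift v w)
    then show "AE h in lborel. integrable lborel (\<lambda>x. case_prod ?f (h, x))"
      by (simp add: shift_def mult.assoc)
  qed measurable
  from lborel_pair.Fubini_integral[OF this]
  have "(\<integral>x. (\<integral>h. ?f h x \<partial>lborel) \<partial>lborel) = (\<integral>h. (\<integral>x. ?f h x \<partial>lborel) \<partial>lborel)" .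
  then show ?thesis
    by (simp add: ip_def shift_def mult.assoc flip: integral_mult_right_zero integral_mult_left_zero)
qed

text \<open>This is exp(l \<Delta>) v: the kernel is even, so averaging \<open>v (x + h)\<close> is
  the same as convolution.\<close>

definition heat :: "real \<Rightarrow> (real^'n \<Rightarrow> complex) \<Rightarrow> real^'n \<Rightarrow> complex" where
  "heat l v x = (\<integral>h. of_real (gauss l h) * v (x + h) \<partial>lborel)"

text \<open>An average of correlations, and not \<open>ip (heat l v) w\<close>: the equation is
  available for each translate separately, and derivatives in \<open>l\<close> act on the kernel
  alone.\<close>

definition heat_form :: "real \<Rightarrow> (real^'n \<Rightarrow> complex) \<Rightarrow> (real^'n \<Rightarrow> complex) \<Rightarrow> complex" where
  "heat_form l v w = (\<integral>h. of_real (gauss l h) * ip (shift h v) w \<partial>lborel)"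

lemma integrable_gauss: "l > 0 \<Longrightarrow> integrable lborel (\<lambda>h::real^'n. complex_of_real (gauss l h))"
  using gauss_integral(1) by (intro integrable_of_real)

lemma gauss_bounded:
  fixes h :: "real^'n"
  assumes "l > 0"
  shows "gauss l h \<le> gauss l (0 :: real^'n)"
  using assms by (simp add: gauss_def)

text \<open>Jensen's inequality for the probability density \<open>gauss l\<close>, obtained from
  Cauchy-Schwarz by splitting the density into two square roots, followed by Fubini.\<close>

lemma heat_L2b:
  assumes l: "l > 0" and v: "v \<in> L2b"
  shows "heat l v \<in> L2b"
proof -
  note [measurable] = L2bD(1)[OF v]
  have m [measurable]: "heat l v \<in> borel_measurable borel"
    unfolding heat_def[abs_def] by measurable
  let ?F = "\<lambda>h x. gauss l h * (norm (v (x + h)))\<^sup>2"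
  have "integrable (lborel \<Otimes>\<^sub>M lborel) (case_prod ?F)"
  proof (rule lborel_pair.Fubini_integrable)
    have "(\<integral>x. (norm (v (x + h)))\<^sup>2 \<partial>lborel) = (L2_norm v)\<^sup>2" for h
      using integral_lborel_shift[of "\<lambda>x. (norm (v x))\<^sup>2" h] by (simp add: L2_norm_power2)
    then show "integrable lborel (\<lambda>h. \<integral>x. norm (case_prod ?F (h, x)) \<partial>lborel)"
      using gauss_integral(1)[OF l, where 'n='a] by simp
    show "AE h in lborel. integrable lborel (\<lambda>x. case_prod ?F (h, x))"
      using integrable_lborel_shift[OF L2bD(2)[OF v]] by simp
  qed measurable
  then have int: "integrable lborel (\<lambda>x. \<integral>h. ?F h x \<partial>lborel)"
    by (rule lborel_pair.integrable_snd)
  have bound: "(norm (heat l v x))\<^sup>2 \<le> (\<integral>h. ?F h x \<partial>lborel)" for x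
  proof -
    define p where "p h = complex_of_real (sqrt (gauss l h))" for h :: "real^'a"
    define q where "q h = complex_of_real (sqrt (gauss l h)) * v (x + h)" for h
    have [measurable]: "p \<in> borel_measurable borel" "q \<in> borel_measurable borel"
      unfolding p_def[abs_def] q_def[abs_def] by measurable
    have p: "p \<in> L2b" using gauss_integral(1)[OF l, where 'n='a] by (simp add: L2b_def p_def)
    \<comment> \<open>This holds at every \<open>x\<close>, not just almost everywhere, since the
      Gaussian is bounded.\<close>
    have "integrable lborel (\<lambda>h. ?F h x)"
    proof (rule Bochner_Integration.integrable_bound)
      show "integrable lborel (\<lambda>h. gauss l (0 :: real^'a) * (norm (v (h + x)))\<^sup>2)"
        by (intro integrable_mult_right integrable_lborel_shift[OF L2bD(2)[OF v]])
      show "AE h in lborel. norm (?F h x) \<le> norm (gauss l (0 :: real^'a) * (norm (v (h + x)))\<^sup>2)"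
        using gauss_bounded[OF l] by (intro AE_I2) (auto simp: add.commute intro!: mult_right_mono)
    qed measurable
    then have q: "q \<in> L2b"
      by (simp add: L2b_def q_def norm_mult power_mult_distrib)
    have "norm (heat l v x) \<le> (\<integral>h. norm (of_real (gauss l h) * v (x + h)) \<partial>lborel)"
      unfolding heat_def by (rule integral_norm_bound)
    also have "\<dots> = (\<integral>h. norm (p h) * norm (q h) \<partial>lborel)"
      by (intro Bochner_Integration.integral_cong) (auto simp: p_def q_def norm_mult simp flip: mult.assoc)
    also have "\<dots> \<le> L2_norm p * L2_norm q"
      by (rule L2b_Cauchy_Schwarz[OF p q])
    also have "L2_norm p = 1"
      using gauss_integral(2)[OF l, where 'n='a] by (simp add: L2_norm_lborel) (simp add: p_def)
    finally have "(norm (heat l v x))\<^sup>2 \<le> (L2_norm q)\<^sup>2"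
      by (intro power_mono) auto
    also have "(L2_norm q)\<^sup>2 = (\<integral>h. ?F h x \<partial>lborel)"
      by (simp add: L2_norm_power2) (simp add: q_def norm_mult power_mult_distrib)
    finally show ?thesis .
  qed
  have "integrable lborel (\<lambda>x. (norm (heat l v x))\<^sup>2)"
  proof (rule Bochner_Integration.integrable_bound[OF int])
    show "AE x in lborel. norm ((norm (heat l v x))\<^sup>2) \<le> norm (\<integral>h. ?F h x \<partial>lborel)"
      using order_trans[OF bound abs_ge_self] by simp
  qed measurable
  with m show ?thesis by (simp add: L2b_def)
qed

lemma ip_heat:
  assumes "l > 0" "v \<in> L2b" "w \<in> L2b"
  shows "ip (heat l v) w = heat_form l v w"
  using ip_shift_Fubini[OF assms(2,3) integrable_gauss[OF assms(1)]]
  by (simp add: heat_form_def ip_def[of "heat l v"] heat_def)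

section \<open>Semigroup law, positivity and log-convexity of the heat form\<close>

lemma ip_shift_shift:
  assumes [measurable]: "v \<in> borel_measurable borel" "w \<in> borel_measurable borel"
  shows "ip (shift h v) (shift k w) = ip (shift (h - k) v) w"
proof -
  have "shift h v = shift k (shift (h - k) v)" by (auto simp: shift_def algebra_simps)
  moreover have "shift (h - k) v \<in> borel_measurable borel" unfolding shift_def[abs_def] by measurable
  ultimately show ?thesis by (simp add: ip_shift assms(2))
qed

text \<open>The heat operator is symmetric and obeys the semigroup law. In terms of the correlation
  \<open>\<rho>\<close>, both sides integrate \<open>\<rho>\<close> against a kernel, and the double
  Gaussian kernel collapses by \<open>gauss_convolution\<close>.\<close>

lemma ip_heat_heat:
  assumes l: "l > 0" and v: "v \<in> L2b" and w: "w \<in> L2b"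
  shows "ip (heat l v) (heat l w) = heat_form (2 * l) v w"
proof -
  note [measurable] = L2bD(1)[OF v] L2bD(1)[OF w]
  define \<rho> where "\<rho> m = ip (shift m v) w" for m
  have [measurable]: "\<rho> \<in> borel_measurable borel"
    unfolding \<rho>_def[abs_def] by (rule ip_shift_measurable) measurable
  have \<rho>b: "norm (\<rho> m) \<le> L2_norm v * L2_norm w" for m
    unfolding \<rho>_def by (rule ip_shift_bound[OF v w])
  have inner: "ip (shift h v) (heat l w) = (\<integral>m. of_real (gauss l (h - m)) * \<rho> m \<partial>lborel)" for h
  proof -
    have "ip (shift h v) (heat l w) = cnj (heat_form l w (shift h v))"
      by (subst ip_commute) (simp add: ip_heat[OF l w L2b_shift[OF v]])
    also have "\<dots> = (\<integral>k. of_real (gauss l k) * cnj (ip (shift k w) (shift h v)) \<partial>lborel)"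
      unfolding heat_form_def by (subst Bochner_Integration.integral_cnj[symmetric]) simp
    also have "\<dots> = (\<integral>k. of_real (gauss l k) * \<rho> (h - k) \<partial>lborel)"
      by (simp only: \<rho>_def ip_commute[symmetric] ip_shift_shift[OF L2bD(1)[OF v] L2bD(1)[OF w]])
    also have "\<dots> = (\<integral>k. of_real (gauss l (- k)) * \<rho> (h - (- k)) \<partial>lborel)"
      by (rule integral_lborel_reflect[symmetric]) measurable
    also have "\<dots> = (\<integral>k. (\<lambda>m. of_real (gauss l (h - m)) * \<rho> m) (k + h) \<partial>lborel)"
      using gauss_minus by (simp add: add.commute)
    also have "\<dots> = (\<integral>m. of_real (gauss l (h - m)) * \<rho> m \<partial>lborel)"
      by (rule integral_lborel_shift) measurable
    finally show ?thesis .
  qed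
  let ?f = "\<lambda>m h. complex_of_real (gauss l h * gauss l (m - h)) * \<rho> m"
  have int: "integrable (lborel \<Otimes>\<^sub>M lborel) (\<lambda>(m, h). ?f m h)"
  proof (rule lborel_pair.Fubini_integrable)
    have eq: "(\<lambda>m. \<integral>h. norm (?f m h) \<partial>lborel) = (\<lambda>m. norm (of_real (gauss (2 * l) m) * \<rho> m))"
      by (simp add: norm_mult gauss_convolution[OF l])
    show "integrable lborel (\<lambda>m. \<integral>h. norm (case (m, h) of (m, h) \<Rightarrow> ?f m h) \<partial>lborel)"
      unfolding prod.case eq unfolding \<rho>_def
      using l by (intro integrable_norm integrable_mult_ip_shift v w integrable_gauss) simp
    have "integrable lborel (\<lambda>h. complex_of_real (gauss l h * gauss l (m - h)))" for m :: "real^'a"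
    proof -
      have "integrable lborel (\<lambda>h. gauss (2 * l) m * gauss (l / 2) (h + (- (1 / 2)) *\<^sub>R m))"
        using l by (intro integrable_mult_right integrable_lborel_shift gauss_integral) simp
      then show ?thesis
        using gauss_mult_gauss[OF l, of _ m] by (intro integrable_of_real) simp
    qed
    then show "AE m in lborel. integrable lborel (\<lambda>h. case (m, h) of (m, h) \<Rightarrow> ?f m h)"
      by (simp del: of_real_mult)
  qed measurable
  have "ip (heat l v) (heat l w) = (\<integral>h. of_real (gauss l h) * (\<integral>m. of_real (gauss l (h - m)) * \<rho> m \<partial>lborel) \<partial>lborel)"
    by (simp add: ip_heat[OF l v heat_L2b[OF l w]] heat_form_def inner)
  also have "\<dots> = (\<integral>h. (\<integral>m. ?f m h \<partial>lborel) \<partial>lborel)"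
  proof -
    have "gauss l (h - m) = gauss l (m - h)" for h m :: "real^'a"
      using gauss_minus[of l "h - m"] by simp
    then show ?thesis by (simp add: mult.assoc)
  qed
  also have "\<dots> = (\<integral>m. (\<integral>h. ?f m h \<partial>lborel) \<partial>lborel)"
    by (rule lborel_pair.Fubini_integral[OF int])
  also have "\<dots> = (\<integral>m. of_real (gauss (2 * l) m) * \<rho> m \<partial>lborel)"
    by (simp only: integral_mult_left_zero integral_complex_of_real gauss_convolution[OF l])
  also have "\<dots> = heat_form (2 * l) v w" by (simp add: heat_form_def \<rho>_def)
  finally show ?thesis .
qed

text \<open>exp((l/2) \<Delta>) is a square root of exp(l \<Delta>); so the quadratic form is real
  and nonnegative.\<close>

lemma heat_form_self:
  assumes "l > 0" "v \<in> L2b"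
  shows "heat_form l v v = of_real ((L2_norm (heat (l / 2) v))\<^sup>2)"
  using ip_heat_heat[of "l / 2" v v] assms
  by (simp add: ip_self[OF L2bD(1)[OF heat_L2b]])

lemma heat_form_bound:
  assumes "l > 0" "v \<in> L2b" "w \<in> L2b"
  shows "norm (heat_form l v w) \<le> L2_norm v * L2_norm w"
proof -
  have "norm (heat_form l v w) \<le> (\<integral>h. gauss l (h :: real^'a) * (L2_norm v * L2_norm w) \<partial>lborel)"
  proof -
    have 1: "integrable lborel (\<lambda>h. complex_of_real (gauss l h) * ip (shift h v) w)"
      using assms by (intro integrable_mult_ip_shift integrable_gauss)
    have 2: "integrable lborel (\<lambda>h::real^'a. gauss l h * (L2_norm v * L2_norm w))"
      using gauss_integral(1)[OF assms(1), where 'n='a] by simp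
    have "(\<integral>h. norm (complex_of_real (gauss l h) * ip (shift h v) w) \<partial>lborel) \<le>
        (\<integral>h. gauss l (h :: real^'a) * (L2_norm v * L2_norm w) \<partial>lborel)"
      by (rule integral_mono[OF integrable_norm[OF 1] 2])
         (use ip_shift_bound[OF assms(2,3)] in \<open>auto simp: norm_mult intro!: mult_left_mono\<close>)
    then show ?thesis unfolding heat_form_def by (rule order_trans[OF integral_norm_bound])
  qed
  also have "\<dots> = L2_norm v * L2_norm w"
    using gauss_integral(2)[OF assms(1), where 'n='a] by simp
  finally show ?thesis .
qed

text \<open>Log-convexity in the scale between 0, \<open>l\<close> and \<open>2 * l\<close>: in
  Cauchy-Schwarz for \<open>ip (heat l v) v\<close>, the squared norm of \<open>heat l v\<close> is
  the form at \<open>2 * l\<close>.\<close>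

lemma heat_form_midpoint:
  assumes "l > 0" "v \<in> L2b"
  shows "(Re (heat_form l v v))\<^sup>2 \<le> Re (heat_form (2 * l) v v) * (L2_norm v)\<^sup>2"
proof -
  have "\<bar>Re (heat_form l v v)\<bar> \<le> norm (ip (heat l v) v)"
    using assms abs_Re_le_cmod by (simp add: ip_heat)
  also have "\<dots> \<le> L2_norm (heat l v) * L2_norm v"
    using assms by (intro ip_bound heat_L2b)
  finally have "(Re (heat_form l v v))\<^sup>2 \<le> (L2_norm (heat l v) * L2_norm v)\<^sup>2"
    using power_mono[of "\<bar>Re (heat_form l v v)\<bar>" _ 2] by simp
  then show ?thesis
    using heat_form_self[of "2 * l" v] assms by (simp add: power_mult_distrib)
qed

text \<open>After rescaling, the Gaussian is fixed and the scale enters only through the translations.\<close>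

lemma heat_form_tendsto_0:
  assumes v: "v \<in> L2b" and w: "w \<in> L2b" and l: "\<And>n. l n > 0" "l \<longlonglongrightarrow> 0"
  shows "(\<lambda>n. heat_form (l n) v w) \<longlonglongrightarrow> ip v w"
proof -
  have scale: "heat_form (r\<^sup>2) v w = (\<integral>k. of_real (gauss 1 k) * ip (shift (r *\<^sub>R k) v) w \<partial>lborel)"
    if r: "r > 0" for r
  proof -
    note [measurable] = ip_shift_measurable[OF L2bD(1)[OF v] L2bD(1)[OF w]]
    let ?f = "\<lambda>h. complex_of_real (gauss (r\<^sup>2) h) * ip (shift h v) w"
    have "gauss (r\<^sup>2) (r *\<^sub>R k) = gauss 1 k / r ^ CARD('a)" for k :: "real^'a"
    proof -
      have "ln (4 * pi * r\<^sup>2) = ln (4 * pi) + 2 * ln r"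
        using r by (simp add: ln_mult ln_realpow)
      then have "- (real CARD('a) / 2) * ln (4 * pi * r\<^sup>2) - (norm (r *\<^sub>R k))\<^sup>2 / (4 * r\<^sup>2) =
          (- (real CARD('a) / 2) * ln (4 * pi * 1) - (norm k)\<^sup>2 / (4 * 1)) - real CARD('a) * ln r"
        using r by (simp add: power_mult_distrib algebra_simps)
      moreover have "exp (real CARD('a) * ln r) = r ^ CARD('a)"
        using r by (simp add: exp_of_nat_mult)
      ultimately show ?thesis by (simp add: gauss_def exp_diff)
    qed
    then have eq: "r ^ CARD('a) *\<^sub>R ?f (r *\<^sub>R k) = of_real (gauss 1 k) * ip (shift (r *\<^sub>R k) v) w" for k
      using r by (simp add: scaleR_conv_of_real)
    have "integral\<^sup>L lborel ?f = integral\<^sup>L (density (distr lborel borel (\<lambda>x. 0 + r *\<^sub>R x)) (\<lambda>_. \<bar>r\<bar> ^ DIM(real^'a))) ?f"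
      using lborel_affine[of r "0::real^'a"] r by simp
    also have "\<dots> = (\<integral>k. \<bar>r\<bar> ^ DIM(real^'a) *\<^sub>R ?f (0 + r *\<^sub>R k) \<partial>lborel)"
      by (subst integral_density, (measurable; fail), (measurable; fail), simp, subst integral_distr) auto
    also have "\<dots> = (\<integral>k. of_real (gauss 1 k) * ip (shift (r *\<^sub>R k) v) w \<partial>lborel)"
      using r by (intro Bochner_Integration.integral_cong) (simp_all add: eq)
    finally show ?thesis by (simp add: heat_form_def)
  qed
  have "(\<lambda>n. \<integral>k. of_real (gauss 1 k) * ip (shift (sqrt (l n) *\<^sub>R k) v) w \<partial>lborel) \<longlonglongrightarrow>
      (\<integral>k. complex_of_real (gauss 1 (k :: real^'a)) * ip v w \<partial>lborel)"
  proof (rule integral_dominated_convergence)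
    note m [measurable] = ip_shift_measurable[OF L2bD(1)[OF v] L2bD(1)[OF w]]
    show "integrable lborel (\<lambda>k::real^'a. gauss 1 k * (L2_norm v * L2_norm w))"
      using gauss_integral(1)[of 1, where 'n='a] by simp
    show "(\<lambda>k::real^'a. complex_of_real (gauss 1 k) * ip (shift (sqrt (l n) *\<^sub>R k) v) w) \<in> borel_measurable lborel" for n
      by (intro borel_measurable_times measurable_compose[OF _ m]) measurable
    show "AE k::real^'a in lborel. norm (complex_of_real (gauss 1 k) * ip (shift (sqrt (l n) *\<^sub>R k) v) w) \<le> gauss 1 k * (L2_norm v * L2_norm w)" for n
      using ip_shift_bound[OF v w] by (auto simp: norm_mult intro!: mult_left_mono)
    have "(\<lambda>n. sqrt (l n) *\<^sub>R k) \<longlonglongrightarrow> 0" for k :: "real^'a"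
      using tendsto_scaleR[OF tendsto_real_sqrt[OF l(2)] tendsto_const[of k]] by simp
    from ip_shift_tendsto[OF v w this]
    show "AE k::real^'a in lborel. (\<lambda>n. complex_of_real (gauss 1 k) * ip (shift (sqrt (l n) *\<^sub>R k) v) w)
        \<longlonglongrightarrow> complex_of_real (gauss 1 k) * ip v w"
      by (auto intro!: tendsto_intros)
  qed measurable
  moreover have "heat_form (l n) v w = (\<integral>k. of_real (gauss 1 k) * ip (shift (sqrt (l n) *\<^sub>R k) v) w \<partial>lborel)" for n
    using scale[of "sqrt (l n)"] l(1)[of n] by simp
  moreover have "(\<integral>k. complex_of_real (gauss 1 (k :: real^'a)) * ip v w \<partial>lborel) = ip v w"
    using gauss_integral(2)[of 1, where 'n='a] by (simp only: integral_mult_left_zero integral_complex_of_real) simp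
  ultimately show ?thesis by (simp only:)
qed


section \<open>Weak derivatives\<close>

lemma Ck_cnj: "Ck k f \<Longrightarrow> Ck k (\<lambda>x. cnj (f x))"
  and partial_cnj: "f differentiable (at x) \<Longrightarrow> partial i (\<lambda>x. cnj (f x)) x = cnj (partial i f x)"
proof -
  have d: "((\<lambda>x. cnj (f x)) has_derivative (\<lambda>h. cnj (frechet_derivative f (at x) h))) (at x)"
    if "f differentiable (at x)" for f :: "real^'a \<Rightarrow> complex" and x
    using that by (intro bounded_linear.has_derivative[OF bounded_linear_cnj]) (simp add: frechet_derivative_works)
  show p: "partial i (\<lambda>x. cnj (f x)) x = cnj (partial i f x)" if "f differentiable (at x)"
    for f :: "real^'a \<Rightarrow> complex" and x i
    using partial_eqI[OF d[OF that]] by (simp add: partial_def)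
  show "Ck k f \<Longrightarrow> Ck k (\<lambda>x. cnj (f x))"
  proof (induction k arbitrary: f)
    case (Suc k)
    have f: "f differentiable (at x)" for x using Suc.prems by (rule Ck_differentiable)
    have "partial i (\<lambda>x. cnj (f x)) = (\<lambda>x. cnj (partial i f x))" for i by (intro ext p f)
    with Suc d[OF f] show ?case
      unfolding Ck_Suc_iff differentiable_def by metis
  qed (auto intro: continuous_intros)
qed

lemma test_fun_cnj:
  assumes "\<phi> \<in> test_fun"
  shows "(\<lambda>x. cnj (\<phi> x)) \<in> test_fun"
proof -
  obtain K where K: "compact K" "\<And>x. x \<notin> K \<Longrightarrow> \<phi> x = 0"
    using test_fun_obtain_compact[OF assms] by blast
  show ?thesis
    by (rule test_funI[OF _ K(1)]) (use K(2) in \<open>auto intro: Ck_cnj test_funD(1)[OF assms]\<close>)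
qed

lemma test_fun_measurable: "\<phi> \<in> test_fun \<Longrightarrow> \<phi> \<in> borel_measurable borel"
  by (intro borel_measurable_continuous_onI test_funD(2))

lemma test_fun_integrable:
  assumes "\<phi> \<in> test_fun"
  shows "integrable lborel \<phi>"
proof -
  obtain M R where M: "M > 0" "R > 0" "\<And>x. norm (\<phi> x) \<le> M * indicator (cball 0 R) x"
    using test_fun_dominated[OF assms] by blast
  show ?thesis
  proof (rule Bochner_Integration.integrable_bound)
    show "integrable lborel (\<lambda>x::real^'a. M * indicator (cball 0 R) x)"
      using emeasure_lborel_cball_finite[of "0::real^'a" R]
      by (intro integrable_mult_right integrable_real_indicator) auto
    show "AE x in lborel. norm (\<phi> x) \<le> norm (M * indicator (cball 0 R) x)"
      using M by (intro AE_I2) (auto simp: abs_mult)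
  qed (use test_fun_measurable[OF assms] in simp)
qed

section \<open>Weak derivatives and the choice of representatives\<close>

lemma has_weak_partial_lborel:
  assumes "f \<in> borel_measurable borel" "g \<in> borel_measurable borel"
  shows "has_weak_partial i f g \<longleftrightarrow>
    (\<forall>\<phi>\<in>test_fun. (\<integral>x. f x * partial i \<phi> x \<partial>lborel) = - (\<integral>x. g x * \<phi> x \<partial>lborel))"
proof -
  have "integral\<^sup>L lebesgue (\<lambda>x. f x * partial i \<phi> x) = (\<integral>x. f x * partial i \<phi> x \<partial>lborel)"
    "integral\<^sup>L lebesgue (\<lambda>x. g x * \<phi> x) = (\<integral>x. g x * \<phi> x \<partial>lborel)" if "\<phi> \<in> test_fun" for \<phi>
    using test_fun_measurable[OF that] test_fun_measurable[OF test_fun_partial[OF that]] assms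
    by (intro integral_completion; simp)+
  then show ?thesis unfolding has_weak_partial_def by simp
qed

lemma has_weak_partial_AE_cong:
  assumes f: "AE x in lebesgue. f x = f' x" "f \<in> borel_measurable lebesgue" "f' \<in> borel_measurable lebesgue"
    and g: "AE x in lebesgue. g x = g' x" "g \<in> borel_measurable lebesgue" "g' \<in> borel_measurable lebesgue"
    and w: "has_weak_partial i f g"
  shows "has_weak_partial i f' g'"
  unfolding has_weak_partial_def
proof
  fix \<phi> :: "real^'a \<Rightarrow> complex" assume \<phi>: "\<phi> \<in> test_fun"
  have [measurable]: "\<phi> \<in> borel_measurable lebesgue" "partial i \<phi> \<in> borel_measurable lebesgue"
    using test_fun_measurable[OF \<phi>] test_fun_measurable[OF test_fun_partial[OF \<phi>]]
    by (auto intro!: measurable_completion)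
  note [measurable] = f(2,3) g(2,3)
  have "integral\<^sup>L lebesgue (\<lambda>x. f' x * partial i \<phi> x) = integral\<^sup>L lebesgue (\<lambda>x. f x * partial i \<phi> x)"
    by (intro integral_cong_AE) (use f(1) in auto)
  also have "\<dots> = - integral\<^sup>L lebesgue (\<lambda>x. g x * \<phi> x)"
    using w \<phi> by (auto simp: has_weak_partial_def)
  also have "integral\<^sup>L lebesgue (\<lambda>x. g x * \<phi> x) = integral\<^sup>L lebesgue (\<lambda>x. g' x * \<phi> x)"
    by (intro integral_cong_AE) (use g(1) in auto)
  finally show "integral\<^sup>L lebesgue (\<lambda>x. f' x * partial i \<phi> x) = - integral\<^sup>L lebesgue (\<lambda>x. g' x * \<phi> x)" .
qed

lemma integrable_L2b_test_fun:
  assumes "g \<in> L2b" "\<phi> \<in> test_fun"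
  shows "integrable lborel (\<lambda>x. g x * \<phi> x)"
  using L2b_integrable_mult[OF assms(1) L2b_cnj[OF test_fun_L2b[OF assms(2)]]] by simp

lemma weak_partial_unique_L2b:
  assumes "g \<in> L2b" "g' \<in> L2b" "f \<in> borel_measurable borel"
    and "has_weak_partial i f g" "has_weak_partial i f g'"
  shows "AE x in lborel. g x = g' x"
proof -
  have "(\<integral>x. (g x - g' x) * \<phi> x \<partial>lborel) = 0" if \<phi>: "\<phi> \<in> test_fun" for \<phi>
  proof -
    have "(\<integral>x. g x * \<phi> x \<partial>lborel) = (\<integral>x. g' x * \<phi> x \<partial>lborel)"
      using assms \<phi> by (simp add: has_weak_partial_lborel L2bD)
    then show ?thesis
      using assms \<phi> by (simp add: left_diff_distrib integrable_L2b_test_fun)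
  qed
  from L2b_eq_0_of_test[OF L2b_diff[OF assms(1,2)] this]
  show ?thesis by simp
qed

text \<open>\<open>weak_partial\<close> is an arbitrary choice. By uniqueness it agrees almost
  everywhere with any Borel weak derivative at hand, and integrals see no more than that.\<close>

lemma weak_partial_L2b:
  assumes W: "W \<in> L2b" and P: "P \<in> L2b" and ae: "AE x in lebesgue. f x = W x"
    and f: "f \<in> borel_measurable lebesgue" and wp: "has_weak_partial i W P"
  shows "weak_partial i f \<in> L2" "AE x in lebesgue. weak_partial i f x = P x"
proof -
  have Wl: "W \<in> borel_measurable lebesgue" "P \<in> borel_measurable lebesgue"
    using W P by (auto dest!: L2bD(1) intro!: measurable_completion)
  have "has_weak_partial i f P"
    by (rule has_weak_partial_AE_cong[OF _ _ _ _ _ _ wp]) (use ae f Wl in auto)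
  then have "\<exists>g. g \<in> L2 \<and> has_weak_partial i f g" using L2b_L2[OF P] by blast
  from someI_ex[OF this] have g: "weak_partial i f \<in> L2" "has_weak_partial i f (weak_partial i f)"
    by (simp_all add: weak_partial_def)
  then show "weak_partial i f \<in> L2" by simp
  obtain Q where Q: "Q \<in> L2b" "AE x in lebesgue. weak_partial i f x = Q x"
    using L2_obtain_L2b[OF g(1)] by blast
  have "Q \<in> borel_measurable lebesgue" using Q(1) by (auto dest!: L2bD(1) intro!: measurable_completion)
  moreover have "weak_partial i f \<in> borel_measurable lebesgue" using g(1) by (simp add: L2_def)
  ultimately have "has_weak_partial i W Q"
    by (intro has_weak_partial_AE_cong[OF ae f Wl(1) Q(2) _ _ g(2)])
  from weak_partial_unique_L2b[OF Q(1) P L2bD(1)[OF W] this wp]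
  have "AE x in lebesgue. Q x = P x" by (rule AE_completion)
  with Q(2) show "AE x in lebesgue. weak_partial i f x = P x" by eventually_elim simp
qed

lemma H1_obtain_L2b:
  assumes "f \<in> H1"
  obtains W P where "W \<in> L2b" "AE x in lebesgue. f x = W x" "\<And>i. P i \<in> L2b"
    "\<And>i. has_weak_partial i W (P i)"
proof -
  have f: "f \<in> L2" "\<And>i. \<exists>g\<in>L2. has_weak_partial i f g" using assms by (auto simp: H1_def)
  obtain W where W: "W \<in> L2b" "AE x in lebesgue. f x = W x" using L2_obtain_L2b[OF f(1)] by blast
  have "\<exists>P. P \<in> L2b \<and> has_weak_partial i W P" for i
  proof -
    obtain g where g: "g \<in> L2" "has_weak_partial i f g" using f(2) by blast
    obtain P where P: "P \<in> L2b" "AE x in lebesgue. g x = P x" using L2_obtain_L2b[OF g(1)] by blast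
    have "W \<in> borel_measurable lebesgue" "P \<in> borel_measurable lebesgue"
      using W P by (auto dest!: L2bD(1) intro!: measurable_completion)
    with f(1) g P W have "has_weak_partial i W P"
      by (intro has_weak_partial_AE_cong[OF W(2) _ _ P(2) _ _ g(2)]) (auto simp: L2_def)
    with P show ?thesis by blast
  qed
  then obtain P where "\<And>i. P i \<in> L2b" "\<And>i. has_weak_partial i W (P i)" by metis
  with W show ?thesis by (intro that)
qed

section \<open>Weak derivatives and translations\<close>

lemma partial_shift:
  assumes "f differentiable (at (x + a))"
  shows "partial i (\<lambda>x. f (x + a)) x = partial i f (x + a)"
  using partial_affine(2)[of f 1 x a i] assms by simp

lemma test_fun_shift: "\<phi> \<in> test_fun \<Longrightarrow> (\<lambda>x. \<phi> (x + a)) \<in> test_fun"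
  using test_fun_affine[of \<phi> 1 a] by simp

text \<open>Supplies the weak derivatives of the functions with which the equation is tested. Shift
  and conjugation are both moved onto the smooth function.\<close>

lemma has_weak_partial_cnj_shift:
  assumes f: "f \<in> L2b" and g: "g \<in> L2b" and w: "has_weak_partial i f g"
  shows "has_weak_partial i (\<lambda>x. cnj (shift h f x)) (\<lambda>x. cnj (shift h g x))"
proof -
  note [measurable] = L2bD(1)[OF f] L2bD(1)[OF g] L2bD(1)[OF L2b_shift[OF f]] L2bD(1)[OF L2b_shift[OF g]]
  show ?thesis
  proof (subst has_weak_partial_lborel)
    show "\<forall>\<phi>\<in>test_fun. (\<integral>x. cnj (shift h f x) * partial i \<phi> x \<partial>lborel) = - (\<integral>x. cnj (shift h g x) * \<phi> x \<partial>lborel)"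
    proof
      fix \<phi> :: "real^'a \<Rightarrow> complex" assume \<phi>: "\<phi> \<in> test_fun"
      define \<psi> where "\<psi> x = cnj (\<phi> (x + (- h)))" for x
      have \<psi>: "\<psi> \<in> test_fun" unfolding \<psi>_def[abs_def] by (intro test_fun_cnj test_fun_shift \<phi>)
      have p: "partial i \<psi> x = cnj (partial i \<phi> (x + (- h)))" for x
        unfolding \<psi>_def[abs_def]
        by (subst partial_cnj) (use test_funD(3)[OF test_fun_shift[OF \<phi>, of "- h"]] in
            \<open>auto simp: partial_shift[OF test_funD(3)[OF \<phi>], of _ "- h", simplified]\<close>)
      note [measurable] = test_fun_measurable[OF \<phi>] test_fun_measurable[OF test_fun_partial[OF \<phi>]]
      have "(\<integral>x. cnj (shift h f x) * partial i \<phi> x \<partial>lborel) = (\<integral>x. (\<lambda>y. cnj (f y) * partial i \<phi> (y + (- h))) (x + h) \<partial>lborel)"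
        by (simp add: shift_def)
      also have "\<dots> = (\<integral>y. cnj (f y) * partial i \<phi> (y + (- h)) \<partial>lborel)"
        by (rule integral_lborel_shift) measurable
      also have "\<dots> = cnj (\<integral>y. f y * partial i \<psi> y \<partial>lborel)"
        by (subst Bochner_Integration.integral_cnj[symmetric]) (simp add: p)
      also have "(\<integral>y. f y * partial i \<psi> y \<partial>lborel) = - (\<integral>y. g y * \<psi> y \<partial>lborel)"
        using w \<psi> by (simp add: has_weak_partial_lborel)
      also have "cnj (- (\<integral>y. g y * \<psi> y \<partial>lborel)) = - (\<integral>y. cnj (g y) * \<phi> (y + (- h)) \<partial>lborel)"
        by (simp add: \<psi>_def flip: Bochner_Integration.integral_cnj)
      also have "(\<integral>y. cnj (g y) * \<phi> (y + (- h)) \<partial>lborel) = (\<integral>x. (\<lambda>y. cnj (g y) * \<phi> (y + (- h))) (x + h) \<partial>lborel)"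
        by (rule integral_lborel_shift[symmetric]) measurable
      also have "\<dots> = (\<integral>x. cnj (shift h g x) * \<phi> x \<partial>lborel)"
        by (simp add: shift_def)
      finally show "(\<integral>x. cnj (shift h f x) * partial i \<phi> x \<partial>lborel) = - (\<integral>x. cnj (shift h g x) * \<phi> x \<partial>lborel)" .
    qed
  qed measurable
qed

text \<open>For fixed \<open>x\<close>, the function \<open>h \<mapsto> v (x + h)\<close> has the
  weak derivative \<open>v' (x + h)\<close>. Testing in \<open>h\<close> and then integrating over
  \<open>x\<close> shows that correlations may be integrated by parts in \<open>h\<close>.\<close>

lemma weak_partial_test_fun_pairing:
  assumes v: "v \<in> L2b" and v': "v' \<in> L2b" and w: "w \<in> L2b" and wp: "has_weak_partial i v v'"
    and \<phi>: "\<phi> \<in> test_fun"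
  shows "(\<integral>h. partial i \<phi> h * ip (shift h v) w \<partial>lborel) = - (\<integral>h. \<phi> h * ip (shift h v') w \<partial>lborel)"
proof -
  note [measurable] = L2bD(1)[OF v] L2bD(1)[OF v'] test_fun_measurable[OF \<phi>] test_fun_measurable[OF test_fun_partial[OF \<phi>]]
  have "(\<integral>h. partial i \<phi> h * v (x + h) \<partial>lborel) = - (\<integral>h. \<phi> h * v' (x + h) \<partial>lborel)" for x
  proof -
    have "(\<integral>h. partial i \<phi> h * v (x + h) \<partial>lborel) = (\<integral>h. (\<lambda>y. v y * partial i \<phi> (y + (- x))) (h + x) \<partial>lborel)"
      by (simp add: add.commute mult.commute)
    also have "\<dots> = (\<integral>y. v y * partial i \<phi> (y + (- x)) \<partial>lborel)"
      by (rule integral_lborel_shift) measurable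
    also have "\<dots> = (\<integral>y. v y * partial i (\<lambda>y. \<phi> (y + (- x))) y \<partial>lborel)"
      by (simp only: partial_shift[OF test_funD(3)[OF \<phi>]])
    also have "\<dots> = - (\<integral>y. v' y * \<phi> (y + (- x)) \<partial>lborel)"
      using wp test_fun_shift[OF \<phi>, of "- x"] by (simp only: has_weak_partial_lborel[OF L2bD(1)[OF v] L2bD(1)[OF v']])
    also have "(\<integral>y. v' y * \<phi> (y + (- x)) \<partial>lborel) = (\<integral>h. (\<lambda>y. v' y * \<phi> (y + (- x))) (h + x) \<partial>lborel)"
      by (rule integral_lborel_shift[symmetric]) measurable
    also have "\<dots> = (\<integral>h. \<phi> h * v' (x + h) \<partial>lborel)"
      by (simp add: add.commute mult.commute)
    finally show ?thesis .
  qed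
  then show ?thesis
    by (simp add: ip_shift_Fubini v v' w test_fun_integrable \<phi> test_fun_partial)
qed

text \<open>Extends integration by parts from compactly supported kernels to integrable ones such as
  the Gaussian, through the cutoff \<eta>(r h) with r tending to 0. Differentiating the cutoff costs
  a factor r and so leaves nothing in the limit. The cutoff need only be nonzero at 0, as \<eta>(0)
  appears on both sides and cancels.\<close>

lemma weak_partial_pairing:
  assumes v: "v \<in> L2b" and v': "v' \<in> L2b" and w: "w \<in> L2b" and wp: "has_weak_partial i v v'"
    and K: "\<And>k. Ck k K" "integrable lborel K" "integrable lborel (partial i K)"
  shows "(\<integral>h. partial i K h * ip (shift h v) w \<partial>lborel) = - (\<integral>h. K h * ip (shift h v') w \<partial>lborel)"
proof -
  define \<eta> :: "real^'a \<Rightarrow> complex" where "\<eta> = bump 1 1"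
  have \<eta>: "\<eta> \<in> test_fun" "\<eta> 0 \<noteq> 0" by (auto simp: \<eta>_def test_fun_bump bump_0)
  define r where "r n = 1 / real (Suc n)" for n
  have r: "r n \<noteq> 0" "\<bar>r n\<bar> \<le> 1" for n by (auto simp: r_def)
  have r0: "r \<longlonglongrightarrow> 0" unfolding r_def by (rule LIMSEQ_Suc[OF lim_1_over_n])
  define c where "c n h = \<eta> (r n *\<^sub>R h)" for n h
  have c: "c n \<in> test_fun" for n
    using test_fun_affine[OF \<eta>(1) r(1)[of n], of 0] by (simp add: c_def[abs_def])
  have pc: "partial i (c n) h = of_real (r n) * partial i \<eta> (r n *\<^sub>R h)" for n h
    using partial_affine(2)[of \<eta> "r n" h 0 i] test_funD(3)[OF \<eta>(1)] by (simp add: c_def[abs_def])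
  obtain M where M: "M > 0" "\<And>x. norm (\<eta> x) \<le> M" using test_fun_bounded[OF \<eta>(1)] by blast
  obtain M' where M': "M' > 0" "\<And>x. norm (partial i \<eta> x) \<le> M'"
    using test_fun_bounded[OF test_fun_partial[OF \<eta>(1)]] by blast
  have lim: "(\<lambda>n. f (r n *\<^sub>R h)) \<longlonglongrightarrow> f 0" if "f \<in> test_fun" for f :: "real^'a \<Rightarrow> complex" and h
  proof -
    have "isCont f 0" using test_funD(2)[OF that] by (simp add: continuous_on_eq_continuous_at)
    moreover have "(\<lambda>n. r n *\<^sub>R h) \<longlonglongrightarrow> 0" using tendsto_scaleR[OF r0 tendsto_const[of h]] by simp
    ultimately show ?thesis by (rule isCont_tendsto_compose)
  qed
  have Kd: "K differentiable (at x)" for x using K(1) Ck_differentiable by blast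
  have pK: "partial i (\<lambda>h. K h * c n h) h = K h * partial i (c n) h + partial i K h * c n h" for n h
    by (intro partial_mult Kd test_funD(3) c)
  let ?C = "\<lambda>u. L2_norm u * L2_norm w"
  let ?L = "\<lambda>n. \<integral>h. partial i (\<lambda>h. K h * c n h) h * ip (shift h v) w \<partial>lborel"
  let ?R = "\<lambda>n. \<integral>h. K h * c n h * ip (shift h v') w \<partial>lborel"
  note [measurable] = L2bD(1)[OF v] L2bD(1)[OF v'] L2bD(1)[OF w]
    borel_measurable_integrable[OF K(2)] borel_measurable_integrable[OF K(3)]
    test_fun_measurable[OF c] test_fun_measurable[OF test_fun_partial[OF c]]
    ip_shift_measurable[OF L2bD(1)[OF v] L2bD(1)[OF w]] ip_shift_measurable[OF L2bD(1)[OF v'] L2bD(1)[OF w]]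
  have "?R \<longlonglongrightarrow> (\<integral>h. \<eta> 0 * (K h * ip (shift h v') w) \<partial>lborel)"
  proof (rule integral_dominated_convergence)
    show "integrable lborel (\<lambda>h. norm (K h) * (M * ?C v'))"
      using K(2) by (intro integrable_mult_left integrable_norm)
    show "AE h in lborel. (\<lambda>n. K h * c n h * ip (shift h v') w) \<longlonglongrightarrow> \<eta> 0 * (K h * ip (shift h v') w)"
    proof (rule AE_I2)
      fix h
      have "(\<lambda>n. K h * c n h * ip (shift h v') w) \<longlonglongrightarrow> K h * \<eta> 0 * ip (shift h v') w"
        unfolding c_def by (intro tendsto_intros lim \<eta>)
      then show "(\<lambda>n. K h * c n h * ip (shift h v') w) \<longlonglongrightarrow> \<eta> 0 * (K h * ip (shift h v') w)"
        by (simp add: mult_ac)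
    qed
    show "AE h in lborel. norm (K h * c n h * ip (shift h v') w) \<le> norm (K h) * (M * ?C v')" for n
      using M ip_shift_bound[OF v' w] unfolding c_def norm_mult mult.assoc
      by (intro AE_I2 mult_left_mono mult_mono) auto
  qed measurable
  moreover have "?L \<longlonglongrightarrow> (\<integral>h. \<eta> 0 * (partial i K h * ip (shift h v) w) \<partial>lborel)"
  proof (rule integral_dominated_convergence)
    show "integrable lborel (\<lambda>h. (norm (K h) * M' + norm (partial i K h) * M) * ?C v)"
      using K(2,3) by (intro integrable_mult_left Bochner_Integration.integrable_add integrable_norm)
    show "AE h in lborel. (\<lambda>n. partial i (\<lambda>h. K h * c n h) h * ip (shift h v) w) \<longlonglongrightarrow>
        \<eta> 0 * (partial i K h * ip (shift h v) w)"
    proof (rule AE_I2)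
      fix h
      have "(\<lambda>n. (K h * (of_real (r n) * partial i \<eta> (r n *\<^sub>R h)) + partial i K h * \<eta> (r n *\<^sub>R h)) * ip (shift h v) w)
        \<longlonglongrightarrow> (K h * (of_real 0 * partial i \<eta> 0) + partial i K h * \<eta> 0) * ip (shift h v) w"
        by (intro tendsto_intros lim \<eta> r0 test_fun_partial)
      then show "(\<lambda>n. partial i (\<lambda>h. K h * c n h) h * ip (shift h v) w) \<longlonglongrightarrow> \<eta> 0 * (partial i K h * ip (shift h v) w)"
        unfolding pK pc unfolding c_def by (simp add: mult_ac)
    qed
    show "AE h in lborel. norm (partial i (\<lambda>h. K h * c n h) h * ip (shift h v) w) \<le>
        (norm (K h) * M' + norm (partial i K h) * M) * ?C v" for n
    proof (rule AE_I2)
      fix h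
      have "norm (partial i (c n) h) \<le> 1 * M'"
        unfolding pc norm_mult using r M' by (intro mult_mono) auto
      then have "norm (K h * partial i (c n) h + partial i K h * c n h) \<le> norm (K h) * M' + norm (partial i K h) * M"
        using M(2) by (intro order_trans[OF norm_triangle_ineq] add_mono) (auto simp: norm_mult c_def intro!: mult_left_mono)
      then show "norm (partial i (\<lambda>h. K h * c n h) h * ip (shift h v) w) \<le>
        (norm (K h) * M' + norm (partial i K h) * M) * ?C v"
        unfolding pK norm_mult using ip_shift_bound[OF v w, of h] M M' by (intro mult_mono) auto
    qed
    show "(\<lambda>h. partial i (\<lambda>h. K h * c n h) h * ip (shift h v) w) \<in> borel_measurable lborel" for n
      unfolding pK by measurable
  qed measurable
  moreover have "?L = (\<lambda>n. - ?R n)"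
    by (intro ext weak_partial_test_fun_pairing v v' w wp test_fun_mult c K(1))
  ultimately have 1: "?L \<longlonglongrightarrow> - (\<integral>h. \<eta> 0 * (K h * ip (shift h v') w) \<partial>lborel)"
    and 2: "?L \<longlonglongrightarrow> (\<integral>h. \<eta> 0 * (partial i K h * ip (shift h v) w) \<partial>lborel)"
    by (simp_all only: tendsto_minus)
  have "\<eta> 0 * (\<integral>h. partial i K h * ip (shift h v) w \<partial>lborel) =
      \<eta> 0 * - (\<integral>h. K h * ip (shift h v') w \<partial>lborel)"
    using LIMSEQ_unique[OF 2 1] by simp
  with \<eta>(2) show ?thesis unfolding mult_cancel_left by blast
qed


section \<open>The heat form as a function of the scale\<close>

lemma integrable_partial_gauss:
  fixes i :: "'n::finite"
  assumes l: "l > 0"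
  shows "integrable lborel (\<lambda>h. complex_of_real (- (h $ i) / (2 * l) * gauss l (h :: real^'n)))"
    and "integrable lborel (\<lambda>h. complex_of_real (((h $ i)\<^sup>2 / (4 * l\<^sup>2) - 1 / (2 * l)) * gauss l (h :: real^'n)))"
proof -
  have c: "\<bar>h $ i\<bar> \<le> 1 + (norm h)\<^sup>2" "(h $ i)\<^sup>2 \<le> (norm h)\<^sup>2" for h :: "real^'n"
  proof -
    show "(h $ i)\<^sup>2 \<le> (norm h)\<^sup>2"
      using component_le_norm_cart[of h i] by (metis abs_ge_zero power2_abs power_mono)
    have "norm h \<le> 1 + (norm h)\<^sup>2"
      using sum_squares_bound[of "norm h" 1] by (simp add: power2_eq_square) (smt (verit) norm_ge_zero)
    then show "\<bar>h $ i\<bar> \<le> 1 + (norm h)\<^sup>2" using component_le_norm_cart[of h i] by linarith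
  qed
  show "integrable lborel (\<lambda>h. complex_of_real (- (h $ i) / (2 * l) * gauss l (h :: real^'n)))"
  proof (intro integrable_of_real integrable_gauss_moment[OF l])
    show "\<bar>- (h $ i) / (2 * l)\<bar> \<le> 1 / (2 * l) * (1 + (norm h)\<^sup>2)" for h :: "real^'n"
      using c(1)[of h] l by (simp add: divide_right_mono)
  qed measurable
  show "integrable lborel (\<lambda>h. complex_of_real (((h $ i)\<^sup>2 / (4 * l\<^sup>2) - 1 / (2 * l)) * gauss l (h :: real^'n)))"
  proof (intro integrable_of_real integrable_gauss_moment[OF l])
    fix h :: "real^'n"
    have "\<bar>(h $ i)\<^sup>2 / (4 * l\<^sup>2) - 1 / (2 * l)\<bar> \<le> (h $ i)\<^sup>2 / (4 * l\<^sup>2) + 1 / (2 * l)"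
      using l abs_triangle_ineq4[of "(h $ i)\<^sup>2 / (4 * l\<^sup>2)" "1 / (2 * l)"] by simp
    also have "\<dots> \<le> (norm h)\<^sup>2 / (4 * l\<^sup>2) + 1 / (2 * l)"
      using c(2)[of h] by (intro add_right_mono divide_right_mono) auto
    also have "\<dots> \<le> (norm h)\<^sup>2 / (4 * l\<^sup>2) + 1 / (2 * l) + (1 / (4 * l\<^sup>2) + (norm h)\<^sup>2 / (2 * l))"
      using l by simp
    also have "\<dots> = (1 / (4 * l\<^sup>2) + 1 / (2 * l)) * (1 + (norm h)\<^sup>2)"
      by (simp add: distrib_left distrib_right)
    finally show "\<bar>(h $ i)\<^sup>2 / (4 * l\<^sup>2) - 1 / (2 * l)\<bar> \<le> (1 / (4 * l\<^sup>2) + 1 / (2 * l)) * (1 + (norm h)\<^sup>2)" .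
  qed measurable
qed

text \<open>Integrating by parts twice; the second derivative falls on the other factor because
  the Gaussian is even.\<close>

lemma heat_form_second_partial:
  assumes l: "l > 0" and v: "v \<in> L2b" and p: "p \<in> L2b" and wp: "has_weak_partial i v p"
  shows "(\<integral>h. of_real (((h $ i)\<^sup>2 / (4 * l\<^sup>2) - 1 / (2 * l)) * gauss l h) * ip (shift h v) v \<partial>lborel)
    = - heat_form l p p"
proof -
  note [measurable] = L2bD(1)[OF v] L2bD(1)[OF p] ip_shift_measurable[OF L2bD(1)[OF v] L2bD(1)[OF p]]
    ip_shift_measurable[OF L2bD(1)[OF p] L2bD(1)[OF v]]
  let ?D = "\<lambda>h :: real^'a. complex_of_real (- (h $ i) / (2 * l) * gauss l h)"
  have [measurable]: "?D \<in> borel_measurable borel"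
    using borel_measurable_integrable[OF integrable_partial_gauss(1)[OF l, of i]] by simp
  have "(\<integral>h. of_real (((h $ i)\<^sup>2 / (4 * l\<^sup>2) - 1 / (2 * l)) * gauss l h) * ip (shift h v) v \<partial>lborel) =
      (\<integral>h. partial i ?D h * ip (shift h v) v \<partial>lborel)"
    by (simp only: partial_partial_gauss[OF l])
  also have "\<dots> = - (\<integral>h. ?D h * ip (shift h p) v \<partial>lborel)"
  proof (rule weak_partial_pairing[OF v p v wp])
    show "integrable lborel (partial i ?D)"
      unfolding partial_partial_gauss[OF l] by (rule integrable_partial_gauss(2)[OF l])
  qed (intro Ck_partial_gauss integrable_partial_gauss l)+
  also have "(\<integral>h. ?D h * ip (shift h p) v \<partial>lborel) = (\<integral>h. ?D (- h) * ip (shift (- h) p) v \<partial>lborel)"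
    by (rule integral_lborel_reflect[symmetric]) measurable
  also have "\<dots> = - cnj (\<integral>h. ?D h * ip (shift h v) p \<partial>lborel)"
  proof -
    have "ip (shift (- h) p) v = cnj (ip (shift h v) p)" for h
    proof -
      have "ip (shift (- h) p) v = ip (shift 0 p) (shift h v)"
        by (subst ip_shift_shift) simp_all
      also have "shift 0 p = p" by (auto simp: shift_def)
      finally show ?thesis using ip_commute by metis
    qed
    then show ?thesis by (simp flip: Bochner_Integration.integral_cnj)
  qed
  also have "(\<integral>h. ?D h * ip (shift h v) p \<partial>lborel) =
      (\<integral>h. partial i (\<lambda>h. complex_of_real (gauss l h)) h * ip (shift h v) p \<partial>lborel)"
    by (simp only: partial_gauss[OF l])
  also have "\<dots> = - heat_form l p p"
    unfolding heat_form_def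
  proof (rule weak_partial_pairing[OF v p p wp])
    show "integrable lborel (partial i (\<lambda>h. complex_of_real (gauss l h)))"
      unfolding partial_gauss[OF l] by (rule integrable_partial_gauss(1)[OF l])
  qed (intro Ck_gauss integrable_gauss l)+
  finally show ?thesis using heat_form_self[OF l p] by simp
qed

text \<open>Dominated convergence of difference quotients: by the mean value theorem each is a
  derivative of the kernel at a scale in [l/2, 2 l], where one Gaussian majorant serves all.\<close>

lemma heat_form_differentiate_under_integral:
  fixes v w :: "real^'n \<Rightarrow> complex"
  assumes l: "l > 0" and v: "v \<in> L2b" and w: "w \<in> L2b"
  shows "((\<lambda>l. Re (heat_form l v w)) has_real_derivative
    Re (\<integral>h. of_real (((norm h)\<^sup>2 / (4 * l\<^sup>2) - real CARD('n) / (2 * l)) * gauss l h) * ip (shift h v) w \<partial>lborel)) (at l)"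
proof -
  define \<rho> where "\<rho> h = ip (shift h v) w" for h
  have [measurable]: "\<rho> \<in> borel_measurable borel"
    unfolding \<rho>_def[abs_def] by (rule ip_shift_measurable[OF L2bD(1)[OF v] L2bD(1)[OF w]])
  define C where "C = L2_norm v * L2_norm w"
  have C: "norm (\<rho> h) \<le> C" "C \<ge> 0" for h
    using ip_shift_bound[OF v w] by (auto simp: \<rho>_def C_def)
  define d where "d s h = ((norm h)\<^sup>2 / (4 * s\<^sup>2) - real CARD('n) / (2 * s)) * gauss s h" for s and h :: "real^'n"
  have [measurable]: "d s \<in> borel_measurable borel" for s unfolding d_def[abs_def] by measurable
  define M where "M = (1 / l\<^sup>2 + real CARD('n) / l) * ((1 + 8 * (2 * l)) * exp (- (real CARD('n) / 2) * ln (4 * pi * (l / 2))))"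
  have M: "M \<ge> 0" using l by (simp add: M_def)
  have d: "\<bar>d s h\<bar> \<le> M * exp (- (norm h)\<^sup>2 / (8 * (2 * l)))" if s: "l / 2 \<le> s" "s \<le> 2 * l" for s and h :: "real^'n"
  proof -
    have s0: "s > 0" using s l by linarith
    have s1: "1 / (4 * s\<^sup>2) \<le> 1 / l\<^sup>2" "1 / (2 * s) \<le> 1 / l"
    proof -
      have "l \<le> 2 * s" using s by simp
      then have "l\<^sup>2 \<le> (2 * s)\<^sup>2" using l by (intro power_mono) auto
      then show "1 / (4 * s\<^sup>2) \<le> 1 / l\<^sup>2" using l s0 by (intro divide_left_mono) (auto simp: power_mult_distrib)
      show "1 / (2 * s) \<le> 1 / l" using \<open>l \<le> 2 * s\<close> l by (intro divide_left_mono) auto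
    qed
    have "\<bar>(norm h)\<^sup>2 / (4 * s\<^sup>2) - real CARD('n) / (2 * s)\<bar> \<le> (norm h)\<^sup>2 * (1 / (4 * s\<^sup>2)) + real CARD('n) * (1 / (2 * s))"
      using s0 abs_triangle_ineq4[of "(norm h)\<^sup>2 / (4 * s\<^sup>2)" "real CARD('n) / (2 * s)"] by simp
    also have "\<dots> \<le> (norm h)\<^sup>2 * (1 / l\<^sup>2) + real CARD('n) * (1 / l)"
      using s1 by (intro add_mono mult_left_mono) auto
    also have "\<dots> \<le> (1 / l\<^sup>2 + real CARD('n) / l) * (1 + (norm h)\<^sup>2)"
      using l by (simp add: algebra_simps)
    finally have "\<bar>d s h\<bar> \<le> (1 / l\<^sup>2 + real CARD('n) / l) * (1 + (norm h)\<^sup>2) * gauss s h"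
      by (simp add: d_def abs_mult mult_right_mono)
    also have "\<dots> \<le> M * exp (- (norm h)\<^sup>2 / (8 * (2 * l)))"
      using mult_left_mono[OF gauss_moment_bound[of "l / 2" s "2 * l" h], of "1 / l\<^sup>2 + real CARD('n) / l"] s l
      by (simp add: M_def mult_ac)
    finally show ?thesis .
  qed
  have eq: "heat_form s v w = (\<integral>h. of_real (gauss s h) * \<rho> h \<partial>lborel)" for s
    by (simp add: heat_form_def \<rho>_def)
  have int: "integrable lborel (\<lambda>h. complex_of_real (gauss s h) * \<rho> h)" if "s > 0" for s
    unfolding \<rho>_def by (intro integrable_mult_ip_shift v w integrable_gauss that)
  have "((\<lambda>x. (heat_form (l + x) v w - heat_form l v w) / of_real x) \<longlongrightarrow> (\<integral>h. of_real (d l h) * \<rho> h \<partial>lborel)) (at 0)"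
    unfolding tendsto_at_iff_sequentially o_def
  proof (intro allI impI)
    fix X :: "nat \<Rightarrow> real" assume X: "\<forall>i. X i \<in> UNIV - {0}" "X \<longlonglongrightarrow> 0"
    obtain N where N: "\<And>n. n \<ge> N \<Longrightarrow> \<bar>X n\<bar> < l / 2"
      using LIMSEQ_D[OF X(2), of "l / 2"] l by auto
    \<comment> \<open>Dropping finitely many terms makes every increment smaller than l/2, so that
      the majorant applies to the whole sequence.\<close>
    define Y where "Y n = X (n + N)" for n
    have Y: "Y n \<noteq> 0" "\<bar>Y n\<bar> < l / 2" for n using X(1) N[of "n + N"] by (auto simp: Y_def)
    have Y0: "Y \<longlonglongrightarrow> 0" unfolding Y_def by (rule LIMSEQ_ignore_initial_segment[OF X(2)])
    have quot: "(heat_form (l + Y n) v w - heat_form l v w) / of_real (Y n) =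
        (\<integral>h. of_real ((gauss (l + Y n) h - gauss l h) / Y n) * \<rho> h \<partial>lborel)" for n
    proof -
      have pos: "l + Y n > 0" using Y(2)[of n] l by linarith
      have "(heat_form (l + Y n) v w - heat_form l v w) / of_real (Y n) =
          (\<integral>h. (of_real (gauss (l + Y n) h) * \<rho> h - of_real (gauss l h) * \<rho> h) / of_real (Y n) \<partial>lborel)"
        unfolding eq integral_divide_zero by (subst Bochner_Integration.integral_diff[OF int[OF pos] int[OF l]]) (rule refl)
      also have "\<dots> = (\<integral>h. of_real ((gauss (l + Y n) h - gauss l h) / Y n) * \<rho> h \<partial>lborel)"
        by (intro Bochner_Integration.integral_cong refl) (simp add: left_diff_distrib diff_divide_distrib)
      finally show ?thesis .
    qed
    have "(\<lambda>n. \<integral>h. of_real ((gauss (l + Y n) h - gauss l h) / Y n) * \<rho> h \<partial>lborel) \<longlonglongrightarrow> (\<integral>h. of_real (d l h) * \<rho> h \<partial>lborel)"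
    proof (rule integral_dominated_convergence)
      show "integrable lborel (\<lambda>h::real^'n. M * exp (- (norm h)\<^sup>2 / (8 * (2 * l))) * C)"
        using l by (intro integrable_mult_right integrable_mult_left integrable_exp_norm_power2) simp
      have "(\<lambda>n. (gauss (l + Y n) h - gauss l h) / Y n) \<longlonglongrightarrow> d l h" for h :: "real^'n"
      proof -
        have "((\<lambda>x. (gauss (l + x) h - gauss l h) / x) \<longlongrightarrow> d l h) (at 0)"
          using gauss_has_derivative_time[OF l, of h] by (simp add: DERIV_def d_def)
        then show ?thesis using Y(1) Y0 unfolding tendsto_at_iff_sequentially o_def by auto
      qed
      then show "AE h in lborel. (\<lambda>n. of_real ((gauss (l + Y n) h - gauss l h) / Y n) * \<rho> h) \<longlonglongrightarrow> of_real (d l h) * \<rho> h"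
        by (intro AE_I2 tendsto_mult tendsto_of_real tendsto_const)
      show "AE h in lborel. norm (of_real ((gauss (l + Y n) h - gauss l h) / Y n) * \<rho> h) \<le> M * exp (- (norm h)\<^sup>2 / (8 * (2 * l))) * C" for n
      proof (rule AE_I2)
        fix h :: "real^'n"
        have dg: "((\<lambda>s. gauss s h) has_real_derivative d s h) (at s)" if "s > 0" for s
          using gauss_has_derivative_time[OF that, of h] by (simp add: d_def)
        obtain s where s: "l / 2 \<le> s" "s \<le> 2 * l" "(gauss (l + Y n) h - gauss l h) / Y n = d s h"
        proof (cases "Y n > 0")
          case True
          obtain s where "l < s" "s < l + Y n" "gauss (l + Y n) h - gauss l h = (l + Y n - l) * d s h"
            using MVT2[of l "l + Y n" "\<lambda>s. gauss s h" "\<lambda>s. d s h"] dg l True by auto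
          then show ?thesis using Y[of n] l by (intro that[of s]) auto
        next
          case False
          then have neg: "Y n < 0" using Y(1)[of n] by simp
          obtain s where "l + Y n < s" "s < l" "gauss l h - gauss (l + Y n) h = (l - (l + Y n)) * d s h"
            using MVT2[of "l + Y n" l "\<lambda>s. gauss s h" "\<lambda>s. d s h"] dg l neg Y(2)[of n] by auto
          then show ?thesis using Y[of n] l neg by (intro that[of s]) (auto simp: field_simps)
        qed
        show "norm (of_real ((gauss (l + Y n) h - gauss l h) / Y n) * \<rho> h) \<le> M * exp (- (norm h)\<^sup>2 / (8 * (2 * l))) * C"
          unfolding s(3) norm_mult norm_of_real using d[OF s(1,2)] C M by (intro mult_mono) auto
      qed
    qed measurable
    then have "(\<lambda>n. (heat_form (l + X (n + N)) v w - heat_form l v w) / of_real (X (n + N))) \<longlonglongrightarrow> (\<integral>h. of_real (d l h) * \<rho> h \<partial>lborel)"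
      unfolding quot[symmetric] by (simp add: Y_def)
    then show "(\<lambda>n. (heat_form (l + X n) v w - heat_form l v w) / of_real (X n)) \<longlonglongrightarrow> (\<integral>h. of_real (d l h) * \<rho> h \<partial>lborel)"
      by (rule LIMSEQ_offset)
  qed
  from tendsto_Re[OF this] show ?thesis
    by (simp add: DERIV_def d_def \<rho>_def)
qed

text \<open>Here the heat equation for the kernel is used: its derivative in \<open>l\<close> is the
  sum of its pure second partials, and \<open>heat_form_second_partial\<close> turns each of them
  into the form of a weak derivative.\<close>

lemma heat_form_has_derivative_scale:
  fixes v :: "real^'n \<Rightarrow> complex"
  assumes l: "l > 0" and v: "v \<in> L2b" and p: "\<And>i. p i \<in> L2b" "\<And>i. has_weak_partial i v (p i)"
  shows "((\<lambda>l. Re (heat_form l v v)) has_real_derivative - (\<Sum>i\<in>UNIV. Re (heat_form l (p i) (p i)))) (at l)"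
proof -
  let ?g = "\<lambda>i h. complex_of_real (((h $ i)\<^sup>2 / (4 * l\<^sup>2) - 1 / (2 * l)) * gauss l (h :: real^'n))"
  have "complex_of_real (((norm h)\<^sup>2 / (4 * l\<^sup>2) - real CARD('n) / (2 * l)) * gauss l h) = (\<Sum>i\<in>UNIV. ?g i h)" for h :: "real^'n"
  proof -
    have "(norm h)\<^sup>2 = (\<Sum>i\<in>UNIV. (h $ i)\<^sup>2)"
      by (simp add: norm_vec_def L2_set_def sum_nonneg)
    then have "((norm h)\<^sup>2 / (4 * l\<^sup>2) - real CARD('n) / (2 * l)) * gauss l h =
        (\<Sum>i\<in>UNIV. ((h $ i)\<^sup>2 / (4 * l\<^sup>2) - 1 / (2 * l)) * gauss l h)"
      by (simp add: sum_subtractf flip: sum_distrib_right sum_divide_distrib)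
    then show ?thesis by (simp only: of_real_sum)
  qed
  then have "(\<integral>h. of_real (((norm h)\<^sup>2 / (4 * l\<^sup>2) - real CARD('n) / (2 * l)) * gauss l h) * ip (shift h v) v \<partial>lborel) =
      (\<integral>h. (\<Sum>i\<in>UNIV. ?g i h * ip (shift h v) v) \<partial>lborel)"
    by (simp only: sum_distrib_right)
  also have "\<dots> = (\<Sum>i\<in>UNIV. \<integral>h. ?g i h * ip (shift h v) v \<partial>lborel)"
    by (intro Bochner_Integration.integral_sum integrable_mult_ip_shift v integrable_partial_gauss l)
  also have "\<dots> = (\<Sum>i\<in>UNIV. - heat_form l (p i) (p i))"
    by (intro sum.cong refl heat_form_second_partial l v p)
  finally show ?thesis
    using heat_form_differentiate_under_integral[OF l v v] by (simp add: sum_negf)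
qed


section \<open>The equation and the heat form\<close>

lemma L2b_borel_lebesgue: "f \<in> L2b \<Longrightarrow> f \<in> borel_measurable lebesgue"
  by (auto dest!: L2bD(1) intro!: measurable_completion)

lemma dual_L2_eq_ip:
  assumes F: "F \<in> L2b" and G: "G \<in> L2b"
    and f: "f \<in> borel_measurable lebesgue" "AE x in lebesgue. f x = F x"
    and g: "g \<in> borel_measurable lebesgue" "AE x in lebesgue. g x = cnj (G x)"
  shows "dual_L2 f g = ip F G"
proof -
  note [measurable] = L2b_borel_lebesgue[OF F] L2b_borel_lebesgue[OF G] f(1) g(1) L2bD(1)[OF F] L2bD(1)[OF G]
  have "dual_L2 f g = integral\<^sup>L lebesgue (\<lambda>x. F x * cnj (G x))"
    unfolding dual_L2_def
  proof (rule integral_cong_AE)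
    show "AE x in lebesgue. f x * g x = F x * cnj (G x)"
      using f(2) g(2) by eventually_elim simp
  qed measurable
  also have "\<dots> = ip F G"
    unfolding ip_def by (rule integral_completion) measurable
  finally show ?thesis .
qed

lemma dual_L2_cmult: "dual_L2 (\<lambda>x. k * f x) g = k * dual_L2 f g"
  by (simp add: dual_L2_def mult.assoc)

lemma ip_shift_right:
  assumes "f \<in> L2b" "g \<in> L2b"
  shows "ip f (shift (- h) g) = ip (shift h f) g"
proof -
  have "shift 0 f = f" by (auto simp: shift_def)
  then show ?thesis using ip_shift_shift[OF L2bD(1)[OF assms(1)] L2bD(1)[OF assms(2)], of 0 "- h"] by simp
qed

text \<open>Testing with the conjugate of \<open>shift (- h) W\<close> turns the bilinear pairing
  into \<open>ip\<close> and moves the shift, with opposite sign, to the other argument. The second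
  order term ends up with a plus because \<open>dual_partial\<close> carries a minus and the term
  changes sides.\<close>

lemma L_op_tested_with_shift:
  assumes w: "w \<in> borel_measurable lebesgue" "AE x in lebesgue. w x = W x"
    and W: "W \<in> L2b" and P: "\<And>i. P i \<in> L2b" "\<And>i. has_weak_partial i W (P i)"
    and v: "v \<in> borel_measurable lebesgue" "AE x in lebesgue. v x = V x" "V \<in> L2b"
    and eq: "\<And>\<phi>. \<phi> \<in> H1 \<Longrightarrow> L_op a b c t v w \<phi> = 0"
  shows "ip (shift h V) W =
    (\<Sum>i\<in>UNIV. \<Sum>j\<in>UNIV. of_real (a i j t) * ip (shift h (P j)) (P i))
    - (\<Sum>j\<in>UNIV. b j t * ip (shift h (P j)) W) - c t * ip (shift h W) W"
proof -
  define \<phi> where "\<phi> x = cnj (shift (- h) W x)" for x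
  have \<phi>: "\<phi> \<in> L2b" unfolding \<phi>_def[abs_def] by (intro L2b_cnj L2b_shift W)
  have P': "(\<lambda>x. cnj (shift (- h) (P i) x)) \<in> L2b" for i by (intro L2b_cnj L2b_shift P)
  have wp: "has_weak_partial i \<phi> (\<lambda>x. cnj (shift (- h) (P i) x))" for i
    unfolding \<phi>_def[abs_def] by (intro has_weak_partial_cnj_shift W P)
  have "\<phi> \<in> H1" unfolding H1_def using L2b_L2[OF \<phi>] L2b_L2[OF P'] wp by blast
  from eq[OF this] have 0: "L_op a b c t v w \<phi> = 0" .
  have p\<phi>: "weak_partial i \<phi> \<in> borel_measurable lebesgue"
    "AE x in lebesgue. weak_partial i \<phi> x = cnj (shift (- h) (P i) x)" for i
    using weak_partial_L2b[OF \<phi> P' _ L2b_borel_lebesgue[OF \<phi>] wp] by (auto simp: L2_def)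
  have pw: "weak_partial i w \<in> borel_measurable lebesgue"
    "AE x in lebesgue. weak_partial i w x = P i x" for i
    using weak_partial_L2b[OF W P(1) w(2,1) P(2)] by (auto simp: L2_def)
  have \<phi>a: "\<phi> \<in> borel_measurable lebesgue" "AE x in lebesgue. \<phi> x = cnj (shift (- h) W x)"
    using L2b_borel_lebesgue[OF \<phi>] by (auto simp: \<phi>_def)
  have 1: "dual_L2 v \<phi> = ip (shift h V) W"
    using dual_L2_eq_ip[OF v(3) L2b_shift[OF W] v(1,2) \<phi>a] by (simp add: ip_shift_right v W)
  have 2: "dual_L2 w \<phi> = ip (shift h W) W"
    using dual_L2_eq_ip[OF W L2b_shift[OF W] w \<phi>a] by (simp add: ip_shift_right W)
  have 3: "dual_L2 (weak_partial j w) \<phi> = ip (shift h (P j)) W" for j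
    using dual_L2_eq_ip[OF P(1) L2b_shift[OF W] pw \<phi>a] by (simp add: ip_shift_right P W)
  have 4: "dual_L2 (weak_partial j w) (weak_partial i \<phi>) = ip (shift h (P j)) (P i)" for i j
    using dual_L2_eq_ip[OF P(1) L2b_shift[OF P(1)] pw p\<phi>] by (simp add: ip_shift_right P)
  show ?thesis
    using 0 unfolding L_op_def dual_partial_def dual_L2_cmult 1 2 3 4
    by (simp add: sum_negf algebra_simps)
qed

text \<open>At a fixed time the coefficients are constants, so averaging the tested equation over
  \<open>h\<close> with Gaussian weight replaces every correlation by the heat form.\<close>

lemma heat_form_equation:
  assumes l: "l > 0" and W: "W \<in> L2b" and P: "\<And>i. P i \<in> L2b" and V: "V \<in> L2b"
    and eq: "\<And>h. ip (shift h V) W =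
    (\<Sum>i\<in>UNIV. \<Sum>j\<in>UNIV. A i j * ip (shift h (P j)) (P i))
    - (\<Sum>j\<in>UNIV. b j * ip (shift h (P j)) W) - c * ip (shift h W) W"
  shows "heat_form l V W =
    (\<Sum>i\<in>UNIV. \<Sum>j\<in>UNIV. A i j * heat_form l (P j) (P i))
    - (\<Sum>j\<in>UNIV. b j * heat_form l (P j) W) - c * heat_form l W W"
proof -
  let ?g = "\<lambda>h. complex_of_real (gauss l h)"
  have i: "integrable lborel (\<lambda>h. k * (?g h * ip (shift h u) w))" if "u \<in> L2b" "w \<in> L2b" for u w k
    using that by (intro integrable_mult_right integrable_mult_ip_shift integrable_gauss l)
  define I1 I2 I3 where
    "I1 h = (\<Sum>i\<in>UNIV. \<Sum>j\<in>UNIV. A i j * (?g h * ip (shift h (P j)) (P i)))" and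
    "I2 h = (\<Sum>j\<in>UNIV. b j * (?g h * ip (shift h (P j)) W))" and
    "I3 h = c * (?g h * ip (shift h W) W)" for h
  have int: "integrable lborel I1" "integrable lborel I2" "integrable lborel I3"
    unfolding I1_def I2_def I3_def by (intro Bochner_Integration.integrable_sum i P W)+
  have "?g h * ip (shift h V) W = I1 h - I2 h - I3 h" for h
    unfolding eq I1_def I2_def I3_def right_diff_distrib sum_distrib_left
    by (simp only: mult.left_commute[of "?g h"])
  then have "heat_form l V W = (\<integral>h. I1 h - I2 h - I3 h \<partial>lborel)"
    by (simp only: heat_form_def)
  also have "\<dots> = (\<integral>h. I1 h \<partial>lborel) - (\<integral>h. I2 h \<partial>lborel) - (\<integral>h. I3 h \<partial>lborel)"
    using int by simp
  also have "(\<integral>h. I1 h \<partial>lborel) = (\<Sum>i\<in>UNIV. \<Sum>j\<in>UNIV. A i j * heat_form l (P j) (P i))"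
    by (simp add: Bochner_Integration.integral_sum i P W Bochner_Integration.integrable_sum heat_form_def I1_def)
  also have "(\<integral>h. I2 h \<partial>lborel) = (\<Sum>j\<in>UNIV. b j * heat_form l (P j) W)"
    by (simp add: Bochner_Integration.integral_sum i P W heat_form_def I2_def)
  also have "(\<integral>h. I3 h \<partial>lborel) = c * heat_form l W W"
    by (simp add: heat_form_def I3_def)
  finally show ?thesis .
qed

text \<open>Ellipticity is given for real vectors. The real part of X_j cnj(X_i) is the product of
  the real parts plus that of the imaginary parts, so the form splits over two real vectors without
  mixed terms.\<close>

lemma Re_elliptic_form:
  fixes X :: "'n::finite \<Rightarrow> complex" and A :: "'n \<Rightarrow> 'n \<Rightarrow> real"
  defines "S \<equiv> \<lambda>\<xi>::real^'n. \<Sum>i\<in>UNIV. \<Sum>j\<in>UNIV. A i j * (\<xi> $ i) * (\<xi> $ j)"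
  shows "Re (\<Sum>i\<in>UNIV. \<Sum>j\<in>UNIV. of_real (A i j) * (X j * cnj (X i))) = S (\<chi> i. Re (X i)) + S (\<chi> i. Im (X i))"
    and "(\<Sum>i\<in>UNIV. (norm (X i))\<^sup>2) = (norm (\<chi> i. Re (X i)))\<^sup>2 + (norm (\<chi> i. Im (X i)))\<^sup>2"
proof -
  show "Re (\<Sum>i\<in>UNIV. \<Sum>j\<in>UNIV. of_real (A i j) * (X j * cnj (X i))) = S (\<chi> i. Re (X i)) + S (\<chi> i. Im (X i))"
    unfolding S_def by (simp add: sum.distrib[symmetric] algebra_simps)
  show "(\<Sum>i\<in>UNIV. (norm (X i))\<^sup>2) = (norm (\<chi> i. Re (X i)))\<^sup>2 + (norm (\<chi> i. Im (X i)))\<^sup>2"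
    by (simp add: norm_vec_def L2_set_def sum_nonneg cmod_power2 sum.distrib)
qed

text \<open>\<open>A\<close> is constant in x, so ellipticity can be applied to the vector of values
  at each point and then integrated.\<close>

lemma ip_elliptic_form:
  fixes X :: "'n::finite \<Rightarrow> real^'n \<Rightarrow> complex" and A :: "'n \<Rightarrow> 'n \<Rightarrow> real"
  assumes X: "\<And>i. X i \<in> L2b"
    and ell: "\<And>\<xi>::real^'n. k * (norm \<xi>)\<^sup>2 \<le> (\<Sum>i\<in>UNIV. \<Sum>j\<in>UNIV. A i j * (\<xi> $ i) * (\<xi> $ j))"
      "\<And>\<xi>::real^'n. (\<Sum>i\<in>UNIV. \<Sum>j\<in>UNIV. A i j * (\<xi> $ i) * (\<xi> $ j)) \<le> K * (norm \<xi>)\<^sup>2"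
  shows "k * (\<Sum>i\<in>UNIV. (L2_norm (X i))\<^sup>2) \<le> Re (\<Sum>i\<in>UNIV. \<Sum>j\<in>UNIV. of_real (A i j) * ip (X j) (X i))"
    and "Re (\<Sum>i\<in>UNIV. \<Sum>j\<in>UNIV. of_real (A i j) * ip (X j) (X i)) \<le> K * (\<Sum>i\<in>UNIV. (L2_norm (X i))\<^sup>2)"
proof -
  let ?F = "\<lambda>x. \<Sum>i\<in>UNIV. \<Sum>j\<in>UNIV. of_real (A i j) * (X j x * cnj (X i x))"
  let ?N = "\<lambda>x. \<Sum>i\<in>UNIV. (norm (X i x))\<^sup>2"
  have F: "integrable lborel ?F"
    by (intro Bochner_Integration.integrable_sum integrable_mult_right L2b_integrable_mult X)
  have N: "integrable lborel ?N"
    by (intro Bochner_Integration.integrable_sum L2bD X)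
  have "(\<integral>x. ?F x \<partial>lborel) = (\<Sum>i\<in>UNIV. \<Sum>j\<in>UNIV. of_real (A i j) * ip (X j) (X i))"
    by (simp add: Bochner_Integration.integral_sum Bochner_Integration.integrable_sum L2b_integrable_mult X ip_def)
  then have 1: "Re (\<Sum>i\<in>UNIV. \<Sum>j\<in>UNIV. of_real (A i j) * ip (X j) (X i)) = (\<integral>x. Re (?F x) \<partial>lborel)"
    using integral_Re[OF F] by simp
  have 2: "(\<Sum>i\<in>UNIV. (L2_norm (X i))\<^sup>2) = (\<integral>x. ?N x \<partial>lborel)"
    by (simp add: L2_norm_power2 L2bD X Bochner_Integration.integral_sum)
  have b: "k * ?N x \<le> Re (?F x)" "Re (?F x) \<le> K * ?N x" for x
    unfolding Re_elliptic_form distrib_left by (intro add_mono ell)+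
  have "k * (\<integral>x. ?N x \<partial>lborel) = (\<integral>x. k * ?N x \<partial>lborel)" by simp
  also have "\<dots> \<le> (\<integral>x. Re (?F x) \<partial>lborel)"
    by (intro integral_mono b integrable_mult_right N integrable_Re F)
  finally show "k * (\<Sum>i\<in>UNIV. (L2_norm (X i))\<^sup>2) \<le> Re (\<Sum>i\<in>UNIV. \<Sum>j\<in>UNIV. of_real (A i j) * ip (X j) (X i))"
    unfolding 1 2 .
  have "(\<integral>x. Re (?F x) \<partial>lborel) \<le> (\<integral>x. K * ?N x \<partial>lborel)"
    by (intro integral_mono b integrable_mult_right N integrable_Re F)
  also have "\<dots> = K * (\<integral>x. ?N x \<partial>lborel)" by simp
  finally show "Re (\<Sum>i\<in>UNIV. \<Sum>j\<in>UNIV. of_real (A i j) * ip (X j) (X i)) \<le> K * (\<Sum>i\<in>UNIV. (L2_norm (X i))\<^sup>2)"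
    unfolding 1 2 .
qed

text \<open>All functions are replaced by their images under exp((l/2) \<Delta>); the heat form
  becomes \<open>ip\<close>, and ellipticity and Cauchy-Schwarz apply. Young's inequality lets the
  drift consume half of the elliptic gain k Q and puts the rest into \<open>C\<close>. For the upper
  bound, 1/k + k/2 <= 2/k since k < 1.\<close>

lemma heat_form_energy_bounds:
  fixes P :: "'n::finite \<Rightarrow> real^'n \<Rightarrow> complex" and A :: "'n \<Rightarrow> 'n \<Rightarrow> real"
  assumes l: "l > 0" and W: "W \<in> L2b" and P: "\<And>i. P i \<in> L2b"
    and k: "0 < k" "k < 1"
    and ell: "\<And>\<xi>::real^'n. k * (norm \<xi>)\<^sup>2 \<le> (\<Sum>i\<in>UNIV. \<Sum>j\<in>UNIV. A i j * (\<xi> $ i) * (\<xi> $ j))"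
      "\<And>\<xi>::real^'n. (\<Sum>i\<in>UNIV. \<Sum>j\<in>UNIV. A i j * (\<xi> $ i) * (\<xi> $ j)) \<le> inverse k * (norm \<xi>)\<^sup>2"
    and b: "\<And>j. norm (b j) \<le> kB" and c: "norm c \<le> kC"
    and eq: "heat_form l V W =
    (\<Sum>i\<in>UNIV. \<Sum>j\<in>UNIV. of_real (A i j) * heat_form l (P j) (P i))
    - (\<Sum>j\<in>UNIV. b j * heat_form l (P j) W) - c * heat_form l W W"
  defines "Q \<equiv> \<Sum>i\<in>UNIV. Re (heat_form l (P i) (P i))"
    and "C \<equiv> real CARD('n) * kB\<^sup>2 / (2 * k) + kC"
  shows "0 \<le> Q"
    and "k / 2 * Q - C * Re (heat_form l W W) \<le> Re (heat_form l V W)"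
    and "Re (heat_form l V W) \<le> 2 / k * Q + C * Re (heat_form l W W)"
proof -
  define X where "X i = heat (l / 2) (P i)" for i
  define Y where "Y = heat (l / 2) W"
  have l2: "l / 2 > 0" using l by simp
  have X: "X i \<in> L2b" for i unfolding X_def by (intro heat_L2b l2 P)
  have Y: "Y \<in> L2b" unfolding Y_def by (intro heat_L2b l2 W)
  have h: "heat_form l (P j) (P i) = ip (X j) (X i)" "heat_form l (P j) W = ip (X j) Y"
    "heat_form l W W = of_real ((L2_norm Y)\<^sup>2)" for i j
    using ip_heat_heat[OF l2 P P] ip_heat_heat[OF l2 P W] heat_form_self[OF l W]
    by (simp_all add: X_def Y_def)
  have Q: "Q = (\<Sum>i\<in>UNIV. (L2_norm (X i))\<^sup>2)"
    unfolding Q_def h by (simp add: ip_self L2bD X)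
  show "0 \<le> Q" unfolding Q by (simp add: sum_nonneg)
  have kB: "0 \<le> kB" using order_trans[OF norm_ge_zero b] .
  let ?E = "Re (\<Sum>i\<in>UNIV. \<Sum>j\<in>UNIV. of_real (A i j) * ip (X j) (X i))"
  let ?L = "(\<Sum>j\<in>UNIV. b j * ip (X j) Y) + c * of_real ((L2_norm Y)\<^sup>2)"
  have E: "k * Q \<le> ?E" "?E \<le> inverse k * Q"
    unfolding Q using ip_elliptic_form[where X=X, OF X ell] by blast+
  have b_term: "norm (b j * ip (X j) Y) \<le> k / 2 * (L2_norm (X j))\<^sup>2 + kB\<^sup>2 / (2 * k) * (L2_norm Y)\<^sup>2" for j
  proof -
    have "norm (b j * ip (X j) Y) \<le> kB * (L2_norm (X j) * L2_norm Y)"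
      unfolding norm_mult using b kB by (intro mult_mono ip_bound X Y) auto
    moreover have "2 * (kB * (L2_norm (X j) * L2_norm Y)) \<le> k * (L2_norm (X j))\<^sup>2 + kB\<^sup>2 / k * (L2_norm Y)\<^sup>2"
      using sum_squares_bound[of "sqrt k * L2_norm (X j)" "kB / sqrt k * L2_norm Y"] k
      by (simp add: power_mult_distrib power_divide field_simps)
    moreover have "kB\<^sup>2 / (2 * k) * (L2_norm Y)\<^sup>2 = (kB\<^sup>2 / k * (L2_norm Y)\<^sup>2) / 2"
      by simp
    ultimately show ?thesis by linarith
  qed
  have "norm ?L \<le> (\<Sum>j\<in>UNIV. norm (b j * ip (X j) Y)) + norm (c * of_real ((L2_norm Y)\<^sup>2))"
    by (intro order_trans[OF norm_triangle_ineq] add_mono norm_sum order_refl)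
  also have "\<dots> \<le> (\<Sum>j\<in>(UNIV :: 'n set). k / 2 * (L2_norm (X j))\<^sup>2 + kB\<^sup>2 / (2 * k) * (L2_norm Y)\<^sup>2) + kC * (L2_norm Y)\<^sup>2"
    using c by (intro add_mono sum_mono b_term) (simp add: norm_mult norm_power mult_right_mono)
  also have "\<dots> = k / 2 * Q + C * (L2_norm Y)\<^sup>2"
    by (simp add: Q C_def sum.distrib sum_distrib_left distrib_right)
  finally have "\<bar>Re ?L\<bar> \<le> k / 2 * Q + C * (L2_norm Y)\<^sup>2"
    using abs_Re_le_cmod order_trans by blast
  moreover have "Re (heat_form l V W) = ?E - Re ?L"
    unfolding eq h by simp
  moreover have "inverse k * Q + k / 2 * Q \<le> 2 / k * Q"
  proof -
    have "k / 2 \<le> 1 / k"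
      using k mult_strict_mono[of k 1 k 1] by (simp add: field_simps)
    then have "k / 2 * Q \<le> 1 / k * Q" using \<open>0 \<le> Q\<close> by (rule mult_right_mono)
    then show ?thesis by (simp add: inverse_eq_divide)
  qed
  moreover have "Re (heat_form l W W) = (L2_norm Y)\<^sup>2" by (simp add: h)
  ultimately show "k / 2 * Q - C * Re (heat_form l W W) \<le> Re (heat_form l V W)"
    "Re (heat_form l V W) \<le> 2 / k * Q + C * Re (heat_form l W W)"
    using E by auto
qed


section \<open>The heat form along a path\<close>

lemma heat_form_commute:
  assumes "l > 0" "v \<in> L2b" "w \<in> L2b"
  shows "heat_form l v w = cnj (heat_form l w v)"
  using ip_heat_heat[of "l / 2" v w] ip_heat_heat[of "l / 2" w v] assms
    ip_commute[of "heat (l / 2) v" "heat (l / 2) w"] by simp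

lemma heat_form_diff_left:
  assumes "l > 0" "v \<in> L2b" "v' \<in> L2b" "w \<in> L2b"
  shows "heat_form l (\<lambda>x. v x - v' x) w = heat_form l v w - heat_form l v' w"
proof -
  have "ip (shift h (\<lambda>x. v x - v' x)) w = ip (shift h v) w - ip (shift h v') w" for h
  proof -
    have "shift h (\<lambda>x. v x - v' x) = (\<lambda>x. shift h v x - shift h v' x)" by (auto simp: shift_def)
    then show ?thesis by (simp only: ip_diff_left[OF L2b_shift[OF assms(2)] L2b_shift[OF assms(3)] assms(4)])
  qed
  then show ?thesis
    using integrable_mult_ip_shift[OF assms(2,4) integrable_gauss[OF assms(1)]]
      integrable_mult_ip_shift[OF assms(3,4) integrable_gauss[OF assms(1)]]
    by (simp add: heat_form_def right_diff_distrib)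
qed

lemma heat_form_cmult_left: "heat_form l (\<lambda>x. c * v x) w = c * heat_form l v w"
proof -
  have "ip (shift h (\<lambda>x. c * v x)) w = c * ip (shift h v) w" for h
    by (simp add: ip_def shift_def mult.assoc)
  then show ?thesis by (simp add: heat_form_def mult.left_commute)
qed

lemma heat_form_isCont:
  assumes "l > 0" "v \<in> L2b" "w \<in> L2b"
  shows "isCont (\<lambda>l. Re (heat_form l v w)) l"
  by (rule DERIV_isCont[OF heat_form_differentiate_under_integral[OF assms]])

text \<open>The mixed terms cancel in the real part because the form is Hermitian. The difference of
  the quadratic form thus becomes linear in the increment \<open>v - w\<close>, ready to be divided
  by a time step.\<close>

lemma Re_heat_form_self_diff:
  assumes l: "l > 0" and v: "v \<in> L2b" and w: "w \<in> L2b"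
  shows "Re (heat_form l v v) - Re (heat_form l w w) =
    Re (heat_form l (\<lambda>x. v x - w x) v) + Re (heat_form l (\<lambda>x. v x - w x) w)"
proof -
  have "Re (heat_form l v w) = Re (heat_form l w v)"
    using heat_form_commute[OF l v w] by simp
  then show ?thesis using heat_form_diff_left[OF l v w] v w by simp
qed

lemma L2_norm_le_add_diff:
  assumes "f \<in> L2b" "g \<in> L2b"
  shows "L2_norm f \<le> L2_norm g + L2_norm (\<lambda>x. f x - g x)"
  using L2_norm_triangle[OF assms(2) L2b_diff[OF assms]] by simp

text \<open>Joint continuity in both arguments and the scale. With \<open>D = U\<close> it gives
  continuity of the energy along the path; with \<open>D\<close> a difference quotient it gives the
  derivative.\<close>

lemma heat_form_path_tendsto:
  assumes U: "\<And>s. U s \<in> L2b" and V: "V \<in> L2b" and D: "\<And>s. D s \<in> L2b"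
    and Ulim: "((\<lambda>s. L2_norm (\<lambda>x. U s x - U t x)) \<longlongrightarrow> 0) F"
    and Dlim: "((\<lambda>s. L2_norm (\<lambda>x. D s x - V x)) \<longlongrightarrow> 0) F"
    and L: "(L \<longlongrightarrow> L t) F" "L t > 0"
  shows "((\<lambda>s. Re (heat_form (L s) (D s) (U s))) \<longlongrightarrow> Re (heat_form (L t) V (U t))) F"
proof -
  let ?e = "\<lambda>s. L2_norm (\<lambda>x. D s x - V x) * (L2_norm (U t) + L2_norm (\<lambda>x. U s x - U t x))
      + L2_norm V * L2_norm (\<lambda>x. U s x - U t x)"
  have pos: "eventually (\<lambda>s. L s > 0) F" using order_tendstoD(1)[OF L] .
  have "((\<lambda>s. Re (heat_form (L s) (D s) (U s)) - Re (heat_form (L s) V (U t))) \<longlongrightarrow> 0) F"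
  proof (rule Lim_null_comparison)
    show "eventually (\<lambda>s. norm (Re (heat_form (L s) (D s) (U s)) - Re (heat_form (L s) V (U t))) \<le> ?e s) F"
      using pos
    proof eventually_elim
      case (elim s)
      have a: "heat_form (L s) (D s) (U s) - heat_form (L s) V (U s) = heat_form (L s) (\<lambda>x. D s x - V x) (U s)"
        by (simp add: heat_form_diff_left[OF elim D V U])
      have b: "heat_form (L s) V (U s) - heat_form (L s) V (U t) = cnj (heat_form (L s) (\<lambda>x. U s x - U t x) V)"
        by (simp add: heat_form_diff_left[OF elim U U V] heat_form_commute[OF elim V U])
      have "norm (heat_form (L s) (D s) (U s) - heat_form (L s) V (U t)) \<le>
          norm (heat_form (L s) (\<lambda>x. D s x - V x) (U s)) + norm (heat_form (L s) (\<lambda>x. U s x - U t x) V)"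
        using norm_triangle_ineq[of "heat_form (L s) (D s) (U s) - heat_form (L s) V (U s)"
            "heat_form (L s) V (U s) - heat_form (L s) V (U t)"] by (simp add: a b) (simp add: a[symmetric] b[symmetric])
      also have "\<dots> \<le> L2_norm (\<lambda>x. D s x - V x) * L2_norm (U s) + L2_norm (\<lambda>x. U s x - U t x) * L2_norm V"
        by (intro add_mono heat_form_bound elim U V D L2b_diff)
      also have "\<dots> \<le> ?e s"
        using mult_left_mono[OF L2_norm_le_add_diff[OF U U, of s t], of "L2_norm (\<lambda>x. D s x - V x)"]
        by (simp add: mult.commute)
      finally have "norm (heat_form (L s) (D s) (U s) - heat_form (L s) V (U t)) \<le> ?e s" .
      then show ?case
        using abs_Re_le_cmod[of "heat_form (L s) (D s) (U s) - heat_form (L s) V (U t)"] by simp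
    qed
    have "(?e \<longlongrightarrow> 0 * (L2_norm (U t) + 0) + L2_norm V * 0) F"
      by (intro tendsto_intros Dlim Ulim)
    then show "(?e \<longlongrightarrow> 0) F" by simp
  qed
  moreover have "((\<lambda>s. Re (heat_form (L s) V (U t))) \<longlongrightarrow> Re (heat_form (L t) V (U t))) F"
    by (rule isCont_tendsto_compose[OF heat_form_isCont[OF L(2) V U] L(1)])
  ultimately have "((\<lambda>s. (Re (heat_form (L s) (D s) (U s)) - Re (heat_form (L s) V (U t))) + Re (heat_form (L s) V (U t)))
      \<longlongrightarrow> 0 + Re (heat_form (L t) V (U t))) F"
    by (rule tendsto_add)
  then show ?thesis by simp
qed

text \<open>Product rule: the increment is split into a change of \<open>U\<close> at the new scale,
  which yields twice the real part, and a change of scale at the fixed function \<open>U t\<close>.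
  Hence weak derivatives are needed at \<open>t\<close> only.\<close>

lemma heat_form_path_has_derivative:
  fixes U :: "real \<Rightarrow> real^'n \<Rightarrow> complex"
  assumes U: "\<And>s. U s \<in> L2b" and V: "V \<in> L2b"
    and lim: "((\<lambda>s. L2_norm (\<lambda>x. (U s x - U t x) / of_real (s - t) - V x)) \<longlongrightarrow> 0) (at t)"
    and P: "\<And>i. P i \<in> L2b" "\<And>i. has_weak_partial i (U t) (P i)"
    and L: "(L has_real_derivative m) (at t)" "L t > 0"
  shows "((\<lambda>s. Re (heat_form (L s) (U s) (U s))) has_real_derivative
    2 * Re (heat_form (L t) V (U t)) - m * (\<Sum>i\<in>UNIV. Re (heat_form (L t) (P i) (P i)))) (at t)"
proof -
  define D where "D s x = inverse (of_real (s - t)) * (U s x - U t x)" for s x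
  have D: "D s \<in> L2b" for s unfolding D_def[abs_def] by (intro L2b_cmult L2b_diff U)
  have Dlim: "((\<lambda>s. L2_norm (\<lambda>x. D s x - V x)) \<longlongrightarrow> 0) (at t)"
    using lim by (simp add: D_def divide_inverse mult.commute)
  have "((\<lambda>s. \<bar>s - t\<bar> * (L2_norm V + L2_norm (\<lambda>x. D s x - V x))) \<longlongrightarrow> \<bar>t - t\<bar> * (L2_norm V + 0)) (at t)"
    by (intro tendsto_intros Dlim)
  then have bound0: "((\<lambda>s. \<bar>s - t\<bar> * (L2_norm V + L2_norm (\<lambda>x. D s x - V x))) \<longlongrightarrow> 0) (at t)"
    by simp
  \<comment> \<open>Differentiability forces continuity: the increment is \<open>s - t\<close> times
    \<open>D s\<close>, whose norm stays bounded near \<open>t\<close>.\<close>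
  have Ulim: "((\<lambda>s. L2_norm (\<lambda>x. U s x - U t x)) \<longlongrightarrow> 0) (at t)"
  proof (rule Lim_null_comparison[OF _ bound0])
    show "eventually (\<lambda>s. norm (L2_norm (\<lambda>x. U s x - U t x)) \<le> \<bar>s - t\<bar> * (L2_norm V + L2_norm (\<lambda>x. D s x - V x))) (at t)"
      unfolding eventually_at_filter
    proof (intro always_eventually allI impI)
      fix s assume "s \<noteq> t"
      then have "(\<lambda>x. U s x - U t x) = (\<lambda>x. of_real (s - t) * D s x)" by (auto simp: D_def simp flip: of_real_diff)
      then have "L2_norm (\<lambda>x. U s x - U t x) = \<bar>s - t\<bar> * L2_norm (D s)"
        by (simp add: L2_norm_def norm_mult power_mult_distrib real_sqrt_mult flip: of_real_diff)
      then show "norm (L2_norm (\<lambda>x. U s x - U t x)) \<le> \<bar>s - t\<bar> * (L2_norm V + L2_norm (\<lambda>x. D s x - V x))"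
        using mult_left_mono[OF L2_norm_le_add_diff[OF D V], of "\<bar>s - t\<bar>" s] by simp
    qed
  qed
  have Lc: "(L \<longlongrightarrow> L t) (at t)" using DERIV_isCont[OF L(1)] by (simp add: isCont_def)
  have "((\<lambda>s. Re (heat_form (L s) (D s) (U s))) \<longlongrightarrow> Re (heat_form (L t) V (U t))) (at t)"
    by (rule heat_form_path_tendsto[OF U V D Ulim Dlim Lc L(2)])
  moreover have "((\<lambda>s. Re (heat_form (L s) (D s) (U t))) \<longlongrightarrow> Re (heat_form (L t) V (U t))) (at t)"
    by (rule heat_form_path_tendsto[where U="\<lambda>s. U t", OF U V D _ Dlim Lc L(2)]) (simp add: L2_norm_def)
  moreover have "((\<lambda>s. (Re (heat_form (L s) (U t) (U t)) - Re (heat_form (L t) (U t) (U t))) / (s - t)) \<longlongrightarrow>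
      - (\<Sum>i\<in>UNIV. Re (heat_form (L t) (P i) (P i))) * m) (at t)"
    using DERIV_chain2[OF heat_form_has_derivative_scale[OF L(2) U P] L(1)]
    unfolding has_field_derivative_iff .
  ultimately have "((\<lambda>s. Re (heat_form (L s) (D s) (U s)) + Re (heat_form (L s) (D s) (U t)) +
      (Re (heat_form (L s) (U t) (U t)) - Re (heat_form (L t) (U t) (U t))) / (s - t)) \<longlongrightarrow>
      Re (heat_form (L t) V (U t)) + Re (heat_form (L t) V (U t)) + - (\<Sum>i\<in>UNIV. Re (heat_form (L t) (P i) (P i))) * m) (at t)"
    by (intro tendsto_add)
  moreover have "eventually (\<lambda>s. Re (heat_form (L s) (D s) (U s)) + Re (heat_form (L s) (D s) (U t)) +
      (Re (heat_form (L s) (U t) (U t)) - Re (heat_form (L t) (U t) (U t))) / (s - t) =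
      (Re (heat_form (L s) (U s) (U s)) - Re (heat_form (L t) (U t) (U t))) / (s - t)) (at t)"
    using order_tendstoD(1)[OF Lc L(2)] eventually_neq_at_within[of t t UNIV]
  proof eventually_elim
    case (elim s)
    have "heat_form (L s) (D s) w = of_real (1 / (s - t)) * heat_form (L s) (\<lambda>x. U s x - U t x) w" for w
      using heat_form_cmult_left[of "L s" "inverse (of_real (s - t))" "\<lambda>x. U s x - U t x" w]
      by (simp add: D_def[abs_def] inverse_eq_divide)
    then have "Re (heat_form (L s) (D s) w) = Re (heat_form (L s) (\<lambda>x. U s x - U t x) w) / (s - t)" for w
      by (simp only: times_complex.sel Re_complex_of_real Im_complex_of_real) simp
    then show ?case
      using Re_heat_form_self_diff[OF elim(1) U[of s] U[of t]]
      by (simp add: add_divide_distrib[symmetric] diff_divide_distrib[symmetric])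
  qed
  ultimately have "((\<lambda>s. (Re (heat_form (L s) (U s) (U s)) - Re (heat_form (L t) (U t) (U t))) / (s - t)) \<longlongrightarrow>
      Re (heat_form (L t) V (U t)) + Re (heat_form (L t) V (U t)) + - (\<Sum>i\<in>UNIV. Re (heat_form (L t) (P i) (P i))) * m) (at t)"
    by (rule Lim_transform_eventually)
  then show ?thesis by (simp add: has_field_derivative_iff mult.commute)
qed

text \<open>The derivative exists at every interior point, while the inequality may fail on a null
  set. The fundamental theorem produces an integral of the derivative, and there the null set can be
  discarded. The sign of \<open>c\<close> is free, so passing to \<open>- f\<close> gives bounds
  from above.\<close>

lemma Gronwall_AE:
  fixes f :: "real \<Rightarrow> real"
  assumes ab: "a \<le> b" and cont: "continuous_on {a..b} f"
    and deriv: "\<And>t. t \<in> {a<..<b} \<Longrightarrow> (f has_real_derivative f' t) (at t)"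
    and N: "negligible N" and ineq: "\<And>t. t \<in> {a<..<b} - N \<Longrightarrow> - c * f t \<le> f' t"
  shows "exp (- c * (b - a)) * f a \<le> f b"
proof -
  let ?g = "\<lambda>t. exp (c * t) * f t"
  let ?g' = "\<lambda>t. exp (c * t) * (f' t + c * f t)"
  have "(?g' has_integral (?g b - ?g a)) {a..b}"
  proof (rule fundamental_theorem_of_calculus_interior[OF ab])
    show "continuous_on {a..b} ?g" by (intro continuous_intros cont)
    fix t assume "t \<in> {a<..<b}"
    from deriv[OF this] have "(?g has_real_derivative ?g' t) (at t)"
      by (auto intro!: derivative_eq_intros simp: algebra_simps)
    then show "(?g has_vector_derivative ?g' t) (at t)"
      by (simp add: has_real_derivative_iff_has_vector_derivative)
  qed
  \<comment> \<open>The endpoints join the null set because the inequality is known in the open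
    interval only.\<close>
  then have "((\<lambda>t. if t \<in> N \<union> {a, b} then 0 else ?g' t) has_integral (?g b - ?g a)) {a..b}"
    by (rule has_integral_spike[where S="N \<union> {a, b}", rotated 2]) (use N in auto)
  then have "0 \<le> ?g b - ?g a"
  proof (rule has_integral_nonneg)
    fix t assume "t \<in> {a..b}"
    then show "0 \<le> (if t \<in> N \<union> {a, b} then 0 else ?g' t)"
      using ineq[of t] by (auto intro!: mult_nonneg_nonneg)
  qed
  then have "exp (- c * b) * (exp (c * a) * f a) \<le> exp (- c * b) * (exp (c * b) * f b)"
    by (intro mult_left_mono) auto
  moreover have "exp (- c * b) * (exp (c * a) * f a) = exp (- c * b + c * a) * f a"
    by (simp only: exp_add mult.assoc)
  moreover have "- c * b + c * a = - c * (b - a)" by (simp add: algebra_simps)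
  moreover have "exp (- c * b) * (exp (c * b) * f b) = f b"
    by (simp add: exp_minus)
  ultimately show ?thesis by (simp only:)
qed


section \<open>Growth along solutions\<close>

lemma L2_norm_AE_cong_diff:
  assumes "AE x in lebesgue. f x = f' x" "AE x in lebesgue. g x = g' x"
    "f \<in> borel_measurable lebesgue" "f' \<in> borel_measurable lebesgue"
    "g \<in> borel_measurable lebesgue" "g' \<in> borel_measurable lebesgue"
  shows "L2_norm (\<lambda>x. f x - g x) = L2_norm (\<lambda>x. f' x - g' x)"
proof (rule L2_norm_AE_cong)
  show "AE x in lebesgue. f x - g x = f' x - g' x"
    using assms(1,2) by eventually_elim simp
qed (use assms in measurable)

text \<open>Replaces all the data by Borel representatives at once. The null set \<open>N\<close>
  contains the times at which the equation fails; it is independent of \<open>h\<close>, because at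
  each other time the equation holds for all test functions in \<open>H1\<close>
  simultaneously.\<close>

lemma H0_solution_obtain_L2b:
  fixes u :: "real \<Rightarrow> real^'n \<Rightarrow> complex"
  assumes u: "u \<in> H0_space T" and sol: "is_solution T a b c u"
  obtains U V P N where
    "\<And>s. U s \<in> L2b"
    "\<And>s. s \<in> {0..T} \<Longrightarrow> L2_norm (U s) = L2_norm (u s)"
    "\<And>t. t \<in> {0..T} \<Longrightarrow> ((\<lambda>s. L2_norm (\<lambda>x. U s x - U t x)) \<longlongrightarrow> 0) (at t within {0..T})"
    "\<And>t. V t \<in> L2b"
    "\<And>t. t \<in> {0<..<T} \<Longrightarrow>
       ((\<lambda>s. L2_norm (\<lambda>x. (U s x - U t x) / of_real (s - t) - V t x)) \<longlongrightarrow> 0) (at t)"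
    "\<And>t i. P t i \<in> L2b"
    "\<And>t i. t \<in> {0<..<T} \<Longrightarrow> has_weak_partial i (U t) (P t i)"
    "negligible N"
    "\<And>t h. t \<in> {0<..<T} - N \<Longrightarrow> ip (shift h (V t)) (U t) =
       (\<Sum>i\<in>UNIV. \<Sum>j\<in>UNIV. of_real (a i j t) * ip (shift h (P t j)) (P t i))
       - (\<Sum>j\<in>UNIV. b j t * ip (shift h (P t j)) (U t)) - c t * ip (shift h (U t)) (U t)"
proof -
  have u0: "u s \<in> L2" if "s \<in> {0..T}" for s using u that by (auto simp: H0_space_def C_L2_def)
  have uH: "u s \<in> H1" if "s \<in> {0..<T}" for s using u that by (auto simp: H0_space_def C_H1_def)
  define v where "v t = L2_deriv {0..<T} u t" for t
  have v: "has_L2_deriv u (v t) t {0..<T}" if "t \<in> {0..<T}" for t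
  proof -
    have "\<exists>v. has_L2_deriv u v t {0..<T}" using u that by (auto simp: H0_space_def C1_L2_def)
    from someI_ex[OF this] show ?thesis by (simp add: v_def L2_deriv_def)
  qed
  \<comment> \<open>A single total selection of representatives. Outside \<open>L2\<close> its value
    is just some element of \<open>L2b\<close>, so that \<open>U s\<close> and \<open>V s\<close>
    lie in \<open>L2b\<close> at every real time, also outside the time interval.\<close>
  have "\<exists>g. g \<in> L2b \<and> (f \<in> L2 \<longrightarrow> (AE x in lebesgue. f x = g x) \<and> L2_norm f = L2_norm g)"
    for f :: "real^'n \<Rightarrow> complex"
  proof (cases "f \<in> L2")
    case True
    then show ?thesis using L2_obtain_L2b[OF True] by blast
  next
    case False
    then show ?thesis using L2b_zero by blast
  qed
  from choice[OF allI[OF this]] obtain R where R: "\<forall>f :: real^'n \<Rightarrow> complex. R f \<in> L2b \<and>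
      (f \<in> L2 \<longrightarrow> (AE x in lebesgue. f x = R f x) \<and> L2_norm f = L2_norm (R f))"
    by (rule exE)
  define U where "U s = R (u s)" for s
  define V where "V s = R (v s)" for s
  have U: "U s \<in> L2b" "u s \<in> L2 \<Longrightarrow> (AE x in lebesgue. u s x = U s x) \<and> L2_norm (u s) = L2_norm (U s)" for s
    unfolding U_def using R[rule_format, of "u s"] by simp_all
  have V: "V t \<in> L2b" "v t \<in> L2 \<Longrightarrow> AE x in lebesgue. v t x = V t x" for t
    unfolding V_def using R[rule_format, of "v t"] by simp_all
  have um: "u s \<in> borel_measurable lebesgue" if "s \<in> {0..T}" for s using u0[OF that] by (simp add: L2_def)
  have Um: "U s \<in> borel_measurable lebesgue" for s using U(1) by (rule L2b_borel_lebesgue)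
  have Uae: "AE x in lebesgue. u s x = U s x" if "s \<in> {0..T}" for s using U(2) u0[OF that] by simp
  have vL: "v t \<in> L2" if "t \<in> {0<..<T}" for t using v[of t] that by (simp add: has_L2_deriv_def)
  have Ulim: "((\<lambda>s. L2_norm (\<lambda>x. U s x - U t x)) \<longlongrightarrow> 0) (at t within {0..T})" if t: "t \<in> {0..T}" for t
  proof -
    have "((\<lambda>s. L2_norm (\<lambda>x. u s x - u t x)) \<longlongrightarrow> 0) (at t within {0..T})"
      using u t by (simp add: H0_space_def C_L2_def)
    then show ?thesis
    proof (rule Lim_transform_eventually)
      show "eventually (\<lambda>s. L2_norm (\<lambda>x. u s x - u t x) = L2_norm (\<lambda>x. U s x - U t x)) (at t within {0..T})"
        unfolding eventually_at_filter using t
        by (intro always_eventually allI impI L2_norm_AE_cong_diff Uae um Um)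
    qed
  qed
  have Vlim: "((\<lambda>s. L2_norm (\<lambda>x. (U s x - U t x) / of_real (s - t) - V t x)) \<longlongrightarrow> 0) (at t)"
    if t: "t \<in> {0<..<T}" for t
  proof -
    \<comment> \<open>At an interior time the restriction to \<open>{0..<T}\<close> disappears, so
      the derivative is two-sided.\<close>
    have at: "at t within {0..<T} = at t"
      using t by (intro at_within_interior) (auto simp: interior_atLeastLessThan)
    have "((\<lambda>s. L2_norm (\<lambda>x. (u s x - u t x) / of_real (s - t) - v t x)) \<longlongrightarrow> 0) (at t within {0..<T})"
      using v[of t] t by (simp add: has_L2_deriv_def)
    then have "((\<lambda>s. L2_norm (\<lambda>x. (U s x - U t x) / of_real (s - t) - V t x)) \<longlongrightarrow> 0) (at t within {0..<T})"
    proof (rule Lim_transform_eventually)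
      have "L2_norm (\<lambda>x. (u s x - u t x) / of_real (s - t) - v t x) =
          L2_norm (\<lambda>x. (U s x - U t x) / of_real (s - t) - V t x)" if s: "s \<in> {0..<T}" for s
      proof (rule L2_norm_AE_cong_diff)
        have [measurable]: "u s \<in> borel_measurable lebesgue" "u t \<in> borel_measurable lebesgue"
          using s t by (auto intro!: um)
        note [measurable] = Um
        have "AE x in lebesgue. u s x = U s x" "AE x in lebesgue. u t x = U t x"
          using s t by (auto intro!: Uae)
        then show "AE x in lebesgue. (u s x - u t x) / of_real (s - t) = (U s x - U t x) / of_real (s - t)"
          by eventually_elim simp
        show "AE x in lebesgue. v t x = V t x" by (rule V(2)[OF vL[OF t]])
        show "(\<lambda>x. (u s x - u t x) / complex_of_real (s - t)) \<in> borel_measurable lebesgue"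
          "(\<lambda>x. (U s x - U t x) / complex_of_real (s - t)) \<in> borel_measurable lebesgue" by measurable
        show "v t \<in> borel_measurable lebesgue" using vL[OF t] by (simp add: L2_def)
        show "V t \<in> borel_measurable lebesgue" by (rule L2b_borel_lebesgue[OF V(1)])
      qed
      then show "eventually (\<lambda>s. L2_norm (\<lambda>x. (u s x - u t x) / of_real (s - t) - v t x) =
          L2_norm (\<lambda>x. (U s x - U t x) / of_real (s - t) - V t x)) (at t within {0..<T})"
        unfolding eventually_at_filter by (intro always_eventually allI impI)
    qed
    then show ?thesis unfolding at .
  qed
  have "\<exists>P. \<forall>i. P i \<in> L2b \<and> (t \<in> {0<..<T} \<longrightarrow> has_weak_partial i (U t) (P i))" for t
  proof (cases "t \<in> {0<..<T}")
    case True
    then have t: "t \<in> {0..T}" "t \<in> {0..<T}" by auto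
    obtain W P where W: "W \<in> L2b" "AE x in lebesgue. u t x = W x" "\<And>i. P i \<in> L2b"
      "\<And>i. has_weak_partial i W (P i)"
      using H1_obtain_L2b[OF uH[OF t(2)]] by blast
    have "AE x in lebesgue. W x = U t x" using W(2) Uae[OF t(1)] by eventually_elim simp
    then have "has_weak_partial i (U t) (P i)" for i
      by (intro has_weak_partial_AE_cong[OF _ _ Um _ _ _ W(4)] L2b_borel_lebesgue W) auto
    with W show ?thesis by blast
  next
    case False
    then show ?thesis using L2b_zero by (intro exI[of _ "\<lambda>i x. 0"] allI conjI impI) blast+
  qed
  then obtain P where P: "\<And>t i. P t i \<in> L2b" "\<And>t i. t \<in> {0<..<T} \<Longrightarrow> has_weak_partial i (U t) (P t i)"
    by metis
  obtain N where N0: "{t \<in> space lebesgue. \<not> (t \<in> {0<..<T} \<longrightarrow> (\<forall>\<phi>\<in>H1. L_op a b c t (v t) (u t) \<phi> = 0))} \<subseteq> N"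
    and "emeasure lebesgue N = 0" "N \<in> sets lebesgue"
    using sol unfolding is_solution_def v_def[symmetric] by (elim AE_E)
  then have N: "negligible N" by (simp add: negligible_iff_null_sets null_sets_def)
  have "ip (shift h (V t)) (U t) =
       (\<Sum>i\<in>UNIV. \<Sum>j\<in>UNIV. of_real (a i j t) * ip (shift h (P t j)) (P t i))
       - (\<Sum>j\<in>UNIV. b j t * ip (shift h (P t j)) (U t)) - c t * ip (shift h (U t)) (U t)"
    if t: "t \<in> {0<..<T} - N" for t h
  proof (rule L_op_tested_with_shift)
    show "u t \<in> borel_measurable lebesgue" "AE x in lebesgue. u t x = U t x"
      using t by (auto intro!: um Uae)
    show "v t \<in> borel_measurable lebesgue" using vL[of t] t by (simp add: L2_def)
    show "AE x in lebesgue. v t x = V t x" using t by (intro V(2) vL) auto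
    show "L_op a b c t (v t) (u t) \<phi> = 0" if "\<phi> \<in> H1" for \<phi>
      using t that N0 by auto
    show "has_weak_partial i (U t) (P t i)" for i using t by (intro P) auto
  qed (rule U V P)+
  moreover have "L2_norm (U s) = L2_norm (u s)" if "s \<in> {0..T}" for s
    using U(2) u0[OF that] by simp
  ultimately show ?thesis by (intro that[of U V P N] U(1) Ulim V(1) Vlim P N)
qed

text \<open>Moving the scale at speed \<open>m\<close> subtracts \<open>m\<close> times the gradient energy, which the equation
  produces at a rate between \<open>k\<close> and \<open>4 / k\<close>.\<close>

lemma heat_form_growth_along_solution:
  fixes U V :: "real \<Rightarrow> real^'n \<Rightarrow> complex" and P :: "real \<Rightarrow> 'n \<Rightarrow> real^'n \<Rightarrow> complex"
    and A :: "'n \<Rightarrow> 'n \<Rightarrow> real \<Rightarrow> real"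
  assumes U: "\<And>s. U s \<in> L2b"
    and Ulim: "\<And>t. t \<in> {0..T} \<Longrightarrow> ((\<lambda>s. L2_norm (\<lambda>x. U s x - U t x)) \<longlongrightarrow> 0) (at t within {0..T})"
    and V: "\<And>t. V t \<in> L2b"
    and Vlim: "\<And>t. t \<in> {0<..<T} \<Longrightarrow>
       ((\<lambda>s. L2_norm (\<lambda>x. (U s x - U t x) / of_real (s - t) - V t x)) \<longlongrightarrow> 0) (at t)"
    and P: "\<And>t i. P t i \<in> L2b" "\<And>t i. t \<in> {0<..<T} \<Longrightarrow> has_weak_partial i (U t) (P t i)"
    and N: "negligible N"
    and eq: "\<And>t h. t \<in> {0<..<T} - N \<Longrightarrow> ip (shift h (V t)) (U t) =
       (\<Sum>i\<in>UNIV. \<Sum>j\<in>UNIV. of_real (A i j t) * ip (shift h (P t j)) (P t i))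
       - (\<Sum>j\<in>UNIV. b j t * ip (shift h (P t j)) (U t)) - c t * ip (shift h (U t)) (U t)"
    and k: "0 < k" "k < 1"
    and ell: "\<And>t \<xi>::real^'n. t \<in> {0..T} \<Longrightarrow>
        k * (norm \<xi>)\<^sup>2 \<le> (\<Sum>i\<in>UNIV. \<Sum>j\<in>UNIV. A i j t * (\<xi> $ i) * (\<xi> $ j))"
      "\<And>t \<xi>::real^'n. t \<in> {0..T} \<Longrightarrow>
        (\<Sum>i\<in>UNIV. \<Sum>j\<in>UNIV. A i j t * (\<xi> $ i) * (\<xi> $ j)) \<le> inverse k * (norm \<xi>)\<^sup>2"
    and b: "\<And>t j. t \<in> {0..T} \<Longrightarrow> norm (b j t) \<le> kB" and c: "\<And>t. t \<in> {0..T} \<Longrightarrow> norm (c t) \<le> kC"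
    and z: "0 \<le> z" "z \<le> T" and L: "\<And>s. s \<in> {z..T} \<Longrightarrow> 0 < \<alpha> + m * s"
  defines "C \<equiv> 2 * (real CARD('n) * kB\<^sup>2 / (2 * k) + kC)"
    and "E \<equiv> \<lambda>s. Re (heat_form (\<alpha> + m * s) (U s) (U s))"
  shows "m \<le> k \<Longrightarrow> exp (- C * (T - z)) * E z \<le> E T"
    and "4 / k \<le> m \<Longrightarrow> E T \<le> exp (C * (T - z)) * E z"
proof -
  define Q where "Q t = (\<Sum>i\<in>UNIV. Re (heat_form (\<alpha> + m * t) (P t i) (P t i)))" for t
  define E' where "E' t = 2 * Re (heat_form (\<alpha> + m * t) (V t) (U t)) - m * Q t" for t
  have cont: "continuous_on {z..T} E"
    unfolding continuous_on_def E_def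
  proof
    fix t assume t: "t \<in> {z..T}"
    have "((\<lambda>s. L2_norm (\<lambda>x. U s x - U t x)) \<longlongrightarrow> 0) (at t within {z..T})"
      using tendsto_within_subset[OF Ulim[of t], of "{z..T}"] t z by auto
    then show "((\<lambda>s. Re (heat_form (\<alpha> + m * s) (U s) (U s))) \<longlongrightarrow> Re (heat_form (\<alpha> + m * t) (U t) (U t))) (at t within {z..T})"
      by (intro heat_form_path_tendsto[where L="\<lambda>s. \<alpha> + m * s"] U L t) (auto intro!: tendsto_intros)
  qed
  have deriv: "(E has_real_derivative E' t) (at t)" if t: "t \<in> {z<..<T}" for t
    unfolding E_def E'_def Q_def
  proof (rule heat_form_path_has_derivative[where L="\<lambda>s. \<alpha> + m * s"])
    show "((\<lambda>s. \<alpha> + m * s) has_real_derivative m) (at t)" by (auto intro!: derivative_eq_intros)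
    show "((\<lambda>s. L2_norm (\<lambda>x. (U s x - U t x) / of_real (s - t) - V t x)) \<longlongrightarrow> 0) (at t)"
      using t z by (intro Vlim) auto
    show "has_weak_partial i (U t) (P t i)" for i using t z by (intro P) auto
  qed (use t in \<open>auto intro!: U V P L\<close>)
  have bounds: "0 \<le> Q t" "k * Q t - C * E t \<le> 2 * Re (heat_form (\<alpha> + m * t) (V t) (U t))"
    "2 * Re (heat_form (\<alpha> + m * t) (V t) (U t)) \<le> 4 / k * Q t + C * E t"
    if t: "t \<in> {z<..<T} - N" for t
  proof -
    have t': "t \<in> {0..T}" "t \<in> {0<..<T} - N" and l: "0 < \<alpha> + m * t" using t z L by auto
    note e = heat_form_energy_bounds[OF l U P(1) k ell[OF t'(1)] b[OF t'(1)] c[OF t'(1)]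
        heat_form_equation[OF l U P(1) V eq[OF t'(2)]]]
    have C2: "C * E t = 2 * ((real CARD('n) * kB\<^sup>2 / (2 * k) + kC) * E t)" by (simp add: C_def)
    show "0 \<le> Q t" "k * Q t - C * E t \<le> 2 * Re (heat_form (\<alpha> + m * t) (V t) (U t))"
      "2 * Re (heat_form (\<alpha> + m * t) (V t) (U t)) \<le> 4 / k * Q t + C * E t"
      using e[folded Q_def E_def] unfolding C2 unfolding E_def by simp_all
  qed
  show "exp (- C * (T - z)) * E z \<le> E T" if m: "m \<le> k"
  proof (rule Gronwall_AE[OF z(2) cont deriv N])
    fix t assume t: "t \<in> {z<..<T} - N"
    show "- C * E t \<le> E' t"
      using bounds(2)[OF t] mult_right_mono[OF m bounds(1)[OF t]] by (simp add: E'_def)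
  qed
  show "E T \<le> exp (C * (T - z)) * E z" if m: "4 / k \<le> m"
  proof -
    \<comment> \<open>The upper bound is the lower one for \<open>- E\<close> with the constant
      \<open>- C\<close>.\<close>
    have "exp (- (- C) * (T - z)) * (- E z) \<le> - E T"
    proof (rule Gronwall_AE[where f="\<lambda>t. - E t" and f'="\<lambda>t. - E' t", OF z(2) _ _ N])
      fix t assume t: "t \<in> {z<..<T} - N"
      show "- (- C) * (- E t) \<le> - E' t"
        using bounds(3)[OF t] mult_right_mono[OF m bounds(1)[OF t]] by (simp add: E'_def)
    qed (auto intro!: continuous_intros cont DERIV_minus deriv)
    then show ?thesis by simp
  qed
qed

text \<open>Iterates \<open>heat_form_midpoint\<close>, halving the scale each time. Powers in place
  of roots keep the exponents natural; both sides have degree 2^n in the squared size of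
  \<open>v\<close>.\<close>

lemma heat_form_dyadic:
  assumes v: "v \<in> L2b" and M: "M > 0"
  shows "Re (heat_form (M / 2 ^ n) v v) ^ 2 ^ n \<le> Re (heat_form M v v) * (L2_norm v)\<^sup>2 ^ (2 ^ n - 1)"
proof (induction n)
  case (Suc n)
  define E where "E n = Re (heat_form (M / 2 ^ n) v v)" for n
  have E0: "0 \<le> E n" for n using heat_form_self[of "M / 2 ^ n" v] v M by (simp add: E_def)
  have "(E (Suc n))\<^sup>2 \<le> E n * (L2_norm v)\<^sup>2"
    using heat_form_midpoint[of "M / 2 ^ Suc n" v] v M by (simp add: E_def)
  then have "(E (Suc n))\<^sup>2 ^ 2 ^ n \<le> (E n * (L2_norm v)\<^sup>2) ^ 2 ^ n"
    by (intro power_mono) auto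
  also have "\<dots> = E n ^ 2 ^ n * (L2_norm v)\<^sup>2 ^ 2 ^ n" by (rule power_mult_distrib)
  also have "\<dots> \<le> Re (heat_form M v v) * (L2_norm v)\<^sup>2 ^ (2 ^ n - 1) * (L2_norm v)\<^sup>2 ^ 2 ^ n"
    using Suc.IH by (intro mult_right_mono) (auto simp: E_def)
  also have "\<dots> = Re (heat_form M v v) * (L2_norm v)\<^sup>2 ^ (2 ^ n - 1 + 2 ^ n)"
    by (simp only: power_add mult.assoc)
  also have "2 ^ n - 1 + 2 ^ n = (2 :: nat) ^ Suc n - 1"
    using one_le_power[of "2::nat" n] by simp
  also have "(E (Suc n))\<^sup>2 ^ 2 ^ n = E (Suc n) ^ 2 ^ Suc n"
    by (simp flip: power_mult)
  finally show ?case by (simp add: E_def)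
qed simp

lemma solution_Hoelder_estimate:
  fixes a :: "'n::finite \<Rightarrow> 'n \<Rightarrow> real \<Rightarrow> real"
  assumes T: "0 < T" and S: "structural_assms T a b c" and T': "0 < T'" "T' < T" and D: "D > 0"
  shows "\<exists>K>0. \<exists>\<theta>>0. \<forall>u :: real \<Rightarrow> real^'n \<Rightarrow> complex.
      u \<in> H0_space T \<longrightarrow> is_solution T a b c u \<longrightarrow> (\<forall>t\<in>{0..T}. L2_norm (u t) \<le> D) \<longrightarrow>
      (\<forall>z\<in>{0..T'}. (L2_norm (u z))\<^sup>2 \<le> K * (L2_norm (u 0))\<^sup>2 powr \<theta>)"
proof -
  obtain k where k: "0 < k" "k < 1"
    and ell: "\<And>t \<xi>::real^'n. t \<in> {0..T} \<Longrightarrow>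
        k * (norm \<xi>)\<^sup>2 \<le> (\<Sum>i\<in>UNIV. \<Sum>j\<in>UNIV. a i j t * (\<xi> $ i) * (\<xi> $ j))"
      "\<And>t \<xi>::real^'n. t \<in> {0..T} \<Longrightarrow>
        (\<Sum>i\<in>UNIV. \<Sum>j\<in>UNIV. a i j t * (\<xi> $ i) * (\<xi> $ j)) \<le> inverse k * (norm \<xi>)\<^sup>2"
    using S unfolding structural_assms_def by blast
  obtain kB where kB: "kB > 0" "\<And>i t. t \<in> {0..T} \<Longrightarrow> norm (b i t) \<le> kB"
    using S unfolding structural_assms_def by blast
  obtain kC where kC: "kC > 0" "\<And>t. t \<in> {0..T} \<Longrightarrow> norm (c t) \<le> kC"
    using S unfolding structural_assms_def by blast
  define C where "C = 2 * (real CARD('n) * kB\<^sup>2 / (2 * k) + kC)"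
  have C: "C \<ge> 0" using k kC by (simp add: C_def)
  \<comment> \<open>The scale reached at time \<open>T\<close> by the fast path, which starts from 1
    at time 0 and has the slope 4/k that makes the energy decrease up to an exponential
    factor.\<close>
  define M where "M = 1 + 4 / k * T"
  have M: "M > 0" using k T by (simp add: M_def add_pos_nonneg)
  \<comment> \<open>A slow path with slope at most \<open>k\<close> can rise by k (T - z) on [z, T],
    and k (T - z) >= k (T - T'). So many halvings bring \<open>M\<close> below this allowance, for
    all \<open>z\<close> at once.\<close>
  obtain n where n: "M / (k * (T - T')) < 2 ^ n" using real_arch_pow[of 2] by auto
  have "k * (T - T') > 0" using k T' by simp
  with n have n': "M / 2 ^ n \<le> k * (T - T')" by (simp add: field_simps)
  define \<Lambda> where "\<Lambda> = M / 2 ^ n"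
  have \<Lambda>: "\<Lambda> > 0" "\<Lambda> \<le> k * (T - T')" using M n' by (simp_all add: \<Lambda>_def)
  \<comment> \<open>The factor \<open>exp (C * T)\<close> of the slow path is raised to the power
    2^n by the interpolation, that of the fast path occurs once, and \<open>D\<close> bounds the
    norm of u(T).\<close>
  define K where "K = exp (C * T) ^ 2 ^ n * (exp (C * T) * (D\<^sup>2) ^ (2 ^ n - 1))"
  have K: "K > 0" using D by (simp add: K_def)
  define \<theta> where "\<theta> = 1 / real (2 ^ n)"
  have "(L2_norm (u z))\<^sup>2 \<le> (K powr \<theta>) * (L2_norm (u 0))\<^sup>2 powr \<theta>"
    if u: "u \<in> H0_space T" and sol: "is_solution T a b c u"
      and uD: "\<forall>t\<in>{0..T}. L2_norm (u t) \<le> D" and z: "z \<in> {0..T'}"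
    for u :: "real \<Rightarrow> real^'n \<Rightarrow> complex" and z
  proof -
    obtain U V P N where U: "\<And>s. U s \<in> L2b"
      and Un: "\<And>s. s \<in> {0..T} \<Longrightarrow> L2_norm (U s) = L2_norm (u s)"
      and rest: "\<And>t. t \<in> {0..T} \<Longrightarrow> ((\<lambda>s. L2_norm (\<lambda>x. U s x - U t x)) \<longlongrightarrow> 0) (at t within {0..T})"
      "\<And>t. V t \<in> L2b"
      "\<And>t. t \<in> {0<..<T} \<Longrightarrow>
         ((\<lambda>s. L2_norm (\<lambda>x. (U s x - U t x) / of_real (s - t) - V t x)) \<longlongrightarrow> 0) (at t)"
      "\<And>t i. P t i \<in> L2b"
      "\<And>t i. t \<in> {0<..<T} \<Longrightarrow> has_weak_partial i (U t) (P t i)"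
      "negligible N"
      "\<And>t h. t \<in> {0<..<T} - N \<Longrightarrow> ip (shift h (V t)) (U t) =
         (\<Sum>i\<in>UNIV. \<Sum>j\<in>UNIV. of_real (a i j t) * ip (shift h (P t j)) (P t i))
         - (\<Sum>j\<in>UNIV. b j t * ip (shift h (P t j)) (U t)) - c t * ip (shift h (U t)) (U t)"
      using H0_solution_obtain_L2b[OF u sol] by blast
    note growth = heat_form_growth_along_solution[OF U rest k ell kB(2) kC(2), folded C_def]
    define E where "E l = Re (heat_form l (U T) (U T))" for l
    have E0: "0 \<le> E l" if "l > 0" for l using heat_form_self[OF that U] by (simp add: E_def)
    have zT: "0 \<le> z" "z < T" "z \<in> {0..T}" using z T' by auto

    have EM: "E M \<le> exp (C * T) * (L2_norm (u 0))\<^sup>2"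
    proof -
      have "E M \<le> exp (C * (T - 0)) * Re (heat_form (1 + 4 / k * 0) (U 0) (U 0))"
        unfolding E_def M_def
      proof (rule growth(2))
        show "0 < 1 + 4 / k * s" if "s \<in> {0..T}" for s using that k by (auto intro!: add_pos_nonneg)
      qed (use T in auto)
      also have "\<dots> \<le> exp (C * (T - 0)) * (L2_norm (U 0) * L2_norm (U 0))"
        using heat_form_bound[of 1 "U 0" "U 0"] U complex_Re_le_cmod order_trans
        by (intro mult_left_mono) (auto intro: order_trans[OF complex_Re_le_cmod])
      finally show ?thesis using Un[of 0] T by (simp add: power2_eq_square)
    qed

    have "exp (- C * (T - z)) * (L2_norm (U z))\<^sup>2 \<le> E \<Lambda>"
    proof -
      \<comment> \<open>The slow path should start at scale 0, where the Gaussian kernel makes no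
        sense; it starts at positive scales instead, which then tend to 0.\<close>
      define l where "l j = \<Lambda> / real (Suc (Suc j))" for j
      have l: "0 < l j" "l j \<le> \<Lambda>" for j using \<Lambda>(1) by (auto simp: l_def field_simps)
      have bound: "exp (- C * (T - z)) * Re (heat_form (l j) (U z) (U z)) \<le> E \<Lambda>" for j
      proof -
        \<comment> \<open>Slope of the straight path from \<open>l j\<close> at time
          \<open>z\<close> to \<open>\<Lambda>\<close> at time \<open>T\<close>; the choice of
          \<open>n\<close> keeps it below \<open>k\<close>.\<close>
        define m where "m = (\<Lambda> - l j) / (T - z)"
        have m: "0 \<le> m" "m * (T - z) = \<Lambda> - l j" using l[of j] zT by (auto simp: m_def)
        have "k * (T - T') \<le> k * (T - z)" using z k by (intro mult_left_mono) auto
        with \<Lambda>(2) l(1)[of j] have "\<Lambda> - l j \<le> k * (T - z)" by linarith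
        then have mk: "m \<le> k" using zT by (simp add: m_def divide_le_eq)
        have ends: "l j - m * z + m * z = l j" "l j - m * z + m * T = \<Lambda>"
          using m(2) by (auto simp: algebra_simps)
        have "exp (- C * (T - z)) * Re (heat_form (l j - m * z + m * z) (U z) (U z)) \<le>
            Re (heat_form (l j - m * z + m * T) (U T) (U T))"
        proof (rule growth(1))
          show "0 < l j - m * z + m * s" if "s \<in> {z..T}" for s
            using mult_left_mono[of z s m] that m(1) l(1)[of j] by auto
        qed (use zT mk in auto)
        then show ?thesis unfolding ends E_def .
      qed
      have lim: "(\<lambda>j. exp (- C * (T - z)) * Re (heat_form (l j) (U z) (U z))) \<longlonglongrightarrow>
          exp (- C * (T - z)) * Re (ip (U z) (U z))"
      proof (intro tendsto_intros heat_form_tendsto_0 U l)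
        have "(\<lambda>j. \<Lambda> * (1 / real (Suc (Suc j)))) \<longlonglongrightarrow> \<Lambda> * 0"
          by (intro tendsto_intros LIMSEQ_Suc[OF LIMSEQ_Suc[OF lim_1_over_n]])
        then show "l \<longlonglongrightarrow> 0" by (simp add: l_def[abs_def])
      qed
      have "exp (- C * (T - z)) * Re (ip (U z) (U z)) \<le> E \<Lambda>"
        by (rule LIMSEQ_le_const2[OF lim]) (use bound in blast)
      then show ?thesis by (simp add: ip_self[OF L2bD(1)[OF U]])
    qed
    then have "exp (C * (T - z)) * (exp (- C * (T - z)) * (L2_norm (U z))\<^sup>2) \<le> exp (C * (T - z)) * E \<Lambda>"
      by (intro mult_left_mono) auto
    then have "(L2_norm (U z))\<^sup>2 \<le> exp (C * (T - z)) * E \<Lambda>"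
      by (simp add: mult.assoc[symmetric] exp_add[symmetric])
    also have "\<dots> \<le> exp (C * T) * E \<Lambda>"
      using C zT E0[OF \<Lambda>(1)] by (intro mult_right_mono) (auto intro!: mult_left_mono)
    finally have Ez: "(L2_norm (u z))\<^sup>2 \<le> exp (C * T) * E \<Lambda>" using Un[OF zT(3)] by simp

    have "((L2_norm (u z))\<^sup>2) ^ 2 ^ n \<le> (exp (C * T) * E \<Lambda>) ^ 2 ^ n"
      by (intro power_mono Ez) simp
    also have "\<dots> = exp (C * T) ^ 2 ^ n * E \<Lambda> ^ 2 ^ n" by (rule power_mult_distrib)
    also have "\<dots> \<le> exp (C * T) ^ 2 ^ n * (E M * (L2_norm (U T))\<^sup>2 ^ (2 ^ n - 1))"
      using heat_form_dyadic[where n=n, OF U[of T] M] by (intro mult_left_mono) (auto simp: E_def \<Lambda>_def)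
    also have "\<dots> \<le> exp (C * T) ^ 2 ^ n * (exp (C * T) * (L2_norm (u 0))\<^sup>2 * (D\<^sup>2) ^ (2 ^ n - 1))"
    proof (intro mult_left_mono mult_mono EM power_mono)
      show "L2_norm (U T) \<le> D" using Un[of T] uD T by simp
    qed auto
    also have "\<dots> = K * (L2_norm (u 0))\<^sup>2" by (simp add: K_def mult_ac)
    finally have "((L2_norm (u z))\<^sup>2) ^ 2 ^ n \<le> K * (L2_norm (u 0))\<^sup>2" .
    then have "(((L2_norm (u z))\<^sup>2) ^ 2 ^ n) powr \<theta> \<le> (K * (L2_norm (u 0))\<^sup>2) powr \<theta>"
      by (intro powr_mono2) (auto simp: \<theta>_def)
    also have "(((L2_norm (u z))\<^sup>2) ^ 2 ^ n) powr \<theta> = (L2_norm (u z))\<^sup>2"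
    \<comment> \<open>Rewriting a natural power as \<open>powr\<close> requires a positive base, so
      norm zero is a case of its own.\<close>
    proof (cases "L2_norm (u z) = 0")
      case False
      then have "0 < (L2_norm (u z))\<^sup>2" by simp
      then show ?thesis by (simp add: \<theta>_def powr_powr flip: powr_realpow)
    qed simp
    finally show ?thesis using K by (simp add: powr_mult)
  qed
  moreover have "K powr \<theta> > 0" "\<theta> > 0" using K by (simp_all add: \<theta>_def)
  ultimately show ?thesis by blast
qed

text \<open>Put y = - ln x. Half of the exponent \<theta> absorbs \<open>K\<close>, as ln K <=
  \<theta> y / 2. The other half beats the double exponential: y >= e gives ln y >= 1, so the square
  root of ln y is at most ln y and its exponential at most y.\<close>

lemma powr_le_double_exp:
  fixes K \<theta> x :: real
  assumes K: "K > 0" and \<theta>: "\<theta> > 0" and x: "x > 0" and L: "exp 1 \<le> - ln x" "2 * ln K / \<theta> \<le> - ln x"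
  shows "K * x powr \<theta> \<le> exp (- (\<theta> / 2) * exp (ln (- ln x) powr (1 / 2)))"
proof -
  define y where "y = - ln x"
  have y: "exp 1 \<le> y" "2 * ln K / \<theta> \<le> y" "y > 0"
    using L less_le_trans[OF exp_gt_zero L(1)] by (simp_all add: y_def)
  have "1 \<le> ln y" using y by (simp add: ln_ge_iff)
  then have "ln y powr (1 / 2) \<le> ln y powr 1" by (intro powr_mono) auto
  then have "exp (ln y powr (1 / 2)) \<le> y" using \<open>1 \<le> ln y\<close> y(3) by (simp add: ln_ge_iff[symmetric])
  then have "\<theta> / 2 * exp (ln y powr (1 / 2)) \<le> \<theta> / 2 * y" using \<theta> by (intro mult_left_mono) auto
  moreover have "ln K \<le> \<theta> / 2 * y" using y(2) \<theta> by (simp add: field_simps)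
  ultimately have "ln K + \<theta> * ln x \<le> - (\<theta> / 2) * exp (ln y powr (1 / 2))"
    by (simp add: y_def field_simps)
  then have "exp (ln K + \<theta> * ln x) \<le> exp (- (\<theta> / 2) * exp (ln y powr (1 / 2)))" by simp
  then show ?thesis using K x by (simp add: exp_add powr_def y_def)
qed

theorem mainTheorem2:
  fixes T :: real
    and a :: "'n::finite \<Rightarrow> 'n \<Rightarrow> real \<Rightarrow> real"
    and b :: "'n \<Rightarrow> real \<Rightarrow> complex"
    and c :: "real \<Rightarrow> complex"
  assumes "0 < T"
    and "structural_assms T a b c"
  shows "\<forall>T'\<in>{0<..<T}. \<forall>D>0. \<exists>\<rho>>0. \<exists>\<sigma>>0. \<exists>\<tau>>0. \<exists>\<delta>\<in>{0<..<1}.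
    \<forall>u :: real \<Rightarrow> real^'n \<Rightarrow> complex.
      u \<in> H0_space T \<longrightarrow> is_solution T a b c u \<longrightarrow>
      (\<forall>t\<in>{0..T}. L2_norm (u t) \<le> D) \<longrightarrow> L2_norm (u 0) \<le> \<rho> \<longrightarrow>
      (SUP z\<in>{0..T'}. (L2_norm (u z))\<^sup>2) \<le>
        (if L2_norm (u 0) = 0 then 0
         else exp (- \<sigma> * exp ((ln (1 / (2 * \<tau>) * \<bar>ln ((L2_norm (u 0))\<^sup>2)\<bar>)) powr \<delta>)))"
proof (intro ballI allI impI)
  fix T' D :: real assume T': "T' \<in> {0<..<T}" and D: "D > 0"
  then have T'': "0 < T'" "T' < T" by auto
  obtain K \<theta> where K: "K > 0" and \<theta>: "\<theta> > 0"
    and est: "\<forall>u :: real \<Rightarrow> real^'n \<Rightarrow> complex.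
      u \<in> H0_space T \<longrightarrow> is_solution T a b c u \<longrightarrow> (\<forall>t\<in>{0..T}. L2_norm (u t) \<le> D) \<longrightarrow>
      (\<forall>z\<in>{0..T'}. (L2_norm (u z))\<^sup>2 \<le> K * (L2_norm (u 0))\<^sup>2 powr \<theta>)"
    using solution_Hoelder_estimate[OF assms T'' D] by blast
  \<comment> \<open>A norm of u(0) up to \<open>exp (- R / 2)\<close> means that minus the logarithm
    of its square is at least \<open>R\<close>, which covers both smallness conditions of
    \<open>powr_le_double_exp\<close>.\<close>
  define R where "R = max (exp 1) (2 * ln K / \<theta>)"
  have main: "(SUP z\<in>{0..T'}. (L2_norm (u z))\<^sup>2) \<le>
        (if L2_norm (u 0) = 0 then 0
         else exp (- (\<theta> / 2) * exp ((ln (1 / (2 * (1 / 2)) * \<bar>ln ((L2_norm (u 0))\<^sup>2)\<bar>)) powr (1 / 2))))"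
    if u: "u \<in> H0_space T" "is_solution T a b c u" "\<forall>t\<in>{0..T}. L2_norm (u t) \<le> D"
      and small: "L2_norm (u 0) \<le> exp (- R / 2)" for u :: "real \<Rightarrow> real^'n \<Rightarrow> complex"
  proof (rule cSUP_least)
    fix z assume z: "z \<in> {0..T'}"
    show "(L2_norm (u z))\<^sup>2 \<le> (if L2_norm (u 0) = 0 then 0
         else exp (- (\<theta> / 2) * exp ((ln (1 / (2 * (1 / 2)) * \<bar>ln ((L2_norm (u 0))\<^sup>2)\<bar>)) powr (1 / 2))))"
    proof (cases "L2_norm (u 0) = 0")
      case True
      \<comment> \<open>Since \<open>0 powr \<theta> = 0\<close>, the Hoelder bound itself forces
        the norm of u(z) to vanish.\<close>
      then show ?thesis using est[rule_format, OF u(1,2) u(3)[rule_format] z] by simp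
    next
      case False
      define x where "x = (L2_norm (u 0))\<^sup>2"
      have x: "x > 0" using False by (simp add: x_def)
      have "x \<le> (exp (- R / 2))\<^sup>2" unfolding x_def using small by (intro power_mono) auto
      also have "\<dots> = exp (- R)" by (simp add: power2_eq_square flip: exp_add)
      finally have "ln x \<le> ln (exp (- R))" using x by (subst ln_le_cancel_iff) auto
      then have R: "R \<le> - ln x" by simp
      then have L: "exp 1 \<le> - ln x" "2 * ln K / \<theta> \<le> - ln x" by (simp_all add: R_def)
      then have "\<bar>ln x\<bar> = - ln x" using exp_gt_zero[of "1::real"] by linarith
      then show ?thesis
        using order_trans[OF est[rule_format, OF u(1,2) u(3)[rule_format] z] powr_le_double_exp[OF K \<theta> x L, unfolded x_def]] False
        by (simp add: x_def)
    qed
  qed (use T' in auto)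
  show "\<exists>\<rho>>0. \<exists>\<sigma>>0. \<exists>\<tau>>0. \<exists>\<delta>\<in>{0<..<1}.
    \<forall>u :: real \<Rightarrow> real^'n \<Rightarrow> complex.
      u \<in> H0_space T \<longrightarrow> is_solution T a b c u \<longrightarrow>
      (\<forall>t\<in>{0..T}. L2_norm (u t) \<le> D) \<longrightarrow> L2_norm (u 0) \<le> \<rho> \<longrightarrow>
      (SUP z\<in>{0..T'}. (L2_norm (u z))\<^sup>2) \<le>
        (if L2_norm (u 0) = 0 then 0
         else exp (- \<sigma> * exp ((ln (1 / (2 * \<tau>) * \<bar>ln ((L2_norm (u 0))\<^sup>2)\<bar>)) powr \<delta>)))"
  \<comment> \<open>\<tau> = 1/2 turns the factor 1 / (2 \<tau>) into 1, \<sigma> = \<theta>/2 is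
    the half of the Hoelder exponent not spent on \<open>K\<close>, and \<delta> = 1/2 is one
    convenient value in ]0,1[.\<close>
  proof (rule exI[of _ "exp (- R / 2)"], rule conjI, simp, rule exI[of _ "\<theta> / 2"], rule conjI, use \<theta> in simp,
      rule exI[of _ "1 / 2"], rule conjI, simp, rule bexI[of _ "1 / 2"], intro allI impI, rule main)
  qed auto
qed

end
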